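(* Let $K$ be a closed subset of $G$. Then for any $f\in\mathcal{L}(\mathcal{X}_K)$, any $x_{P(K)}\in\mathcal{X}_{P(K)}$ and any $g\in\mathcal{L}(\mathcal{X}_{N'(K)})$ with $g\geq 0$, writing $a:=\underline{E}^{\mathrm{irr}}_{K\mid x_{P(K)}}(f(X_K))$ and $\phi:=g(X_{N'(K)})\mathbb{I}_{x_{P(K)}}(X_{P(K)})$: $$\underline{E}^{\mathrm{irr}}_G\big(\phi\, f(X_K)\big)=\begin{cases} a\,\underline{E}^{\mathrm{irr}}_{N(K)}(\phi) & \text{if } a\geq 0,\\ a\,\overline{E}^{\mathrm{irr}}_{N(K)}(\phi) & \text{if } a\leq 0.\end{cases}$$
   Context: Setting: $G$ is a finite set of nodes forming a DAG; node $s$ carries a variable $X_s$ with finite nonempty state space $\mathcal{X}_s$; $\mathcal{X}_S=\times_{s\in S}\mathcal{X}_s$; $\mathcal{L}(\mathcal{X}_S)$: real-valued functions on $\mathcal{X}_S$; $\mathbb{I}_{x_{P(K)}}$: indicator of $\{x_{P(K)}\}$. $P(s)$: parents; $s\sqsubseteq v$: directed path (possibly trivial) from $s$ to $v$; $s\sqsubset v$: additionally $s\neq v$; $D(s)=\{v:s\sqsubset v\}$; $N(s)=G\setminus(\{s\}\cup D(s))$. For $K\subseteq G$: $P(K)=(\bigcup_{s\in K}P(s))\setminus K$, $D(K)=(\bigcup_{s\in K}D(s))\setminus K$, $N(K)=G\setminus(K\cup D(K))$, $N'(K)=N(K)\setminus P(K)$; $K$ closed if $s\sqsubseteq k\sqsubseteq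 t$, $s,t\in K$ implies $k\in K$. Local models: nonempty closed convex sets $\mathcal{M}_{s\mid x_{P(s)}}$ of probability mass functions on $\mathcal{X}_s$. Full conditional probability measure: $(A,B)\mapsto P(A\mid B)$ ($B\ne\emptyset$) with (F1) $P(\cdot\mid B)$ a probability measure, $P(B\mid B)=1$; (F2) $P(A\cap C\mid B)=P(A\mid C\cap B)P(C\mid B)$ if $C\cap B\ne\emptyset$. Irrelevant natural extension $\mathcal{F}^{\mathrm{irr}}_G$: all full conditional probability measures $P$ on $\mathcal{X}_G$ with $P(X_s\mid x_{N(s)})\in\mathcal{M}_{s\mid x_{P(s)}}$ for all $s,x_{N(s)}$. $\underline{E}^{\mathrm{irr}}_G(f)=\inf\{\sum_{z_G}f(z_G)P(z_G):P\in\mathcal{F}^{\mathrm{irr}}_G\}$, $\overline{E}(f)=-\underline{E}(-f)$. Sub-network: for $K\subseteq G$ and fixed $x_{P(K)}$, the credal network on the DAG restricted to $K$ with local credal sets $\mathcal{M}_{s\mid(z_{P(s)\cap K},x_{P(s)\setminus K})}$; lower expectation of its irrelevant natural extension: $\underline{E}^{\mathrm{irr}}_{K\mid x_{P(K)}}$ (written $\underline{E}^{\mathrm{irr}}_K$ if $P(K)=\emptyset$, e.g. $\underline{E}^{\mathrm{irr}}_{N(K)}$). *)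

theory Defs
  imports "HOL-Analysis.Analysis"
begin

(* A network is given by a node set S, a parent function pa (pa s = parents of s),
   state spaces X s, and local models M s xp (a set of pmfs on X s, for
   each assignment xp of the parents).
   An assignment to a node set S (an element of X_S) is an extensional function
   in PiE S X (values undefined outside S). *)

definition edges :: "'n set \<Rightarrow> ('n \<Rightarrow> 'n set) \<Rightarrow> ('n \<times> 'n) set" where
  "edges S pa = {(t, s). s \<in> S \<and> t \<in> pa s}"

definition path_le :: "'n set \<Rightarrow> ('n \<Rightarrow> 'n set) \<Rightarrow> 'n \<Rightarrow> 'n \<Rightarrow> bool" where
  "path_le S pa s v \<longleftrightarrow> (s, v) \<in> (edges S pa)\<^sup>*"

definition is_dag :: "'n set \<Rightarrow> ('n \<Rightarrow> 'n set) \<Rightarrow> bool" where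
  "is_dag S pa \<longleftrightarrow> finite S \<and> (\<forall>s\<in>S. pa s \<subseteq> S) \<and> acyclic (edges S pa)"

definition desc :: "'n set \<Rightarrow> ('n \<Rightarrow> 'n set) \<Rightarrow> 'n \<Rightarrow> 'n set" where
  "desc S pa s = {v \<in> S. path_le S pa s v \<and> s \<noteq> v}"

definition nondesc :: "'n set \<Rightarrow> ('n \<Rightarrow> 'n set) \<Rightarrow> 'n \<Rightarrow> 'n set" where
  "nondesc S pa s = S - ({s} \<union> desc S pa s)"

definition parK :: "'n set \<Rightarrow> ('n \<Rightarrow> 'n set) \<Rightarrow> 'n set \<Rightarrow> 'n set" where
  "parK S pa K = (\<Union>s\<in>K. pa s) - K"

definition descK :: "'n set \<Rightarrow> ('n \<Rightarrow> 'n set) \<Rightarrow> 'n set \<Rightarrow> 'n set" where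
  "descK S pa K = (\<Union>s\<in>K. desc S pa s) - K"

definition nondescK :: "'n set \<Rightarrow> ('n \<Rightarrow> 'n set) \<Rightarrow> 'n set \<Rightarrow> 'n set" where
  "nondescK S pa K = S - (K \<union> descK S pa K)"

definition nondescK' :: "'n set \<Rightarrow> ('n \<Rightarrow> 'n set) \<Rightarrow> 'n set \<Rightarrow> 'n set" where
  "nondescK' S pa K = nondescK S pa K - parK S pa K"

definition closed_set :: "'n set \<Rightarrow> ('n \<Rightarrow> 'n set) \<Rightarrow> 'n set \<Rightarrow> bool" where
  "closed_set S pa K \<longleftrightarrow> K \<subseteq> S \<and>
     (\<forall>s\<in>K. \<forall>k\<in>S. \<forall>t\<in>K. path_le S pa s k \<and> path_le S pa k t \<longrightarrow> k \<in> K)"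

definition is_pmf_on :: "'v set \<Rightarrow> ('v \<Rightarrow> real) \<Rightarrow> bool" where
  "is_pmf_on A p \<longleftrightarrow> (\<forall>v\<in>A. p v \<ge> 0) \<and> (\<forall>v. v \<notin> A \<longrightarrow> p v = 0) \<and> (\<Sum>v\<in>A. p v) = 1"

definition convex_fun_set :: "('v \<Rightarrow> real) set \<Rightarrow> bool" where
  "convex_fun_set C \<longleftrightarrow>
     (\<forall>p\<in>C. \<forall>q\<in>C. \<forall>t::real. 0 \<le> t \<and> t \<le> 1 \<longrightarrow> (\<lambda>v. t * p v + (1 - t) * q v) \<in> C)"

definition credal_network ::
  "'n set \<Rightarrow> ('n \<Rightarrow> 'n set) \<Rightarrow> ('n \<Rightarrow> 'v set) \<Rightarrow> ('n \<Rightarrow> ('n \<Rightarrow> 'v) \<Rightarrow> ('v \<Rightarrow> real) set) \<Rightarrow> bool" where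
  "credal_network S pa X M \<longleftrightarrow> is_dag S pa \<and>
     (\<forall>s\<in>S. finite (X s) \<and> X s \<noteq> {}) \<and>
     (\<forall>s\<in>S. \<forall>xp\<in>PiE (pa s) X. M s xp \<noteq> {} \<and> closed (M s xp) \<and> convex_fun_set (M s xp) \<and>
        (\<forall>p\<in>M s xp. is_pmf_on (X s) p))"

definition full_cond_prob :: "'a set \<Rightarrow> ('a set \<Rightarrow> 'a set \<Rightarrow> real) \<Rightarrow> bool" where
  "full_cond_prob Om P \<longleftrightarrow>
     (\<forall>B. B \<subseteq> Om \<and> B \<noteq> {} \<longrightarrow>
        (\<forall>A. A \<subseteq> Om \<longrightarrow> P A B \<ge> 0) \<and> P Om B = 1 \<and>
        (\<forall>A C. A \<subseteq> Om \<and> C \<subseteq> Om \<and> A \<inter> C = {} \<longrightarrow> P (A \<union> C) B = P A B + P C B) \<and>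
        P B B = 1) \<and>
     (\<forall>A B C. A \<subseteq> Om \<and> B \<subseteq> Om \<and> C \<subseteq> Om \<and> B \<noteq> {} \<and> C \<inter> B \<noteq> {} \<longrightarrow>
        P (A \<inter> C) B = P A (C \<inter> B) * P C B)"

definition irr_ext ::
  "'n set \<Rightarrow> ('n \<Rightarrow> 'n set) \<Rightarrow> ('n \<Rightarrow> 'v set) \<Rightarrow> ('n \<Rightarrow> ('n \<Rightarrow> 'v) \<Rightarrow> ('v \<Rightarrow> real) set)
     \<Rightarrow> (('n \<Rightarrow> 'v) set \<Rightarrow> ('n \<Rightarrow> 'v) set \<Rightarrow> real) set" where
  "irr_ext S pa X M = {P. full_cond_prob (PiE S X) P \<and>
     (\<forall>s\<in>S. \<forall>xN\<in>PiE (nondesc S pa s) X.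
        (\<lambda>v. if v \<in> X s then
               P {z\<in>PiE S X. z s = v} {z\<in>PiE S X. restrict z (nondesc S pa s) = xN}
             else 0) \<in> M s (restrict xN (pa s)))}"

definition lowE_irr ::
  "'n set \<Rightarrow> ('n \<Rightarrow> 'n set) \<Rightarrow> ('n \<Rightarrow> 'v set) \<Rightarrow> ('n \<Rightarrow> ('n \<Rightarrow> 'v) \<Rightarrow> ('v \<Rightarrow> real) set)
     \<Rightarrow> (('n \<Rightarrow> 'v) \<Rightarrow> real) \<Rightarrow> real" where
  "lowE_irr S pa X M f = Inf {(\<Sum>z\<in>PiE S X. f z * P {z} (PiE S X)) | P. P \<in> irr_ext S pa X M}"

definition upE_irr ::
  "'n set \<Rightarrow> ('n \<Rightarrow> 'n set) \<Rightarrow> ('n \<Rightarrow> 'v set) \<Rightarrow> ('n \<Rightarrow> ('n \<Rightarrow> 'v) \<Rightarrow> ('v \<Rightarrow> real) set)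
     \<Rightarrow> (('n \<Rightarrow> 'v) \<Rightarrow> real) \<Rightarrow> real" where
  "upE_irr S pa X M f = - lowE_irr S pa X M (\<lambda>z. - f z)"

(* sub-network on K with parents outside K fixed to xP:
   DAG restricted to K, local credal sets M_{s | (z_{P(s) \<inter> K}, x_{P(s) \<setminus> K})} *)
definition sub_pa :: "('n \<Rightarrow> 'n set) \<Rightarrow> 'n set \<Rightarrow> 'n \<Rightarrow> 'n set" where
  "sub_pa pa K = (\<lambda>s. pa s \<inter> K)"

definition sub_M ::
  "('n \<Rightarrow> 'n set) \<Rightarrow> ('n \<Rightarrow> ('n \<Rightarrow> 'v) \<Rightarrow> ('v \<Rightarrow> real) set) \<Rightarrow> 'n set \<Rightarrow> ('n \<Rightarrow> 'v)
     \<Rightarrow> 'n \<Rightarrow> ('n \<Rightarrow> 'v) \<Rightarrow> ('v \<Rightarrow> real) set" where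
  "sub_M pa M K xP = (\<lambda>s z. M s (restrict (\<lambda>t. if t \<in> K then z t else xP t) (pa s)))"

definition lowE_sub ::
  "'n set \<Rightarrow> ('n \<Rightarrow> 'n set) \<Rightarrow> ('n \<Rightarrow> 'v set) \<Rightarrow> ('n \<Rightarrow> ('n \<Rightarrow> 'v) \<Rightarrow> ('v \<Rightarrow> real) set)
     \<Rightarrow> ('n \<Rightarrow> 'v) \<Rightarrow> (('n \<Rightarrow> 'v) \<Rightarrow> real) \<Rightarrow> real" where
  "lowE_sub K pa X M xP f = lowE_irr K (sub_pa pa K) X (sub_M pa M K xP) f"

(* \<underline>E^irr_K for a node set K with P(K) = {} (e.g. K = N(K')): the
   local credal sets are just M_{s | z_{P(s)}} *)
definition lowE_sub0 ::
  "'n set \<Rightarrow> ('n \<Rightarrow> 'n set) \<Rightarrow> ('n \<Rightarrow> 'v set) \<Rightarrow> ('n \<Rightarrow> ('n \<Rightarrow> 'v) \<Rightarrow> ('v \<Rightarrow> real) set)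
     \<Rightarrow> (('n \<Rightarrow> 'v) \<Rightarrow> real) \<Rightarrow> real" where
  "lowE_sub0 K pa X M f = lowE_irr K (sub_pa pa K) X (\<lambda>s z. M s (restrict z (pa s))) f"

definition upE_sub0 ::
  "'n set \<Rightarrow> ('n \<Rightarrow> 'n set) \<Rightarrow> ('n \<Rightarrow> 'v set) \<Rightarrow> ('n \<Rightarrow> ('n \<Rightarrow> 'v) \<Rightarrow> ('v \<Rightarrow> real) set)
     \<Rightarrow> (('n \<Rightarrow> 'v) \<Rightarrow> real) \<Rightarrow> real" where
  "upE_sub0 K pa X M f = - lowE_sub0 K pa X M (\<lambda>z. - f z)"

end

theory Submission
  imports Defs
begin

text \<open>
  Write N for the non-descendants of K and D for its descendants. Every model P of the irrelevant
  natural extension splits into its marginal on N, which is a model of the sub-network on N, and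
  its conditionals on K given a value w of N; where w agrees with x_P(K) (the only values on which
  the indicator in \<open>\<phi>\<close> does not vanish) these are models of the sub-network on K given x_P(K).
  Hence the expectation of \<open>\<phi> f\<close> is a \<open>\<phi>\<close>-weighted average, under the marginal, of
  conditional expectations of f that are each at least a.

  Conversely, a model Q of the sub-network on N and a model R of the sub-network on K are composed
  into a joint model attaining \<open>E_Q(\<phi>) E_R(f)\<close>. Full conditional probabilities cannot simply be
  multiplied, so the composition is a limit: Q and R are approximated by strictly positive
  distributions, which are combined with slightly perturbed local models on D and on those nodes of
  K that lie below a parent deviating from x_P(K); along a subsequence the conditional ratios of
  these positive distributions converge to a full conditional probability satisfying every local
  constraint. Taking infima over Q and R, the sign of a decides whether the lower or the upper
  expectation on N appears.
\<close>

section \<open>Assignments, fibres and cylinders\<close>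

definition fibre :: "'n set \<Rightarrow> ('n \<Rightarrow> 'v set) \<Rightarrow> 'n set \<Rightarrow> ('n \<Rightarrow> 'v) \<Rightarrow> ('n \<Rightarrow> 'v) set" where
  "fibre S X W z = {y \<in> PiE S X. \<forall>t\<in>S - W. y t = z t}"

definition cylinder :: "'n set \<Rightarrow> ('n \<Rightarrow> 'v set) \<Rightarrow> 'n set \<Rightarrow> ('n \<Rightarrow> 'v) \<Rightarrow> ('n \<Rightarrow> 'v) set" where
  "cylinder S X C z = {y \<in> PiE S X. \<forall>t\<in>C. y t = z t}"

lemma fibre_subset: "fibre S X W z \<subseteq> PiE S X" unfolding fibre_def by auto
lemma cylinder_subset: "cylinder S X C z \<subseteq> PiE S X" unfolding cylinder_def by auto

lemma finite_PiE_ball: "finite S \<Longrightarrow> \<forall>s\<in>S. finite (X s) \<Longrightarrow> finite (PiE S X)"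
  by (rule finite_PiE) auto

lemma finite_fibre: "finite S \<Longrightarrow> \<forall>s\<in>S. finite (X s) \<Longrightarrow> finite (fibre S X W z)"
  using finite_PiE_ball fibre_subset finite_subset by metis

lemma finite_cylinder: "finite S \<Longrightarrow> \<forall>s\<in>S. finite (X s) \<Longrightarrow> finite (cylinder S X C z)"
  using finite_PiE_ball cylinder_subset finite_subset by metis

lemma fibre_empty: "z \<in> PiE S X \<Longrightarrow> fibre S X {} z = {z}"
  unfolding fibre_def using PiE_ext[of _ S X z] by auto

lemma fibre_Un:
  assumes "W1 \<inter> W2 = {}" "z \<in> PiE S X"
  shows "fibre S X (W1 \<union> W2) z = (\<Union>y1\<in>fibre S X W1 z. fibre S X W2 y1)"
proof
  show "fibre S X (W1 \<union> W2) z \<subseteq> (\<Union>y1\<in>fibre S X W1 z. fibre S X W2 y1)"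
  proof
    fix y assume y: "y \<in> fibre S X (W1 \<union> W2) z"
    define y1 where "y1 = (\<lambda>t. if t \<in> W1 then y t else z t)"
    have "y1 \<in> PiE S X" using y assms(2) unfolding y1_def fibre_def
      by (auto simp: PiE_def Pi_def extensional_def)
    hence "y1 \<in> fibre S X W1 z" unfolding fibre_def y1_def by auto
    moreover have "y \<in> fibre S X W2 y1" using y unfolding fibre_def y1_def by auto
    ultimately show "y \<in> (\<Union>y1\<in>fibre S X W1 z. fibre S X W2 y1)" by auto
  qed
  show "(\<Union>y1\<in>fibre S X W1 z. fibre S X W2 y1) \<subseteq> fibre S X (W1 \<union> W2) z"
    unfolding fibre_def by auto
qed

lemma fibre_all: "fibre S X S z = PiE S X" unfolding fibre_def by auto

lemma fibre_trans: "y1 \<in> fibre S X W1 z \<Longrightarrow> y \<in> fibre S X W2 y1 \<Longrightarrow> y \<in> fibre S X (W1 \<union> W2) z"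
  unfolding fibre_def by auto

lemma fibre_mono: "y \<in> fibre S X W z \<Longrightarrow> W \<subseteq> W' \<Longrightarrow> y \<in> fibre S X W' z"
  unfolding fibre_def by auto

lemma sum_fibre_Un:
  assumes "finite S" "\<forall>s\<in>S. finite (X s)" "W1 \<inter> W2 = {}" "z \<in> PiE S X"
  shows "sum F (fibre S X (W1 \<union> W2) z) = (\<Sum>y1\<in>fibre S X W1 z. sum F (fibre S X W2 y1))"
proof -
  have "sum F (fibre S X (W1 \<union> W2) z) = sum F (\<Union>y1\<in>fibre S X W1 z. fibre S X W2 y1)"
    using fibre_Un[OF assms(3,4)] by simp
  also have "\<dots> = (\<Sum>y1\<in>fibre S X W1 z. sum F (fibre S X W2 y1))"
  proof (rule sum.UNION_disjoint)
    show "finite (fibre S X W1 z)" using finite_fibre assms by metis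
    show "\<forall>i\<in>fibre S X W1 z. finite (fibre S X W2 i)" using finite_fibre assms by metis
    show "\<forall>i\<in>fibre S X W1 z. \<forall>j\<in>fibre S X W1 z. i \<noteq> j \<longrightarrow> fibre S X W2 i \<inter> fibre S X W2 j = {}"
    proof (intro ballI impI)
      fix i j assume i: "i \<in> fibre S X W1 z" and j: "j \<in> fibre S X W1 z" and ij: "i \<noteq> j"
      then obtain t where t: "i t \<noteq> j t" by auto
      have tS: "t \<in> S"
      proof (rule ccontr)
        assume "t \<notin> S"
        hence "i t = undefined" "j t = undefined" using i j unfolding fibre_def by (auto simp: PiE_def extensional_def)
        thus False using t by simp
      qed
      have tW1: "t \<in> W1"
      proof (rule ccontr)
        assume "t \<notin> W1"
        thus False using i j t tS unfolding fibre_def by auto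
      qed
      hence "t \<notin> W2" using assms(3) by auto
      thus "fibre S X W2 i \<inter> fibre S X W2 j = {}" using t tS unfolding fibre_def by auto
    qed
  qed
  finally show ?thesis .
qed

lemma fun_upd_in_PiE: "z \<in> PiE S X \<Longrightarrow> w \<in> S \<Longrightarrow> v \<in> X w \<Longrightarrow> z(w:=v) \<in> PiE S X"
  by (auto simp: PiE_def Pi_def extensional_def)

lemma restrict_in_PiE: "z \<in> PiE G X \<Longrightarrow> T \<subseteq> G \<Longrightarrow> restrict z T \<in> PiE T X"
  by (auto simp: PiE_def Pi_def)

lemma fibre_singleton:
  assumes "w \<in> S" "z \<in> PiE S X"
  shows "fibre S X {w} z = (\<lambda>v. z(w:=v)) ` X w" and "inj_on (\<lambda>v. z(w:=v)) (X w)"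
proof -
  show "fibre S X {w} z = (\<lambda>v. z(w:=v)) ` X w"
  proof
    show "fibre S X {w} z \<subseteq> (\<lambda>v. z(w := v)) ` X w"
    proof
      fix y assume y: "y \<in> fibre S X {w} z"
      have "y = z(w := y w)"
      proof
        fix t show "y t = (z(w := y w)) t"
          using y assms unfolding fibre_def by (cases "t \<in> S") (auto simp: PiE_def extensional_def)
      qed
      moreover have "y w \<in> X w" using y assms(1) unfolding fibre_def by auto
      ultimately show "y \<in> (\<lambda>v. z(w := v)) ` X w" by auto
    qed
    show "(\<lambda>v. z(w := v)) ` X w \<subseteq> fibre S X {w} z"
    proof
      fix y assume "y \<in> (\<lambda>v. z(w:=v)) ` X w"
      then obtain v where v: "v \<in> X w" "y = z(w:=v)" by auto
      thus "y \<in> fibre S X {w} z" unfolding fibre_def using fun_upd_in_PiE[OF assms(2) assms(1) v(1)] by auto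
    qed
  qed
  show "inj_on (\<lambda>v. z(w:=v)) (X w)" by (auto simp: inj_on_def fun_eq_iff)
qed

lemma sum_fibre_singleton:
  assumes "w \<in> S" "z \<in> PiE S X"
  shows "sum F (fibre S X {w} z) = (\<Sum>v\<in>X w. F (z(w:=v)))"
  using fibre_singleton[OF assms] by (simp add: sum.reindex)

lemma sum_fibre_prod_kernels:
  fixes c :: "'n \<Rightarrow> ('n \<Rightarrow> 'v) \<Rightarrow> real"
  assumes fin: "finite S" "\<forall>s\<in>S. finite (X s)"
    and sink: "\<forall>W'. W' \<subseteq> W \<longrightarrow> W' \<noteq> {} \<longrightarrow> (\<exists>w\<in>W'. \<forall>u\<in>W'. w \<notin> pa u)"
    and WS: "W \<subseteq> S"
    and loc: "\<forall>w\<in>W. \<forall>y\<in>PiE S X. \<forall>y'\<in>PiE S X. y w = y' w \<and> (\<forall>t\<in>pa w. y t = y' t) \<longrightarrow> c w y = c w y'"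
    and norm: "\<forall>w\<in>W. \<forall>y\<in>PiE S X. (\<Sum>v\<in>X w. c w (y(w:=v))) = 1"
    and z: "z \<in> PiE S X"
  shows "(\<Sum>y\<in>fibre S X W z. \<Prod>w\<in>W. c w y) = 1"
  using sink WS loc norm z
proof (induction "card W" arbitrary: W z rule: less_induct)
  case less
  have finW: "finite W" using less.prems(2) fin(1) finite_subset by auto
  show ?case
  proof (cases "W = {}")
    case True thus ?thesis using fibre_empty[OF less.prems(5)] by simp
  next
    case False
    then obtain w where w: "w \<in> W" "\<forall>u\<in>W. w \<notin> pa u" using less.prems(1) by blast
    define W0 where "W0 = W - {w}"
    have W: "W = W0 \<union> {w}" "W0 \<inter> {w} = {}" using w unfolding W0_def by auto
    have wS: "w \<in> S" using w less.prems(2) by auto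
    have c: "card W0 < card W" using card_Diff1_less[OF finW w(1)] unfolding W0_def .
    have s1: "\<forall>W'. W' \<subseteq> W0 \<longrightarrow> W' \<noteq> {} \<longrightarrow> (\<exists>w\<in>W'. \<forall>u\<in>W'. w \<notin> pa u)"
      using less.prems(1) unfolding W0_def by auto
    have s2: "W0 \<subseteq> S" using less.prems(2) unfolding W0_def by auto
    have s3: "\<forall>w\<in>W0. \<forall>y\<in>PiE S X. \<forall>y'\<in>PiE S X. y w = y' w \<and> (\<forall>t\<in>pa w. y t = y' t) \<longrightarrow> c w y = c w y'"
      using less.prems(3) unfolding W0_def by (meson DiffD1)
    have s4: "\<forall>w\<in>W0. \<forall>y\<in>PiE S X. (\<Sum>v\<in>X w. c w (y(w:=v))) = 1"
      using less.prems(4) unfolding W0_def by (meson DiffD1)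
    have IH: "(\<Sum>y\<in>fibre S X W0 z. \<Prod>w\<in>W0. c w y) = 1" if z: "z \<in> PiE S X" for z
      using less.hyps[OF c s1 s2 s3 s4 z] .
    have "(\<Sum>y\<in>fibre S X W z. \<Prod>w\<in>W. c w y)
        = (\<Sum>y1\<in>fibre S X W0 z. \<Sum>y\<in>fibre S X {w} y1. \<Prod>w\<in>W. c w y)"
      using sum_fibre_Un[OF fin W(2) less.prems(5)] W(1) by simp
    also have "\<dots> = (\<Sum>y1\<in>fibre S X W0 z. \<Prod>w\<in>W0. c w y1)"
    proof (rule sum.cong[OF refl])
      fix y1 assume y1: "y1 \<in> fibre S X W0 z"
      hence y1P: "y1 \<in> PiE S X" using fibre_subset by blast
      have "(\<Sum>y\<in>fibre S X {w} y1. \<Prod>w\<in>W. c w y) = (\<Sum>v\<in>X w. \<Prod>u\<in>W. c u (y1(w:=v)))"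
        by (rule sum_fibre_singleton[OF wS y1P])
      also have "\<dots> = (\<Sum>v\<in>X w. c w (y1(w:=v)) * (\<Prod>u\<in>W0. c u y1))"
      proof (rule sum.cong[OF refl])
        fix v assume v: "v \<in> X w"
        have "(\<Prod>u\<in>W. c u (y1(w:=v))) = c w (y1(w:=v)) * (\<Prod>u\<in>W0. c u (y1(w:=v)))"
          using finW w unfolding W0_def by (simp add: prod.remove)
        also have "(\<Prod>u\<in>W0. c u (y1(w:=v))) = (\<Prod>u\<in>W0. c u y1)"
        proof (rule prod.cong[OF refl])
          fix u assume u: "u \<in> W0"
          have "w \<notin> pa u" "u \<noteq> w" using u w unfolding W0_def by auto
          thus "c u (y1(w:=v)) = c u y1"
            using s3[rule_format, OF u fun_upd_in_PiE[OF y1P wS v] y1P] by auto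
        qed
        finally show "(\<Prod>u\<in>W. c u (y1(w:=v))) = c w (y1(w:=v)) * (\<Prod>u\<in>W0. c u y1)" .
      qed
      also have "\<dots> = (\<Sum>v\<in>X w. c w (y1(w:=v))) * (\<Prod>u\<in>W0. c u y1)"
        by (rule sum_distrib_right[symmetric])
      also have "\<dots> = (\<Prod>u\<in>W0. c u y1)" using less.prems(4) w y1P by simp
      finally show "(\<Sum>y\<in>fibre S X {w} y1. \<Prod>w\<in>W. c w y) = (\<Prod>u\<in>W0. c u y1)" .
    qed
    also have "\<dots> = 1" using IH[OF less.prems(5)] .
    finally show ?thesis .
  qed
qed

lemma dag_sink_exists:
  assumes "is_dag S pa" "W \<subseteq> S"
  shows "\<forall>W'. W' \<subseteq> W \<longrightarrow> W' \<noteq> {} \<longrightarrow> (\<exists>w\<in>W'. \<forall>u\<in>W'. w \<notin> pa u)"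
proof (intro allI impI)
  fix W' assume W': "W' \<subseteq> W" "W' \<noteq> {}"
  have fin: "finite (edges S pa)"
  proof -
    have "edges S pa \<subseteq> S \<times> S" using assms(1) unfolding is_dag_def edges_def by auto
    thus ?thesis using assms(1) unfolding is_dag_def by (meson finite_SigmaI finite_subset)
  qed
  have "wf ((edges S pa)\<inverse>)"
    using finite_acyclic_wf_converse[OF fin] assms(1) unfolding is_dag_def by auto
  then obtain w where w: "w \<in> W'" "\<forall>y. (y, w) \<in> (edges S pa)\<inverse> \<longrightarrow> y \<notin> W'"
    using W'(2) wf_eq_minimal by (metis ex_in_conv)
  have "\<forall>u\<in>W'. w \<notin> pa u"
  proof
    fix u assume u: "u \<in> W'"
    hence uS: "u \<in> S" using W' assms(2) by auto
    show "w \<notin> pa u"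
    proof
      assume "w \<in> pa u"
      hence "(u, w) \<in> (edges S pa)\<inverse>" using uS unfolding edges_def by auto
      thus False using w(2) u by blast
    qed
  qed
  thus "\<exists>w\<in>W'. \<forall>u\<in>W'. w \<notin> pa u" using w(1) by blast
qed

section \<open>Full conditional probabilities\<close>

lemma fcp_measure:
  assumes "full_cond_prob Om P" "B \<subseteq> Om" "B \<noteq> {}"
  shows "\<And>A. A \<subseteq> Om \<Longrightarrow> P A B \<ge> 0" "P Om B = 1"
    "\<And>A C. A \<subseteq> Om \<Longrightarrow> C \<subseteq> Om \<Longrightarrow> A \<inter> C = {} \<Longrightarrow> P (A \<union> C) B = P A B + P C B"
    "P B B = 1"
  using assms unfolding full_cond_prob_def by blast+

lemma fcp_chain:
  assumes "full_cond_prob Om P" "A \<subseteq> Om" "B \<subseteq> Om" "C \<subseteq> Om" "B \<noteq> {}" "C \<inter> B \<noteq> {}"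
  shows "P (A \<inter> C) B = P A (C \<inter> B) * P C B"
proof -
  have "\<forall>A B C. A \<subseteq> Om \<and> B \<subseteq> Om \<and> C \<subseteq> Om \<and> B \<noteq> {} \<and> C \<inter> B \<noteq> {} \<longrightarrow> P (A \<inter> C) B = P A (C \<inter> B) * P C B"
    using assms(1) unfolding full_cond_prob_def by (rule conjunct2)
  thus ?thesis using assms(2-6) by simp
qed

lemma fcp_empty:
  assumes "full_cond_prob Om P" "B \<subseteq> Om" "B \<noteq> {}"
  shows "P {} B = 0"
  using fcp_measure(3)[OF assms, of "{}" "{}"] by simp

lemma fcp_sum:
  assumes "full_cond_prob Om P" "B \<subseteq> Om" "B \<noteq> {}" "finite A" "A \<subseteq> Om"
  shows "P A B = (\<Sum>w\<in>A. P {w} B)"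
  using assms(4,5)
proof (induction A rule: finite_induct)
  case empty thus ?case using fcp_empty[OF assms(1-3)] by simp
next
  case (insert x F)
  have "P (insert x F) B = P ({x} \<union> F) B" by simp
  also have "\<dots> = P {x} B + P F B" by (rule fcp_measure(3)[OF assms(1-3)]) (use insert in auto)
  finally show ?case using insert by simp
qed

lemma fcp_inter:
  assumes "full_cond_prob Om P" "A \<subseteq> Om" "B \<subseteq> Om" "B \<noteq> {}"
  shows "P A B = P (A \<inter> B) B"
  using fcp_chain[OF assms(1,2,3,3,4)] fcp_measure(4)[OF assms(1,3,4)] assms(4) by simp

lemma fcp_mono:
  assumes "full_cond_prob Om P" "B \<subseteq> Om" "B \<noteq> {}" "A \<subseteq> A'" "A' \<subseteq> Om"
  shows "P A B \<le> P A' B"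
proof -
  have "A' = A \<union> (A' - A)" using assms by auto
  hence "P A' B = P A B + P (A' - A) B" using fcp_measure(3)[OF assms(1-3), of A "A' - A"] assms by auto
  thus ?thesis using fcp_measure(1)[OF assms(1-3), of "A' - A"] assms by auto
qed

lemma fcp_sum_one:
  assumes "full_cond_prob Om P" "B \<subseteq> Om" "B \<noteq> {}" "finite Om"
  shows "(\<Sum>w\<in>B. P {w} B) = 1"
  using fcp_sum[OF assms(1-3) _ assms(2)] fcp_measure(4)[OF assms(1-3)] assms(4) finite_subset assms(2)
  by metis

lemma convex_fun_set_sum:
  assumes "convex_fun_set C" "finite I"
  shows "(\<forall>i\<in>I. l i \<ge> 0) \<Longrightarrow> sum l I = 1 \<Longrightarrow> (\<forall>i\<in>I. F i \<in> C)
          \<Longrightarrow> (\<lambda>v. \<Sum>i\<in>I. l i * F i v) \<in> C"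
  using assms(2)
proof (induction I arbitrary: l rule: finite_induct)
  case empty thus ?case by simp
next
  case (insert i I)
  define s where "s = sum l I"
  have s0: "s \<ge> 0" unfolding s_def using insert by (auto intro: sum_nonneg)
  have li: "l i = 1 - s" using insert unfolding s_def by simp
  show ?case
  proof (cases "s = 0")
    case True
    hence "\<forall>j\<in>I. l j = 0" using insert unfolding s_def by (simp add: sum_nonneg_eq_0_iff)
    hence "(\<lambda>v. \<Sum>j\<in>insert i I. l j * F j v) = F i" using insert li True by auto
    thus ?thesis using insert by simp
  next
    case False
    hence sp: "s > 0" using s0 by simp
    define G where "G = (\<lambda>v. \<Sum>j\<in>I. (l j / s) * F j v)"
    have "G \<in> C" unfolding G_def
      apply (rule insert.IH)
      using insert sp by (auto simp: s_def sum_divide_distrib[symmetric])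
    have conv: "\<forall>p\<in>C. \<forall>q\<in>C. \<forall>t::real. 0 \<le> t \<and> t \<le> 1 \<longrightarrow> (\<lambda>v. t * p v + (1 - t) * q v) \<in> C"
      using assms(1) unfolding convex_fun_set_def .
    have "(\<lambda>v. l i * F i v + (1 - l i) * G v) \<in> C"
      apply (rule conv[rule_format])
      using insert li s0 \<open>G \<in> C\<close> by auto
    moreover have "(\<lambda>v. l i * F i v + (1 - l i) * G v) = (\<lambda>v. \<Sum>j\<in>insert i I. l j * F j v)"
      using insert sp li unfolding G_def by (auto simp: sum_distrib_left)
    ultimately show ?thesis by simp
  qed
qed

section \<open>Directed acyclic graphs and closed node sets\<close>

locale dag_net =
  fixes G :: "'n set" and par :: "'n \<Rightarrow> 'n set"
  assumes dag: "is_dag G par"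
begin

abbreviation "reaches \<equiv> path_le G par"

lemma finite_G: "finite G" using dag unfolding is_dag_def by auto

lemma par_subset: "s \<in> G \<Longrightarrow> par s \<subseteq> G" using dag unfolding is_dag_def by auto

lemma acyclic_edges: "acyclic (edges G par)" using dag unfolding is_dag_def by auto

lemma reaches_refl: "reaches s s" unfolding path_le_def by auto

lemma reaches_trans: "reaches s t \<Longrightarrow> reaches t u \<Longrightarrow> reaches s u" unfolding path_le_def by auto

lemma reaches_edge: "s \<in> G \<Longrightarrow> t \<in> par s \<Longrightarrow> reaches t s"
  unfolding path_le_def edges_def by auto

lemma reaches_antisym: "reaches s v \<Longrightarrow> reaches v s \<Longrightarrow> s = v"
proof (rule ccontr)
  assume a: "reaches s v" "reaches v s" "s \<noteq> v"
  hence "(s, v) \<in> (edges G par)\<^sup>+" "(v, s) \<in> (edges G par)\<^sup>+" unfolding path_le_def by (metis rtranclD)+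
  hence "(s, s) \<in> (edges G par)\<^sup>+" by auto
  thus False using acyclic_edges unfolding acyclic_def by auto
qed

lemma desc_iff: "v \<in> desc G par s \<longleftrightarrow> v \<in> G \<and> reaches s v \<and> s \<noteq> v"
  unfolding desc_def by auto

lemma nondesc_iff: "v \<in> nondesc G par s \<longleftrightarrow> v \<in> G \<and> v \<noteq> s \<and> \<not> reaches s v"
  unfolding nondesc_def desc_def by auto

lemma par_subset_nondesc: "s \<in> G \<Longrightarrow> par s \<subseteq> nondesc G par s"
proof
  fix t assume s: "s \<in> G" and t: "t \<in> par s"
  have tG: "t \<in> G" using par_subset s t by auto
  have e: "reaches t s" using reaches_edge s t .
  have "t \<noteq> s"
  proof
    assume "t = s"
    hence "(s, s) \<in> edges G par" using s t unfolding edges_def by auto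
    thus False using acyclic_edges unfolding acyclic_def by auto
  qed
  moreover have "\<not> reaches s t" using reaches_antisym e \<open>t \<noteq> s\<close> by auto
  ultimately show "t \<in> nondesc G par s" using tG unfolding nondesc_iff by auto
qed

lemma child_in_desc:
  assumes "u \<in> G" "t \<in> par u" "reaches s t"
  shows "u \<in> desc G par s"
proof -
  have "reaches s u" using reaches_trans[OF assms(3) reaches_edge[OF assms(1,2)]] .
  moreover have "s \<noteq> u"
  proof
    assume "s = u"
    hence "t \<in> nondesc G par s" using par_subset_nondesc[of s] assms by auto
    thus False using assms(3) unfolding nondesc_iff by auto
  qed
  ultimately show ?thesis using assms(1) unfolding desc_iff by auto
qed

lemma par_nondesc_subset_nondesc: "s \<in> G \<Longrightarrow> u \<in> nondesc G par s \<Longrightarrow> par u \<subseteq> nondesc G par s"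
proof
  fix t assume s: "s \<in> G" and u: "u \<in> nondesc G par s" and t: "t \<in> par u"
  have uG: "u \<in> G" using u unfolding nondesc_iff by auto
  have tG: "t \<in> G" using par_subset uG t by auto
  have "\<not> reaches s t"
  proof
    assume "reaches s t"
    hence "u \<in> desc G par s" using child_in_desc uG t by auto
    thus False using u unfolding nondesc_def by auto
  qed
  moreover hence "t \<noteq> s" using reaches_refl by auto
  ultimately show "t \<in> nondesc G par s" using tG unfolding nondesc_iff by auto
qed

lemma desc_subset: "desc G par s \<subseteq> G" unfolding desc_def by auto
lemma nondesc_subset: "nondesc G par s \<subseteq> G" unfolding nondesc_def by auto

lemma notin_desc_self: "s \<notin> desc G par s" unfolding desc_def by auto

lemma node_partition: "s \<in> G \<Longrightarrow> G = {s} \<union> desc G par s \<union> nondesc G par s"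
  unfolding nondesc_def desc_def by auto

lemma desc_nondesc_disjoint: "desc G par s \<inter> nondesc G par s = {}"
  unfolding nondesc_def by auto

lemma desc_trans: "v \<in> desc G par u \<Longrightarrow> u \<in> desc G par s \<Longrightarrow> v \<in> desc G par s"
  unfolding desc_iff using reaches_trans reaches_antisym by metis

lemma edges_sub_pa: "A \<subseteq> G \<Longrightarrow> edges A (sub_pa par A) \<subseteq> edges G par"
  unfolding edges_def sub_pa_def by auto

lemma path_le_sub_pa_imp: "A \<subseteq> G \<Longrightarrow> path_le A (sub_pa par A) s v \<Longrightarrow> reaches s v"
  unfolding path_le_def using rtrancl_mono[OF edges_sub_pa] by blast

lemma path_le_sub_pa:
  assumes cl: "closed_set G par A" and s: "s \<in> A" and v: "v \<in> A" and p: "reaches s v"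
  shows "path_le A (sub_pa par A) s v"
proof -
  have "(s, v) \<in> (edges G par)\<^sup>*" using p unfolding path_le_def .
  thus ?thesis using s
  proof (induction rule: converse_rtrancl_induct)
    case base thus ?case unfolding path_le_def by auto
  next
    case (step y z)
    have zG: "z \<in> G" and yz: "y \<in> par z" using step(1) unfolding edges_def by auto
    have "reaches y z" using step(1) unfolding path_le_def by auto
    moreover have "reaches z v" using step(2) unfolding path_le_def by auto
    ultimately have zA: "z \<in> A" using cl step(4) v zG unfolding closed_set_def by blast
    have "(y, z) \<in> edges A (sub_pa par A)" using zA yz step(4) unfolding edges_def sub_pa_def by auto
    moreover have "path_le A (sub_pa par A) z v" using step(3)[OF zA] .
    ultimately show ?case unfolding path_le_def by (meson converse_rtrancl_into_rtrancl)
  qed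
qed

lemma desc_sub_pa:
  assumes "closed_set G par A" "s \<in> A"
  shows "desc A (sub_pa par A) s = desc G par s \<inter> A"
proof -
  have AG: "A \<subseteq> G" using assms(1) unfolding closed_set_def by auto
  show ?thesis
    unfolding desc_def using path_le_sub_pa_imp[OF AG] path_le_sub_pa[OF assms(1) assms(2)] AG by blast
qed

lemma nondesc_sub_pa:
  assumes "closed_set G par A" "s \<in> A"
  shows "nondesc A (sub_pa par A) s = nondesc G par s \<inter> A"
  using desc_sub_pa[OF assms] assms(1) unfolding nondesc_def closed_set_def by auto

end

locale closed_part = dag_net +
  fixes K
  assumes closedK: "closed_set G par K"
begin

abbreviation "N \<equiv> nondescK G par K"
abbreviation "D \<equiv> descK G par K"
abbreviation "PK \<equiv> parK G par K"

lemma K_subset: "K \<subseteq> G" using closedK unfolding closed_set_def by auto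

lemma D_iff: "v \<in> D \<longleftrightarrow> v \<in> G \<and> v \<notin> K \<and> (\<exists>k\<in>K. v \<in> desc G par k)"
  unfolding descK_def desc_def by auto

lemma N_iff: "v \<in> N \<longleftrightarrow> v \<in> G \<and> v \<notin> K \<and> v \<notin> D"
  unfolding nondescK_def by auto

lemma D_subset: "D \<subseteq> G" using D_iff by auto
lemma N_subset: "N \<subseteq> G" using N_iff by auto
lemma K_D_disjoint: "K \<inter> D = {}" using D_iff by auto
lemma K_N_disjoint: "K \<inter> N = {}" using N_iff by auto
lemma D_N_disjoint: "D \<inter> N = {}" using N_iff by auto
lemma G_eq_K_D_N: "G = K \<union> D \<union> N" using N_iff K_subset D_subset by auto

lemma N_ancestor_closed: "v \<in> N \<Longrightarrow> reaches u v \<Longrightarrow> u \<in> G \<Longrightarrow> u \<in> N"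
proof -
  assume v: "v \<in> N" and p: "reaches u v" and uG: "u \<in> G"
  show "u \<in> N"
  proof (rule ccontr)
    assume "u \<notin> N"
    hence "u \<in> K \<or> u \<in> D" using uG N_iff by auto
    then obtain k where k: "k \<in> K" "reaches k u" using D_iff reaches_refl unfolding desc_iff by blast
    have "u \<noteq> v" using v \<open>u \<notin> N\<close> by auto
    have "reaches k v" using reaches_trans[OF k(2) p] .
    moreover have "k \<noteq> v" using k(1) v K_N_disjoint by auto
    ultimately have "v \<in> D" using k(1) v N_iff unfolding D_iff desc_iff by auto
    thus False using v D_N_disjoint by auto
  qed
qed

lemma par_subset_N: "u \<in> N \<Longrightarrow> par u \<subseteq> N"
  using N_ancestor_closed reaches_edge par_subset N_subset by blast

lemma closed_set_N: "closed_set G par N"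
  unfolding closed_set_def using N_subset N_ancestor_closed by blast

lemma PK_iff: "t \<in> PK \<longleftrightarrow> t \<notin> K \<and> (\<exists>k\<in>K. t \<in> par k)"
  unfolding parK_def by auto

lemma PK_subset_N: "PK \<subseteq> N"
proof
  fix t assume t: "t \<in> PK"
  then obtain k where k: "k \<in> K" "t \<in> par k" "t \<notin> K" unfolding PK_iff by auto
  have tG: "t \<in> G" using par_subset k K_subset by auto
  have "t \<notin> D"
  proof
    assume "t \<in> D"
    then obtain k2 where k2: "k2 \<in> K" "reaches k2 t" unfolding D_iff desc_iff by auto
    have "reaches t k" using reaches_edge k K_subset by auto
    hence "t \<in> K" using closedK k2 k(1) tG unfolding closed_set_def by blast
    thus False using k by auto
  qed
  thus "t \<in> N" using tG k N_iff by auto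
qed

lemma par_subset_K_PK: "k \<in> K \<Longrightarrow> par k \<subseteq> K \<union> PK"
  unfolding parK_def by auto

lemma desc_subset_K_D: "k \<in> K \<Longrightarrow> desc G par k \<subseteq> K \<union> D"
  unfolding descK_def by auto

lemma desc_subset_D: "d \<in> D \<Longrightarrow> desc G par d \<subseteq> D"
proof
  fix v assume d: "d \<in> D" and v: "v \<in> desc G par d"
  then obtain k where k: "k \<in> K" "d \<in> desc G par k" "d \<notin> K" unfolding D_iff by auto
  have vk: "v \<in> desc G par k" using desc_trans[OF v k(2)] .
  have "v \<notin> K"
  proof
    assume "v \<in> K"
    hence "d \<in> K" using closedK k v desc_subset unfolding closed_set_def desc_iff by blast
    thus False using k by auto
  qed
  thus "v \<in> D" using vk k desc_subset unfolding D_iff by auto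
qed

lemma N_subset_nondesc_K: "k \<in> K \<Longrightarrow> N \<subseteq> nondesc G par k"
proof
  fix v assume k: "k \<in> K" and v: "v \<in> N"
  have "v \<notin> desc G par k" using desc_subset_K_D[OF k] v K_N_disjoint D_N_disjoint by auto
  moreover have "v \<noteq> k" using k v K_N_disjoint by auto
  ultimately show "v \<in> nondesc G par k" using v N_subset unfolding nondesc_def by auto
qed

end

section \<open>Marginals and conditionals of full conditional probabilities\<close>

lemma PiE_differ_in_domain: "i \<in> PiE S X \<Longrightarrow> j \<in> PiE S X \<Longrightarrow> i t \<noteq> j t \<Longrightarrow> t \<in> S"
  by (metis PiE_arb)

lemma fcp_UNION:
  assumes fcp: "full_cond_prob Om P" and B: "B \<subseteq> Om" "B \<noteq> {}" and fin: "finite Om" "finite I"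
    and A: "\<forall>i\<in>I. A i \<subseteq> Om" and dj: "\<forall>i\<in>I. \<forall>j\<in>I. i \<noteq> j \<longrightarrow> A i \<inter> A j = {}"
  shows "P (\<Union>i\<in>I. A i) B = (\<Sum>i\<in>I. P (A i) B)"
proof -
  have fA: "\<forall>i\<in>I. finite (A i)" using A fin finite_subset by blast
  have "P (\<Union>i\<in>I. A i) B = (\<Sum>w\<in>(\<Union>i\<in>I. A i). P {w} B)"
    by (rule fcp_sum[OF fcp B]) (use A fA fin in auto)
  also have "\<dots> = (\<Sum>i\<in>I. \<Sum>w\<in>A i. P {w} B)"
    by (rule sum.UNION_disjoint[OF fin(2) fA dj])
  also have "\<dots> = (\<Sum>i\<in>I. P (A i) B)"
    by (rule sum.cong[OF refl], rule fcp_sum[OF fcp B, symmetric]) (use A fA in auto)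
  finally show ?thesis .
qed

lemma restrict_eq_cylinder: "xN \<in> PiE Nd X \<Longrightarrow> {z \<in> PiE S X. restrict z Nd = xN} = cylinder S X Nd xN"
  unfolding cylinder_def by (auto simp: PiE_def extensional_def fun_eq_iff)

definition default_ext :: "'n set \<Rightarrow> ('n \<Rightarrow> 'v set) \<Rightarrow> 'n set \<Rightarrow> ('n \<Rightarrow> 'v) \<Rightarrow> ('n \<Rightarrow> 'v)" where
  "default_ext S X C w = (\<lambda>t. if t \<in> S then (if t \<in> C then w t else (SOME x. x \<in> X t)) else undefined)"

lemma default_ext_in:
  assumes "\<forall>t\<in>S. X t \<noteq> {}" "\<forall>t\<in>C \<inter> S. w t \<in> X t"
  shows "default_ext S X C w \<in> PiE S X" "\<forall>t\<in>C \<inter> S. default_ext S X C w t = w t"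
  using assms unfolding default_ext_def by (auto simp: PiE_def Pi_def extensional_def some_in_eq)

lemma cylinder_nonempty:
  assumes "\<forall>t\<in>S. X t \<noteq> {}" "\<forall>t\<in>C \<inter> S. w t \<in> X t" "C \<subseteq> S"
  shows "cylinder S X C w \<noteq> {}"
  using default_ext_in[OF assms(1,2)] assms(3) unfolding cylinder_def by blast

lemma local_model_coarsen:
  fixes P :: "('n \<Rightarrow> 'v) set \<Rightarrow> ('n \<Rightarrow> 'v) set \<Rightarrow> real"
  assumes fin: "finite S" "\<forall>t\<in>S. finite (X t)" and ne: "\<forall>t\<in>S. X t \<noteq> {}"
    and fcp: "full_cond_prob (PiE S X) P"
    and NdS: "Nd \<subseteq> S" and CNd: "C \<subseteq> Nd"
    and w: "\<forall>t\<in>C. w t \<in> X t"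
    and H: "\<forall>xN\<in>PiE Nd X. (\<lambda>v. if v \<in> X s then P {z\<in>PiE S X. z s = v} {z\<in>PiE S X. restrict z Nd = xN} else 0) \<in> Mf xN"
    and Mf: "\<forall>xN\<in>PiE Nd X. (\<forall>t\<in>C. xN t = w t) \<longrightarrow> Mf xN = Mw"
    and cvx: "convex_fun_set Mw"
  shows "(\<lambda>v. if v \<in> X s then P {z\<in>PiE S X. z s = v} (cylinder S X C w) else 0) \<in> Mw"
proof -
  define Y where "Y = {xN \<in> PiE Nd X. \<forall>t\<in>C. xN t = w t}"
  define B where "B = cylinder S X C w"
  have finite_configs: "finite (PiE S X)" using finite_PiE_ball fin by blast
  have "finite Nd" using NdS fin(1) finite_subset by auto
  hence "finite (PiE Nd X)" using finite_PiE_ball[of Nd X] fin NdS by auto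
  hence finY: "finite Y" unfolding Y_def by (rule finite_subset[rotated]) auto
  have BO: "B \<subseteq> PiE S X" unfolding B_def by (rule cylinder_subset)
  have Bne: "B \<noteq> {}" unfolding B_def by (rule cylinder_nonempty) (use ne w CNd NdS in auto)
  have BU: "B = (\<Union>xN\<in>Y. cylinder S X Nd xN)"
  proof
    show "B \<subseteq> (\<Union>xN\<in>Y. cylinder S X Nd xN)"
    proof
      fix z assume z: "z \<in> B"
      have zP: "z \<in> PiE S X" using z BO by auto
      have "restrict z Nd \<in> Y" using z zP NdS CNd unfolding Y_def B_def cylinder_def by (auto simp: PiE_def Pi_def)
      moreover have "z \<in> cylinder S X Nd (restrict z Nd)" using zP unfolding cylinder_def by auto
      ultimately show "z \<in> (\<Union>xN\<in>Y. cylinder S X Nd xN)" by auto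
    qed
    show "(\<Union>xN\<in>Y. cylinder S X Nd xN) \<subseteq> B"
      unfolding B_def Y_def cylinder_def using CNd by auto
  qed
  have dj: "\<forall>i\<in>Y. \<forall>j\<in>Y. i \<noteq> j \<longrightarrow> cylinder S X Nd i \<inter> cylinder S X Nd j = {}"
  proof (intro ballI impI)
    fix i j assume i: "i \<in> Y" and j: "j \<in> Y" and ij: "i \<noteq> j"
    then obtain t where t: "i t \<noteq> j t" by auto
    have "t \<in> Nd" using i j t PiE_differ_in_domain unfolding Y_def by fastforce
    thus "cylinder S X Nd i \<inter> cylinder S X Nd j = {}" using t unfolding cylinder_def by auto
  qed
  have cylO: "\<forall>i\<in>Y. cylinder S X Nd i \<subseteq> PiE S X" using cylinder_subset by blast
  have cylne: "\<forall>i\<in>Y. cylinder S X Nd i \<noteq> {}"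
    using cylinder_nonempty[OF ne] NdS unfolding Y_def by (auto simp: PiE_def Pi_def)
  define l where "l xN = P (cylinder S X Nd xN) B" for xN
  have l0: "\<forall>i\<in>Y. l i \<ge> 0" unfolding l_def using fcp_measure(1)[OF fcp BO Bne] cylO by auto
  have l1: "sum l Y = 1"
  proof -
    have "sum l Y = P (\<Union>xN\<in>Y. cylinder S X Nd xN) B"
      unfolding l_def by (rule fcp_UNION[OF fcp BO Bne finite_configs finY cylO dj, symmetric])
    also have "\<dots> = 1" using BU fcp_measure(4)[OF fcp BO Bne] by simp
    finally show ?thesis .
  qed
  define F where "F xN = (\<lambda>v. if v \<in> X s then P {z\<in>PiE S X. z s = v} {z\<in>PiE S X. restrict z Nd = xN} else 0)" for xN
  have FM: "\<forall>i\<in>Y. F i \<in> Mw" unfolding F_def using H Mf unfolding Y_def by auto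
  have "(\<lambda>v. \<Sum>i\<in>Y. l i * F i v) \<in> Mw" by (rule convex_fun_set_sum[OF cvx finY l0 l1 FM])
  moreover have "(\<lambda>v. if v \<in> X s then P {z\<in>PiE S X. z s = v} B else 0) = (\<lambda>v. \<Sum>i\<in>Y. l i * F i v)"
  proof
    fix v
    show "(if v \<in> X s then P {z\<in>PiE S X. z s = v} B else 0) = (\<Sum>i\<in>Y. l i * F i v)"
    proof (cases "v \<in> X s")
      case False thus ?thesis unfolding F_def by simp
    next
      case True
      define E where "E = {z\<in>PiE S X. z s = v}"
      have EO: "E \<subseteq> PiE S X" unfolding E_def by auto
      have "P E B = P (E \<inter> B) B" by (rule fcp_inter[OF fcp EO BO Bne])
      also have "E \<inter> B = (\<Union>i\<in>Y. E \<inter> cylinder S X Nd i)" using BU by auto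
      also have "P (\<Union>i\<in>Y. E \<inter> cylinder S X Nd i) B = (\<Sum>i\<in>Y. P (E \<inter> cylinder S X Nd i) B)"
        by (rule fcp_UNION[OF fcp BO Bne finite_configs finY]) (use EO dj in blast)+
      also have "\<dots> = (\<Sum>i\<in>Y. l i * F i v)"
      proof (rule sum.cong[OF refl])
        fix i assume i: "i \<in> Y"
        have sub: "cylinder S X Nd i \<subseteq> B" using BU i by auto
        have "P (E \<inter> cylinder S X Nd i) B = P E (cylinder S X Nd i \<inter> B) * P (cylinder S X Nd i) B"
          by (rule fcp_chain[OF fcp EO BO cylO[rule_format, OF i] Bne]) (use sub cylne i in auto)
        also have "cylinder S X Nd i \<inter> B = cylinder S X Nd i" using sub by auto
        also have "cylinder S X Nd i = {z\<in>PiE S X. restrict z Nd = i}"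
          using restrict_eq_cylinder[of i Nd X S] i unfolding Y_def by auto
        finally show "P (E \<inter> cylinder S X Nd i) B = l i * F i v"
          unfolding l_def F_def E_def using True restrict_eq_cylinder[of i Nd X S] i unfolding Y_def by auto
      qed
      finally show ?thesis using True unfolding E_def by simp
    qed
  qed
  ultimately show ?thesis unfolding B_def by simp
qed

definition lift :: "'n set \<Rightarrow> ('n \<Rightarrow> 'v set) \<Rightarrow> 'n set \<Rightarrow> ('n \<Rightarrow> 'v) set \<Rightarrow> ('n \<Rightarrow> 'v) set" where
  "lift S X T A = {z \<in> PiE S X. restrict z T \<in> A}"

lemma lift_subset: "lift S X T A \<subseteq> PiE S X" unfolding lift_def by auto
lemma lift_Int: "lift S X T (A \<inter> C) = lift S X T A \<inter> lift S X T C" unfolding lift_def by auto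
lemma lift_Un: "lift S X T (A \<union> C) = lift S X T A \<union> lift S X T C" unfolding lift_def by auto
lemma lift_disjoint: "A \<inter> C = {} \<Longrightarrow> lift S X T A \<inter> lift S X T C = {}" unfolding lift_def by auto
lemma lift_PiE: "T \<subseteq> S \<Longrightarrow> lift S X T (PiE T X) = PiE S X"
  unfolding lift_def by (auto simp: PiE_def Pi_def)

lemma restrict_default_ext:
  assumes "\<forall>t\<in>S. X t \<noteq> {}" "b \<in> PiE T X" "T \<subseteq> S"
  shows "restrict (default_ext S X T b) T = b"
  using assms unfolding default_ext_def by (auto simp: PiE_def extensional_def fun_eq_iff)

lemma lift_nonempty:
  assumes "\<forall>t\<in>S. X t \<noteq> {}" "T \<subseteq> S" "B \<subseteq> PiE T X" "B \<noteq> {}"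
  shows "lift S X T B \<noteq> {}"
proof -
  obtain b where b: "b \<in> B" using assms by auto
  have bP: "b \<in> PiE T X" using b assms by auto
  have "default_ext S X T b \<in> PiE S X" by (rule default_ext_in(1)) (use assms bP in auto)
  moreover have "restrict (default_ext S X T b) T = b" by (rule restrict_default_ext[OF assms(1) bP assms(2)])
  ultimately show ?thesis using b unfolding lift_def by auto
qed

lemma fcp_marginal:
  assumes ne: "\<forall>t\<in>S. X t \<noteq> {}" and fcp: "full_cond_prob (PiE S X) P" and TS: "T \<subseteq> S"
  shows "full_cond_prob (PiE T X) (\<lambda>A B. P (lift S X T A) (lift S X T B))"
  unfolding full_cond_prob_def
proof (intro conjI allI impI)
  fix B assume B: "B \<subseteq> PiE T X \<and> B \<noteq> {}"
  have B1: "lift S X T B \<subseteq> PiE S X" "lift S X T B \<noteq> {}" using lift_subset[of S X T B] lift_nonempty[OF ne TS, of B] B by auto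
  note F1 = fcp_measure[OF fcp B1]
  show "0 \<le> P (lift S X T A) (lift S X T B)" if "A \<subseteq> PiE T X" for A by (rule F1(1)[OF lift_subset])
  show "P (lift S X T (PiE T X)) (lift S X T B) = 1" using F1(2) lift_PiE[OF TS, of X] by metis
  show "P (lift S X T (A \<union> C)) (lift S X T B) = P (lift S X T A) (lift S X T B) + P (lift S X T C) (lift S X T B)"
    if a: "A \<subseteq> PiE T X \<and> C \<subseteq> PiE T X \<and> A \<inter> C = {}" for A C
  proof -
    show "P (lift S X T (A \<union> C)) (lift S X T B) = P (lift S X T A) (lift S X T B) + P (lift S X T C) (lift S X T B)"
      unfolding lift_Un by (rule F1(3)[OF lift_subset lift_subset]) (use a lift_disjoint[of A C S X T] in auto)
  qed
  show "P (lift S X T B) (lift S X T B) = 1" using F1(4) .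
next
  fix A B C assume a: "A \<subseteq> PiE T X \<and> B \<subseteq> PiE T X \<and> C \<subseteq> PiE T X \<and> B \<noteq> {} \<and> C \<inter> B \<noteq> {}"
  have "lift S X T B \<noteq> {}" "lift S X T (C \<inter> B) \<noteq> {}" using lift_nonempty[OF ne TS, of B] lift_nonempty[OF ne TS, of "C \<inter> B"] a by auto
  thus "P (lift S X T (A \<inter> C)) (lift S X T B) = P (lift S X T A) (lift S X T (C \<inter> B)) * P (lift S X T C) (lift S X T B)"
  proof -
    have "P (lift S X T A \<inter> lift S X T C) (lift S X T B) = P (lift S X T A) (lift S X T C \<inter> lift S X T B) * P (lift S X T C) (lift S X T B)"
      by (rule fcp_chain[OF fcp lift_subset lift_subset lift_subset]) (use \<open>lift S X T B \<noteq> {}\<close> \<open>lift S X T (C \<inter> B) \<noteq> {}\<close> lift_Int[of S X T C B] in auto)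
    thus ?thesis using lift_Int by metis
  qed
qed

lemma fcp_restrict_superset:
  assumes fcp: "full_cond_prob Om P" "A \<subseteq> Om" "B \<subseteq> Om" "B \<noteq> {}" "B \<subseteq> C0" "C0 \<subseteq> Om"
  shows "P (A \<inter> C0) B = P A B"
proof -
  have "P (A \<inter> C0) B = P A (C0 \<inter> B) * P C0 B"
    by (rule fcp_chain) (use assms in auto)
  moreover have "C0 \<inter> B = B" using assms by auto
  moreover have "P C0 B = 1"
  proof -
    have "P B B \<le> P C0 B" by (rule fcp_mono) (use assms in auto)
    moreover have "P C0 B \<le> P Om B" by (rule fcp_mono) (use assms in auto)
    ultimately show ?thesis using fcp_measure(2,4)[OF assms(1,3,4)] by auto
  qed
  ultimately show ?thesis by simp
qed

lemma default_ext2_in: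
  assumes ne: "\<forall>t\<in>S. X t \<noteq> {}" and T: "T1 \<subseteq> S" "T2 \<subseteq> S" "T1 \<inter> T2 = {}"
    and c: "c \<in> PiE T1 X" and b: "b \<in> PiE T2 X"
  shows "default_ext S X (T1 \<union> T2) (\<lambda>t. if t \<in> T1 then c t else b t) \<in> cylinder S X T1 c \<inter> lift S X T2 {b}"
proof -
  define z where "z = default_ext S X (T1 \<union> T2) (\<lambda>t. if t \<in> T1 then c t else b t)"
  have zP: "z \<in> PiE S X" unfolding z_def by (rule default_ext_in(1)) (use ne c b in \<open>auto simp: PiE_def Pi_def\<close>)
  have zv: "\<forall>t\<in>(T1 \<union> T2) \<inter> S. z t = (if t \<in> T1 then c t else b t)"
    unfolding z_def by (rule default_ext_in(2)) (use ne c b in \<open>auto simp: PiE_def Pi_def\<close>)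
  have "z \<in> cylinder S X T1 c" using zP zv T unfolding cylinder_def by auto
  moreover have "\<forall>t\<in>T2. z t = b t"
  proof
    fix t assume t: "t \<in> T2"
    hence "t \<in> (T1 \<union> T2) \<inter> S" "t \<notin> T1" using T by auto
    thus "z t = b t" using zv by auto
  qed
  hence "restrict z T2 = b" using b by (auto simp: restrict_def PiE_def extensional_def fun_eq_iff)
  ultimately show ?thesis using zP unfolding z_def lift_def by auto
qed

lemma fcp_conditional:
  assumes ne: "\<forall>t\<in>S. X t \<noteq> {}" and fcp: "full_cond_prob (PiE S X) P"
    and T: "T1 \<subseteq> S" "T2 \<subseteq> S" "T1 \<inter> T2 = {}" and c: "c \<in> PiE T1 X"
  shows "full_cond_prob (PiE T2 X) (\<lambda>A B. P (lift S X T2 A \<inter> cylinder S X T1 c) (lift S X T2 B \<inter> cylinder S X T1 c))"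
proof -
  define C0 where "C0 = cylinder S X T1 c"
  have C0O: "C0 \<subseteq> PiE S X" unfolding C0_def by (rule cylinder_subset)
  have ne2: "\<And>B. B \<subseteq> PiE T2 X \<Longrightarrow> B \<noteq> {} \<Longrightarrow> lift S X T2 B \<inter> C0 \<noteq> {}"
  proof -
    fix B assume "B \<subseteq> PiE T2 X" "B \<noteq> {}"
    then obtain b where b: "b \<in> B" "b \<in> PiE T2 X" by auto
    have "default_ext S X (T1 \<union> T2) (\<lambda>t. if t \<in> T1 then c t else b t) \<in> C0 \<inter> lift S X T2 {b}"
      unfolding C0_def by (rule default_ext2_in[OF ne T c b(2)])
    thus "lift S X T2 B \<inter> C0 \<noteq> {}" using b unfolding lift_def by auto
  qed
  have sub: "\<And>A. lift S X T2 A \<inter> C0 \<subseteq> PiE S X" using lift_subset by blast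
  show ?thesis
    unfolding C0_def[symmetric] full_cond_prob_def
  proof (intro conjI allI impI)
    fix B assume B: "B \<subseteq> PiE T2 X \<and> B \<noteq> {}"
    have B1: "lift S X T2 B \<inter> C0 \<subseteq> PiE S X" "lift S X T2 B \<inter> C0 \<noteq> {}" using sub ne2 B by auto
    note F1 = fcp_measure[OF fcp B1]
    show "0 \<le> P (lift S X T2 A \<inter> C0) (lift S X T2 B \<inter> C0)" if "A \<subseteq> PiE T2 X" for A by (rule F1(1)[OF sub])
    have "P (PiE S X \<inter> C0) (lift S X T2 B \<inter> C0) = P (PiE S X) (lift S X T2 B \<inter> C0)"
      by (rule fcp_restrict_superset[OF fcp]) (use B1 C0O in auto)
    hence "P (lift S X T2 (PiE T2 X) \<inter> C0) (lift S X T2 B \<inter> C0) = P (PiE S X) (lift S X T2 B \<inter> C0)"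
      using lift_PiE[OF T(2), of X] by metis
    thus "P (lift S X T2 (PiE T2 X) \<inter> C0) (lift S X T2 B \<inter> C0) = 1" using F1(2) by simp
    show "P (lift S X T2 (A \<union> C) \<inter> C0) (lift S X T2 B \<inter> C0) = P (lift S X T2 A \<inter> C0) (lift S X T2 B \<inter> C0) + P (lift S X T2 C \<inter> C0) (lift S X T2 B \<inter> C0)"
      if a: "A \<subseteq> PiE T2 X \<and> C \<subseteq> PiE T2 X \<and> A \<inter> C = {}" for A C
    proof -
      have "lift S X T2 (A \<union> C) \<inter> C0 = (lift S X T2 A \<inter> C0) \<union> (lift S X T2 C \<inter> C0)" using lift_Un by blast
      moreover have "(lift S X T2 A \<inter> C0) \<inter> (lift S X T2 C \<inter> C0) = {}" using lift_disjoint a by blast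
      ultimately show "P (lift S X T2 (A \<union> C) \<inter> C0) (lift S X T2 B \<inter> C0) = P (lift S X T2 A \<inter> C0) (lift S X T2 B \<inter> C0) + P (lift S X T2 C \<inter> C0) (lift S X T2 B \<inter> C0)"
        using F1(3)[OF sub sub] by simp
    qed
    show "P (lift S X T2 B \<inter> C0) (lift S X T2 B \<inter> C0) = 1" using F1(4) .
  next
    fix A B C assume a: "A \<subseteq> PiE T2 X \<and> B \<subseteq> PiE T2 X \<and> C \<subseteq> PiE T2 X \<and> B \<noteq> {} \<and> C \<inter> B \<noteq> {}"
    have n1: "lift S X T2 B \<inter> C0 \<noteq> {}" "lift S X T2 (C \<inter> B) \<inter> C0 \<noteq> {}"
      using ne2[of B] ne2[of "C \<inter> B"] a by auto
    have e1: "(lift S X T2 A \<inter> C0) \<inter> (lift S X T2 C \<inter> C0) = lift S X T2 (A \<inter> C) \<inter> C0" using lift_Int by blast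
    have e2: "(lift S X T2 C \<inter> C0) \<inter> (lift S X T2 B \<inter> C0) = lift S X T2 (C \<inter> B) \<inter> C0" using lift_Int by blast
    have "P ((lift S X T2 A \<inter> C0) \<inter> (lift S X T2 C \<inter> C0)) (lift S X T2 B \<inter> C0)
       = P (lift S X T2 A \<inter> C0) ((lift S X T2 C \<inter> C0) \<inter> (lift S X T2 B \<inter> C0)) * P (lift S X T2 C \<inter> C0) (lift S X T2 B \<inter> C0)"
      by (rule fcp_chain[OF fcp sub sub sub n1(1)]) (use e2 n1 in auto)
    thus "P (lift S X T2 (A \<inter> C) \<inter> C0) (lift S X T2 B \<inter> C0) = P (lift S X T2 A \<inter> C0) (lift S X T2 (C \<inter> B) \<inter> C0) * P (lift S X T2 C \<inter> C0) (lift S X T2 B \<inter> C0)"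
      using e1 e2 by simp
  qed
qed

lemma fcp_singleton_bounds:
  assumes "full_cond_prob Om P" "Om \<noteq> {}" "z \<in> Om"
  shows "0 \<le> P {z} Om" "P {z} Om \<le> 1"
proof -
  show "0 \<le> P {z} Om" using fcp_measure(1)[OF assms(1) _ assms(2)] assms(3) by auto
  have "P {z} Om \<le> P Om Om" by (rule fcp_mono) (use assms in auto)
  thus "P {z} Om \<le> 1" using fcp_measure(2)[OF assms(1) _ assms(2)] by auto
qed

lemma expectation_ge_min:
  assumes "full_cond_prob Om P" "Om \<noteq> {}" "finite Om"
  shows "- (\<Sum>z\<in>Om. \<bar>f z\<bar>) \<le> (\<Sum>z\<in>Om. f z * P {z} Om)"
proof -
  have "(\<Sum>z\<in>Om. - \<bar>f z\<bar>) \<le> (\<Sum>z\<in>Om. f z * P {z} Om)"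
  proof (rule sum_mono)
    fix z assume z: "z \<in> Om"
    note b = fcp_singleton_bounds[OF assms(1,2) z]
    show "- \<bar>f z\<bar> \<le> f z * P {z} Om"
    proof (cases "f z \<ge> 0")
      case True thus ?thesis using b by (smt (verit) mult_nonneg_nonneg)
    next
      case False
      have "f z * P {z} Om \<ge> f z * 1" using b False by (intro mult_left_mono_neg) auto
      thus ?thesis using False by auto
    qed
  qed
  thus ?thesis by (simp add: sum_negf)
qed

lemma expectation_le_max:
  assumes "full_cond_prob Om P" "Om \<noteq> {}" "finite Om"
  shows "(\<Sum>z\<in>Om. f z * P {z} Om) \<le> (\<Sum>z\<in>Om. \<bar>f z\<bar>)"
  using expectation_ge_min[OF assms, of "\<lambda>z. - f z"] by (simp add: sum_negf)

lemma bdd_below_expectations: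
  assumes "\<forall>P\<in>Ps. full_cond_prob Om P" "Om \<noteq> {}" "finite Om"
  shows "bdd_below {(\<Sum>z\<in>Om. f z * P {z} Om) | P. P \<in> Ps}"
  unfolding bdd_below_def using expectation_ge_min[OF _ assms(2,3)] assms(1) by blast

lemma bdd_above_expectations:
  assumes "\<forall>P\<in>Ps. full_cond_prob Om P" "Om \<noteq> {}" "finite Om"
  shows "bdd_above {(\<Sum>z\<in>Om. f z * P {z} Om) | P. P \<in> Ps}"
  unfolding bdd_above_def using expectation_le_max[OF _ assms(2,3)] assms(1) by blast

section \<open>Splitting a model of the network\<close>

locale credal_part = closed_part +
  fixes X :: "'a \<Rightarrow> 'v set" and M :: "'a \<Rightarrow> ('a \<Rightarrow> 'v) \<Rightarrow> ('v \<Rightarrow> real) set"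
  assumes net: "credal_network G par X M"
begin

lemma finite_X: "\<forall>t\<in>G. finite (X t)" using net unfolding credal_network_def by auto
lemma X_nonempty: "\<forall>t\<in>G. X t \<noteq> {}" using net unfolding credal_network_def by auto
lemma local_model_props: "s \<in> G \<Longrightarrow> xp \<in> PiE (par s) X \<Longrightarrow> M s xp \<noteq> {} \<and> convex_fun_set (M s xp) \<and> (\<forall>p\<in>M s xp. is_pmf_on (X s) p)"
  using net unfolding credal_network_def by auto

lemma finite_configs: "finite (PiE G X)" using finite_PiE_ball finite_G finite_X by blast
lemma finite_configs_on: "T \<subseteq> G \<Longrightarrow> finite (PiE T X)" using finite_PiE_ball[of T X] finite_G finite_X finite_subset by blast
lemma configs_on_nonempty: "T \<subseteq> G \<Longrightarrow> PiE T X \<noteq> {}" using X_nonempty by (auto simp: PiE_eq_empty_iff)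

definition marg_N :: "(('a \<Rightarrow> 'v) set \<Rightarrow> ('a \<Rightarrow> 'v) set \<Rightarrow> real) \<Rightarrow> ('a \<Rightarrow> 'v) set \<Rightarrow> ('a \<Rightarrow> 'v) set \<Rightarrow> real" where
  "marg_N P = (\<lambda>A B. P (lift G X N A) (lift G X N B))"

definition cond_K :: "(('a \<Rightarrow> 'v) set \<Rightarrow> ('a \<Rightarrow> 'v) set \<Rightarrow> real) \<Rightarrow> ('a \<Rightarrow> 'v) \<Rightarrow> ('a \<Rightarrow> 'v) set \<Rightarrow> ('a \<Rightarrow> 'v) set \<Rightarrow> real" where
  "cond_K P w = (\<lambda>A B. P (lift G X K A \<inter> cylinder G X N w) (lift G X K B \<inter> cylinder G X N w))"

lemma irr_ext_fcp: "P \<in> irr_ext S pa X' M' \<Longrightarrow> full_cond_prob (PiE S X') P"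
  unfolding irr_ext_def by auto

lemma irr_ext_local: "P \<in> irr_ext S pa X' M' \<Longrightarrow> s \<in> S \<Longrightarrow> xN \<in> PiE (nondesc S pa s) X' \<Longrightarrow>
   (\<lambda>v. if v \<in> X' s then P {z\<in>PiE S X'. z s = v} {z\<in>PiE S X'. restrict z (nondesc S pa s) = xN} else 0) \<in> M' s (restrict xN (pa s))"
  unfolding irr_ext_def by auto

lemma lift_node_event: "s \<in> T \<Longrightarrow> T \<subseteq> S \<Longrightarrow> lift S X T {w \<in> PiE T X. w s = v} = {z \<in> PiE S X. z s = v}"
  unfolding lift_def by (auto simp: PiE_def Pi_def)

lemma lift_restrict_event: "C \<subseteq> T \<Longrightarrow> T \<subseteq> S \<Longrightarrow> xN \<in> PiE C X \<Longrightarrow>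
    lift S X T {w \<in> PiE T X. restrict w C = xN} = cylinder S X C xN"
  unfolding lift_def cylinder_def by (auto simp: PiE_def Pi_def extensional_def fun_eq_iff)

lemma marg_N_irr_ext:
  assumes P: "P \<in> irr_ext G par X M"
  shows "marg_N P \<in> irr_ext N (sub_pa par N) X (\<lambda>s z. M s (restrict z (par s)))"
proof -
  have fcpP: "full_cond_prob (PiE G X) P" using irr_ext_fcp[OF P] .
  have fcpQ: "full_cond_prob (PiE N X) (marg_N P)"
    unfolding marg_N_def by (rule fcp_marginal[OF X_nonempty fcpP N_subset])
  have loc: "(\<lambda>v. if v \<in> X s then marg_N P {z\<in>PiE N X. z s = v} {z\<in>PiE N X. restrict z (nondesc N (sub_pa par N) s) = xN} else 0)
      \<in> M s (restrict (restrict xN (sub_pa par N s)) (par s))"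
    if s: "s \<in> N" and xN: "xN \<in> PiE (nondesc N (sub_pa par N) s) X" for s xN
  proof -
    define Nn where "Nn = nondesc N (sub_pa par N) s"
    have Nn: "Nn = nondesc G par s \<inter> N" unfolding Nn_def by (rule nondesc_sub_pa[OF closed_set_N s])
    have sG: "s \<in> G" using s N_subset by auto
    have parsN: "par s \<subseteq> N" using par_subset_N[OF s] .
    have parsNn: "par s \<subseteq> Nn" using Nn parsN par_subset_nondesc[OF sG] by auto
    have e1: "restrict (restrict xN (sub_pa par N s)) (par s) = restrict xN (par s)"
      using parsN unfolding sub_pa_def by (auto simp: restrict_def fun_eq_iff)
    have xpP: "restrict xN (par s) \<in> PiE (par s) X" using xN parsNn unfolding Nn_def by (auto simp: PiE_def Pi_def)
    have cvx: "convex_fun_set (M s (restrict xN (par s)))" using local_model_props[OF sG xpP] by auto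
    have co: "(\<lambda>v. if v \<in> X s then P {z\<in>PiE G X. z s = v} (cylinder G X Nn xN) else 0) \<in> M s (restrict xN (par s))"
    proof (rule local_model_coarsen[OF finite_G finite_X X_nonempty fcpP, of "nondesc G par s" Nn xN s "\<lambda>xN'. M s (restrict xN' (par s))"])
      show "nondesc G par s \<subseteq> G" by (rule nondesc_subset)
      show "Nn \<subseteq> nondesc G par s" using Nn by auto
      show "\<forall>t\<in>Nn. xN t \<in> X t" using xN unfolding Nn_def by auto
      show "\<forall>xN'\<in>PiE (nondesc G par s) X. (\<lambda>v. if v \<in> X s then P {z\<in>PiE G X. z s = v} {z\<in>PiE G X. restrict z (nondesc G par s) = xN'} else 0) \<in> M s (restrict xN' (par s))"
        using irr_ext_local[OF P sG] by auto
      show "\<forall>xN'\<in>PiE (nondesc G par s) X. (\<forall>t\<in>Nn. xN' t = xN t) \<longrightarrow> M s (restrict xN' (par s)) = M s (restrict xN (par s))"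
      proof (intro ballI impI)
        fix xN' assume "\<forall>t\<in>Nn. xN' t = xN t"
        hence "restrict xN' (par s) = restrict xN (par s)" using parsNn by (intro restrict_ext) auto
        thus "M s (restrict xN' (par s)) = M s (restrict xN (par s))" by simp
      qed
      show "convex_fun_set (M s (restrict xN (par s)))" by (rule cvx)
    qed
    have "(\<lambda>v. if v \<in> X s then marg_N P {z\<in>PiE N X. z s = v} {z\<in>PiE N X. restrict z Nn = xN} else 0)
        = (\<lambda>v. if v \<in> X s then P {z\<in>PiE G X. z s = v} (cylinder G X Nn xN) else 0)"
      unfolding marg_N_def using lift_node_event[OF s N_subset] lift_restrict_event[OF _ N_subset, of Nn xN] Nn xN unfolding Nn_def by auto
    thus ?thesis using co e1 unfolding Nn_def by simp
  qed
  show ?thesis unfolding irr_ext_def using fcpQ loc by auto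
qed

lemma cond_K_irr_ext:
  assumes P: "P \<in> irr_ext G par X M" and w: "w \<in> PiE N X"
  shows "cond_K P w \<in> irr_ext K (sub_pa par K) X (sub_M par M K (restrict w PK))"
proof -
  have fcpP: "full_cond_prob (PiE G X) P" using irr_ext_fcp[OF P] .
  have fcpR: "full_cond_prob (PiE K X) (cond_K P w)"
    unfolding cond_K_def by (rule fcp_conditional[OF X_nonempty fcpP N_subset K_subset _ w]) (use K_N_disjoint in auto)
  define C0 where "C0 = cylinder G X N w"
  have loc: "(\<lambda>v. if v \<in> X k then cond_K P w {z\<in>PiE K X. z k = v} {z\<in>PiE K X. restrict z (nondesc K (sub_pa par K) k) = xk} else 0)
      \<in> sub_M par M K (restrict w PK) k (restrict xk (sub_pa par K k))"
    if k: "k \<in> K" and xk: "xk \<in> PiE (nondesc K (sub_pa par K) k) X" for k xk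
  proof -
    define Kn where "Kn = nondesc K (sub_pa par K) k"
    have Kn: "Kn = nondesc G par k \<inter> K" unfolding Kn_def by (rule nondesc_sub_pa[OF closedK k])
    have kG: "k \<in> G" using k K_subset by auto
    define mw where "mw = (\<lambda>t. if t \<in> K then xk t else w t)"
    define C where "C = Kn \<union> N"
    have CNd: "C \<subseteq> nondesc G par k" unfolding C_def using Kn N_subset_nondesc_K[OF k] by auto
    have park: "par k \<subseteq> C" unfolding C_def using Kn par_subset_nondesc[OF kG] par_subset_K_PK[OF k] PK_subset_N by auto
    have KnK: "Kn \<subseteq> K" using Kn by auto
    have xkX: "\<forall>t\<in>Kn. xk t \<in> X t" using xk unfolding Kn_def by auto
    have mwX: "\<forall>t\<in>C. mw t \<in> X t" unfolding C_def mw_def using xkX w KnK K_N_disjoint by (auto simp: PiE_def Pi_def)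
    have xpP: "restrict mw (par k) \<in> PiE (par k) X" using mwX park by (auto simp: PiE_def Pi_def)
    have cvx: "convex_fun_set (M k (restrict mw (par k)))" using local_model_props[OF kG xpP] by auto
    have co: "(\<lambda>v. if v \<in> X k then P {z\<in>PiE G X. z k = v} (cylinder G X C mw) else 0) \<in> M k (restrict mw (par k))"
    proof (rule local_model_coarsen[OF finite_G finite_X X_nonempty fcpP, of "nondesc G par k" C mw k "\<lambda>xN'. M k (restrict xN' (par k))"])
      show "nondesc G par k \<subseteq> G" by (rule nondesc_subset)
      show "C \<subseteq> nondesc G par k" by (rule CNd)
      show "\<forall>t\<in>C. mw t \<in> X t" by (rule mwX)
      show "\<forall>xN'\<in>PiE (nondesc G par k) X. (\<lambda>v. if v \<in> X k then P {z\<in>PiE G X. z k = v} {z\<in>PiE G X. restrict z (nondesc G par k) = xN'} else 0) \<in> M k (restrict xN' (par k))"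
        using irr_ext_local[OF P kG] by auto
      show "\<forall>xN'\<in>PiE (nondesc G par k) X. (\<forall>t\<in>C. xN' t = mw t) \<longrightarrow> M k (restrict xN' (par k)) = M k (restrict mw (par k))"
      proof (intro ballI impI)
        fix xN' assume "\<forall>t\<in>C. xN' t = mw t"
        hence "restrict xN' (par k) = restrict mw (par k)" using park by (intro restrict_ext) auto
        thus "M k (restrict xN' (par k)) = M k (restrict mw (par k))" by simp
      qed
      show "convex_fun_set (M k (restrict mw (par k)))" by (rule cvx)
    qed
    have cylC: "cylinder G X Kn xk \<inter> C0 = cylinder G X C mw"
      unfolding C0_def C_def mw_def cylinder_def using K_N_disjoint KnK by auto
    have Rv: "cond_K P w {z\<in>PiE K X. z k = v} {z\<in>PiE K X. restrict z Kn = xk} = P {z\<in>PiE G X. z k = v} (cylinder G X C mw)" for v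
    proof -
      have "cond_K P w {z\<in>PiE K X. z k = v} {z\<in>PiE K X. restrict z Kn = xk}
          = P ({z\<in>PiE G X. z k = v} \<inter> C0) (cylinder G X Kn xk \<inter> C0)"
        unfolding cond_K_def C0_def using lift_node_event[OF k K_subset] lift_restrict_event[OF KnK K_subset] xk unfolding Kn_def by auto
      also have "\<dots> = P {z\<in>PiE G X. z k = v} (cylinder G X Kn xk \<inter> C0)"
      proof (rule fcp_restrict_superset[OF fcpP])
        show "cylinder G X Kn xk \<inter> C0 \<noteq> {}" unfolding cylC C_def
          by (rule cylinder_nonempty[OF X_nonempty]) (use mwX KnK K_subset N_subset in \<open>auto simp: C_def\<close>)
      qed (auto simp: C0_def cylinder_def)
      finally show ?thesis using cylC by simp
    qed
    have e1: "sub_M par M K (restrict w PK) k (restrict xk (sub_pa par K k)) = M k (restrict mw (par k))"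
    proof -
      have "restrict (\<lambda>t. if t \<in> K then restrict xk (sub_pa par K k) t else restrict w PK t) (par k) = restrict mw (par k)"
        using par_subset_K_PK[OF k] unfolding mw_def sub_pa_def by (auto simp: restrict_def fun_eq_iff)
      thus ?thesis unfolding sub_M_def by simp
    qed
    have eqf: "(\<lambda>v. if v \<in> X k then cond_K P w {z\<in>PiE K X. z k = v} {z\<in>PiE K X. restrict z Kn = xk} else 0)
       = (\<lambda>v. if v \<in> X k then P {z\<in>PiE G X. z k = v} (cylinder G X C mw) else 0)"
      by (rule ext) (simp only: Rv)
    show ?thesis unfolding Kn_def[symmetric] eqf e1 by (rule co)
  qed
  show ?thesis unfolding irr_ext_def using fcpR loc by auto
qed

lemma expectation_decompose:
  assumes P: "P \<in> irr_ext G par X M"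
  shows "(\<Sum>z\<in>PiE G X. F (restrict z N) * f (restrict z K) * P {z} (PiE G X))
       = (\<Sum>w\<in>PiE N X. F w * marg_N P {w} (PiE N X) * (\<Sum>u\<in>PiE K X. f u * cond_K P w {u} (PiE K X)))"
proof -
  define Om where "Om = PiE G X"
  have fcpP: "full_cond_prob Om P" using irr_ext_fcp[OF P] unfolding Om_def .
  have finOm: "finite Om" unfolding Om_def by (rule finite_configs)
  have OmNe: "Om \<noteq> {}" unfolding Om_def using configs_on_nonempty[of G] by auto
  have img1: "(\<lambda>z. restrict z N) ` Om \<subseteq> PiE N X" unfolding Om_def image_subset_iff
    using restrict_in_PiE[OF _ N_subset] by (intro ballI)
  have img2: "(\<lambda>z. restrict z K) ` A \<subseteq> PiE K X" if "A \<subseteq> Om" for A unfolding image_subset_iff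
  proof
    fix z assume "z \<in> A"
    hence "z \<in> PiE G X" using that unfolding Om_def by auto
    thus "restrict z K \<in> PiE K X" by (rule restrict_in_PiE[OF _ K_subset])
  qed
  define H where "H z = F (restrict z N) * f (restrict z K) * P {z} Om" for z
  have "(\<Sum>z\<in>Om. H z) = (\<Sum>w\<in>PiE N X. \<Sum>z\<in>{z\<in>Om. restrict z N = w}. H z)"
    by (rule sum.group[symmetric, OF finOm finite_configs_on[OF N_subset] img1])
  also have "\<dots> = (\<Sum>w\<in>PiE N X. F w * marg_N P {w} (PiE N X) * (\<Sum>u\<in>PiE K X. f u * cond_K P w {u} (PiE K X)))"
  proof (rule sum.cong[OF refl])
    fix w assume w: "w \<in> PiE N X"
    define Cw where "Cw = {z\<in>Om. restrict z N = w}"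
    have Cw: "Cw = cylinder G X N w" unfolding Cw_def Om_def by (rule restrict_eq_cylinder[OF w])
    have CwO: "Cw \<subseteq> Om" unfolding Cw_def by auto
    have Cwne: "Cw \<noteq> {}" unfolding Cw by (rule cylinder_nonempty[OF X_nonempty]) (use w N_subset in auto)
    have finCw: "finite Cw" using CwO finOm finite_subset by auto
    have "(\<Sum>z\<in>Cw. H z) = (\<Sum>u\<in>PiE K X. \<Sum>z\<in>{z\<in>Cw. restrict z K = u}. H z)"
      by (rule sum.group[symmetric, OF finCw finite_configs_on[OF K_subset] img2[OF CwO]])
    also have "\<dots> = (\<Sum>u\<in>PiE K X. F w * marg_N P {w} (PiE N X) * (f u * cond_K P w {u} (PiE K X)))"
    proof (rule sum.cong[OF refl])
      fix u assume u: "u \<in> PiE K X"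
      define Cwu where "Cwu = {z\<in>Cw. restrict z K = u}"
      have CwuO: "Cwu \<subseteq> Om" using CwO unfolding Cwu_def by auto
      have s1: "(\<Sum>z\<in>Cwu. H z) = (\<Sum>z\<in>Cwu. F w * f u * P {z} Om)"
        unfolding H_def Cwu_def Cw_def by (rule sum.cong) auto
      also have "\<dots> = F w * f u * P Cwu Om"
        by (simp add: sum_distrib_left fcp_sum[OF fcpP _ OmNe _ CwuO] finite_subset[OF CwuO finOm])
      finally have s1: "(\<Sum>z\<in>Cwu. H z) = F w * f u * P Cwu Om" .
      have "Cwu = lift G X K {u} \<inter> Cw" unfolding Cwu_def lift_def using CwO unfolding Om_def by blast
      hence "P Cwu Om = P (lift G X K {u} \<inter> Cw) Om" by simp
      also have "P (lift G X K {u} \<inter> Cw) Om = P (lift G X K {u}) (Cw \<inter> Om) * P Cw Om"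
        by (rule fcp_chain[OF fcpP]) (use lift_subset[of G X K "{u}"] CwO OmNe Cwne in \<open>auto simp: Om_def\<close>)
      also have "Cw \<inter> Om = Cw" using CwO by auto
      also have "P (lift G X K {u}) Cw = cond_K P w {u} (PiE K X)"
      proof -
        have "cond_K P w {u} (PiE K X) = P (lift G X K {u} \<inter> Cw) Cw"
        proof -
          have "PiE G X \<inter> Cw = Cw" using CwO unfolding Om_def by auto
          thus ?thesis unfolding cond_K_def Cw[symmetric] using lift_PiE[OF K_subset, of X] by simp
        qed
        also have "\<dots> = P (lift G X K {u}) Cw"
          by (rule fcp_inter[OF fcpP, symmetric]) (use lift_subset[of G X K "{u}"] CwO Cwne in \<open>auto simp: Om_def\<close>)
        finally show ?thesis by simp
      qed
      also have "P Cw Om = marg_N P {w} (PiE N X)"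
      proof -
        have "lift G X N {w} = Cw" unfolding lift_def Cw_def Om_def by auto
        thus ?thesis unfolding marg_N_def using lift_PiE[OF N_subset, of X] unfolding Om_def by simp
      qed
      finally show "(\<Sum>z\<in>Cwu. H z) = F w * marg_N P {w} (PiE N X) * (f u * cond_K P w {u} (PiE K X))"
        using s1 by (simp add: algebra_simps)
    qed
    also have "\<dots> = F w * marg_N P {w} (PiE N X) * (\<Sum>u\<in>PiE K X. f u * cond_K P w {u} (PiE K X))"
      by (simp add: sum_distrib_left)
    finally show "(\<Sum>z\<in>{z\<in>Om. restrict z N = w}. H z) = F w * marg_N P {w} (PiE N X) * (\<Sum>u\<in>PiE K X. f u * cond_K P w {u} (PiE K X))"
      unfolding Cw_def .
  qed
  finally show ?thesis unfolding H_def Om_def .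
qed

lemma expectation_lower_bound:
  assumes P: "P \<in> irr_ext G par X M" and xP: "xP \<in> PiE PK X"
    and Fnn: "\<forall>w\<in>PiE N X. F w \<ge> 0" and Find: "\<forall>w\<in>PiE N X. F w \<noteq> 0 \<longrightarrow> restrict w PK = xP"
  shows "lowE_sub K par X M xP f * (\<Sum>w\<in>PiE N X. F w * marg_N P {w} (PiE N X))
         \<le> (\<Sum>z\<in>PiE G X. F (restrict z N) * f (restrict z K) * P {z} (PiE G X))"
proof -
  define a where "a = lowE_sub K par X M xP f"
  have fcpQ: "full_cond_prob (PiE N X) (marg_N P)" using irr_ext_fcp[OF marg_N_irr_ext[OF P]] .
  have "a * (\<Sum>w\<in>PiE N X. F w * marg_N P {w} (PiE N X)) = (\<Sum>w\<in>PiE N X. F w * marg_N P {w} (PiE N X) * a)"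
    by (simp add: sum_distrib_left algebra_simps)
  also have "\<dots> \<le> (\<Sum>w\<in>PiE N X. F w * marg_N P {w} (PiE N X) * (\<Sum>u\<in>PiE K X. f u * cond_K P w {u} (PiE K X)))"
  proof (rule sum_mono)
    fix w assume w: "w \<in> PiE N X"
    show "F w * marg_N P {w} (PiE N X) * a \<le> F w * marg_N P {w} (PiE N X) * (\<Sum>u\<in>PiE K X. f u * cond_K P w {u} (PiE K X))"
    proof (cases "F w = 0")
      case True thus ?thesis by simp
    next
      case False
      hence rw: "restrict w PK = xP" using Find w by auto
      have Rirr: "cond_K P w \<in> irr_ext K (sub_pa par K) X (sub_M par M K xP)" using cond_K_irr_ext[OF P w] rw by simp
      have "a \<le> (\<Sum>u\<in>PiE K X. f u * cond_K P w {u} (PiE K X))"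
        unfolding a_def lowE_sub_def lowE_irr_def
      proof (rule cInf_lower)
        show "(\<Sum>u\<in>PiE K X. f u * cond_K P w {u} (PiE K X)) \<in> {\<Sum>z\<in>PiE K X. f z * P {z} (PiE K X) |P. P \<in> irr_ext K (sub_pa par K) X (sub_M par M K xP)}"
          using Rirr by blast
        show "bdd_below {\<Sum>z\<in>PiE K X. f z * P {z} (PiE K X) |P. P \<in> irr_ext K (sub_pa par K) X (sub_M par M K xP)}"
          by (rule bdd_below_expectations) (use irr_ext_fcp[of _ K "sub_pa par K" X "sub_M par M K xP"] configs_on_nonempty[OF K_subset] finite_configs_on[OF K_subset] in auto)
      qed
      moreover have "F w * marg_N P {w} (PiE N X) \<ge> 0"
        using Fnn w fcp_singleton_bounds(1)[OF fcpQ configs_on_nonempty[OF N_subset] w] by auto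
      ultimately show ?thesis by (simp add: mult_left_mono)
    qed
  qed
  also have "\<dots> = (\<Sum>z\<in>PiE G X. F (restrict z N) * f (restrict z K) * P {z} (PiE G X))"
    by (rule expectation_decompose[OF P, symmetric])
  finally show ?thesis unfolding a_def .
qed

end

section \<open>Limits of strictly positive distributions\<close>

lemma bounded_convergent_subseq:
  fixes x :: "nat \<Rightarrow> 'i \<Rightarrow> real"
  assumes "finite I" "\<forall>n. \<forall>i\<in>I. \<bar>x n i\<bar> \<le> Bd"
  shows "\<exists>\<sigma>. strict_mono \<sigma> \<and> (\<forall>i\<in>I. convergent (\<lambda>n. x (\<sigma> n) i))"
  using assms
proof (induction I rule: finite_induct)
  case empty
  show ?case by (rule exI[of _ id]) (auto simp: strict_mono_def)
next
  case (insert i I)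
  then obtain \<sigma> where \<sigma>: "strict_mono \<sigma>" "\<forall>j\<in>I. convergent (\<lambda>n. x (\<sigma> n) j)" by auto
  define y where "y n = x (\<sigma> n) i" for n
  have "bounded (range y)" unfolding bounded_iff y_def using insert.prems by auto
  then obtain l r where r: "strict_mono (r::nat\<Rightarrow>nat)" "(y \<circ> r) \<longlonglongrightarrow> l"
    using bounded_imp_convergent_subsequence by blast
  show ?case
  proof (rule exI[of _ "\<sigma> \<circ> r"], intro conjI ballI)
    show "strict_mono (\<sigma> \<circ> r)" by (rule strict_mono_o[OF \<sigma>(1) r(1)])
    fix j assume j: "j \<in> insert i I"
    show "convergent (\<lambda>n. x ((\<sigma> \<circ> r) n) j)"
    proof (cases "j = i")
      case True thus ?thesis using r(2) unfolding y_def convergent_def comp_def by auto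
    next
      case False
      hence "j \<in> I" using j by auto
      then obtain L where "(\<lambda>n. x (\<sigma> n) j) \<longlonglongrightarrow> L" using \<sigma>(2) unfolding convergent_def by auto
      hence "((\<lambda>n. x (\<sigma> n) j) \<circ> r) \<longlonglongrightarrow> L" by (rule LIMSEQ_subseq_LIMSEQ[OF _ r(1)])
      thus ?thesis unfolding convergent_def comp_def by auto
    qed
  qed
qed

definition cond_ratio :: "('a \<Rightarrow> real) \<Rightarrow> 'a set \<Rightarrow> 'a set \<Rightarrow> real" where
  "cond_ratio p A B = sum p (A \<inter> B) / sum p B"

lemma cond_ratio_props:
  fixes p :: "'a \<Rightarrow> real"
  assumes fin: "finite Om" and pos: "\<forall>z\<in>Om. p z > 0" and B: "B \<subseteq> Om" "B \<noteq> {}"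
  shows "sum p B > 0"
    and "A \<subseteq> Om \<Longrightarrow> 0 \<le> cond_ratio p A B" and "A \<subseteq> Om \<Longrightarrow> cond_ratio p A B \<le> 1"
    and "cond_ratio p Om B = 1" and "cond_ratio p B B = 1"
    and "A \<inter> C = {} \<Longrightarrow> cond_ratio p (A \<union> C) B = cond_ratio p A B + cond_ratio p C B"
    and "C \<subseteq> Om \<Longrightarrow> C \<inter> B \<noteq> {} \<Longrightarrow> cond_ratio p (A \<inter> C) B = cond_ratio p A (C \<inter> B) * cond_ratio p C B"
proof -
  have finB: "finite B" using B fin finite_subset by auto
  show sB: "sum p B > 0" using sum_pos[OF finB B(2)] pos B by auto
  have nn: "0 \<le> sum p (A \<inter> B)" for A
  proof (intro sum_nonneg)
    fix x assume "x \<in> A \<inter> B"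
    hence "x \<in> Om" using B by auto
    thus "0 \<le> p x" using pos by (simp add: less_imp_le)
  qed
  show "0 \<le> cond_ratio p A B" if "A \<subseteq> Om" unfolding cond_ratio_def using nn sB by auto
  show "cond_ratio p A B \<le> 1" if "A \<subseteq> Om"
  proof -
    have pB: "\<forall>z\<in>B. 0 \<le> p z" using pos B by (auto simp: less_imp_le subset_iff)
    have "sum p (A \<inter> B) \<le> sum p B" using pB finB by (intro sum_mono2) auto
    thus ?thesis unfolding cond_ratio_def using sB by auto
  qed
  show "cond_ratio p Om B = 1" unfolding cond_ratio_def using B sB by (simp add: Int_absorb1)
  show "cond_ratio p B B = 1" unfolding cond_ratio_def using sB by simp
  show "cond_ratio p (A \<union> C) B = cond_ratio p A B + cond_ratio p C B" if "A \<inter> C = {}"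
  proof -
    have "(A \<union> C) \<inter> B = (A \<inter> B) \<union> (C \<inter> B)" by auto
    hence "sum p ((A \<union> C) \<inter> B) = sum p (A \<inter> B) + sum p (C \<inter> B)"
      using that finB by (simp add: sum.union_disjoint disjoint_iff)
    thus ?thesis unfolding cond_ratio_def by (simp add: add_divide_distrib)
  qed
  show "cond_ratio p (A \<inter> C) B = cond_ratio p A (C \<inter> B) * cond_ratio p C B" if "C \<subseteq> Om" "C \<inter> B \<noteq> {}"
  proof -
    have "finite (C \<inter> B)" using finB by auto
    hence "sum p (C \<inter> B) > 0" using sum_pos[of "C \<inter> B" p] that pos B by auto
    moreover have "A \<inter> C \<inter> B = A \<inter> (C \<inter> B)" "C \<inter> B \<inter> B = C \<inter> B" by auto
    ultimately show ?thesis unfolding cond_ratio_def by (simp add: Int_assoc)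
  qed
qed

lemma fcp_cond_ratio_limit:
  fixes p :: "nat \<Rightarrow> 'a \<Rightarrow> real"
  assumes fin: "finite Om" and pos: "\<forall>n. \<forall>z\<in>Om. p n z > 0"
  shows "\<exists>\<sigma> P. strict_mono \<sigma> \<and> full_cond_prob Om P \<and>
     (\<forall>A B. A \<subseteq> Om \<longrightarrow> B \<subseteq> Om \<longrightarrow> B \<noteq> {} \<longrightarrow> (\<lambda>n. cond_ratio (p (\<sigma> n)) A B) \<longlonglongrightarrow> P A B)"
proof -
  define I where "I = Pow Om \<times> {B. B \<subseteq> Om \<and> B \<noteq> {}}"
  define x where "x n i = cond_ratio (p n) (fst i) (snd i)" for n i
  have finI: "finite I" unfolding I_def using fin by auto
  have bd: "\<forall>n. \<forall>i\<in>I. \<bar>x n i\<bar> \<le> 1"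
  proof (intro allI ballI)
    fix n i assume i: "i \<in> I"
    obtain A B where AB: "i = (A, B)" "A \<subseteq> Om" "B \<subseteq> Om" "B \<noteq> {}" using i unfolding I_def by auto
    have pn: "\<forall>z\<in>Om. p n z > 0" using pos by auto
    have "0 \<le> cond_ratio (p n) A B" "cond_ratio (p n) A B \<le> 1"
      using cond_ratio_props(2,3)[OF fin pn AB(3,4) AB(2)] by auto
    thus "\<bar>x n i\<bar> \<le> 1" unfolding x_def AB(1) by auto
  qed
  obtain \<sigma> where \<sigma>: "strict_mono \<sigma>" "\<forall>i\<in>I. convergent (\<lambda>n. x (\<sigma> n) i)"
    using bounded_convergent_subseq[OF finI bd] by blast
  define P where "P A B = lim (\<lambda>n. cond_ratio (p (\<sigma> n)) A B)" for A B
  have lim: "(\<lambda>n. cond_ratio (p (\<sigma> n)) A B) \<longlonglongrightarrow> P A B" if "A \<subseteq> Om" "B \<subseteq> Om" "B \<noteq> {}" for A B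
  proof -
    have "(A, B) \<in> I" unfolding I_def using that by auto
    hence "convergent (\<lambda>n. cond_ratio (p (\<sigma> n)) A B)" using \<sigma>(2) unfolding x_def by auto
    thus ?thesis unfolding P_def by (simp add: convergent_LIMSEQ_iff)
  qed
  have fcp: "full_cond_prob Om P"
    unfolding full_cond_prob_def
  proof (intro conjI allI impI)
    fix B assume B: "B \<subseteq> Om \<and> B \<noteq> {}"
    note rf = cond_ratio_props[OF fin _ conjunct1[OF B] conjunct2[OF B]]
    show "0 \<le> P A B" if "A \<subseteq> Om" for A
      using LIMSEQ_le_const[OF lim[OF that conjunct1[OF B] conjunct2[OF B]]] rf(2)[OF _ that] pos by blast
    show "P Om B = 1"
      using LIMSEQ_unique[OF lim[OF _ conjunct1[OF B] conjunct2[OF B], of Om]] rf(4) pos by auto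
    show "P B B = 1"
      using LIMSEQ_unique[OF lim[OF conjunct1[OF B] conjunct1[OF B] conjunct2[OF B]]] rf(5) pos by auto
    show "P (A \<union> C) B = P A B + P C B" if "A \<subseteq> Om \<and> C \<subseteq> Om \<and> A \<inter> C = {}" for A C
    proof -
      have "(\<lambda>n. cond_ratio (p (\<sigma> n)) (A \<union> C) B) = (\<lambda>n. cond_ratio (p (\<sigma> n)) A B + cond_ratio (p (\<sigma> n)) C B)"
        using rf(6) that pos by auto
      moreover have "(\<lambda>n. cond_ratio (p (\<sigma> n)) A B + cond_ratio (p (\<sigma> n)) C B) \<longlonglongrightarrow> P A B + P C B"
        by (intro tendsto_add lim) (use that B in auto)
      moreover have "(\<lambda>n. cond_ratio (p (\<sigma> n)) (A \<union> C) B) \<longlonglongrightarrow> P (A \<union> C) B"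
        by (rule lim) (use that B in auto)
      ultimately show ?thesis using LIMSEQ_unique by metis
    qed
  next
    fix A B C assume a: "A \<subseteq> Om \<and> B \<subseteq> Om \<and> C \<subseteq> Om \<and> B \<noteq> {} \<and> C \<inter> B \<noteq> {}"
    have e: "(\<lambda>n. cond_ratio (p (\<sigma> n)) (A \<inter> C) B) = (\<lambda>n. cond_ratio (p (\<sigma> n)) A (C \<inter> B) * cond_ratio (p (\<sigma> n)) C B)"
      using cond_ratio_props(7)[OF fin _ _ _ ] a pos by auto
    have "(\<lambda>n. cond_ratio (p (\<sigma> n)) A (C \<inter> B) * cond_ratio (p (\<sigma> n)) C B) \<longlonglongrightarrow> P A (C \<inter> B) * P C B"
      by (intro tendsto_mult lim) (use a in auto)
    moreover have "(\<lambda>n. cond_ratio (p (\<sigma> n)) (A \<inter> C) B) \<longlonglongrightarrow> P (A \<inter> C) B"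
      by (rule lim) (use a in auto)
    ultimately show "P (A \<inter> C) B = P A (C \<inter> B) * P C B" using e LIMSEQ_unique by metis
  qed
  show ?thesis using \<sigma>(1) fcp lim by blast
qed

text \<open>A full conditional probability is a lexicographic hierarchy of ordinary distributions: the
  atoms of positive mass given the whole space form the first layer, the atoms of positive mass
  given the rest form the second one, and so on. Giving the atoms of layer l the weight
  \<open>\<epsilon>\<^sup>l\<close> (times their conditional mass) yields strictly positive distributions whose conditional
  ratios converge to P as \<open>\<epsilon> \<rightarrow> 0\<close>.\<close>

locale fcp_layers =
  fixes Om :: "'a set" and P :: "'a set \<Rightarrow> 'a set \<Rightarrow> real"
  assumes fin: "finite Om" and fcp: "full_cond_prob Om P"
begin

definition layer :: "nat \<Rightarrow> 'a set" where
  "layer i = ((\<lambda>B. B - {w\<in>B. P {w} B > 0}) ^^ i) Om"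

definition level :: "'a \<Rightarrow> nat" where
  "level w = (LEAST i. w \<notin> layer (Suc i))"

definition level_weight :: "'a \<Rightarrow> real" where
  "level_weight w = P {w} (layer (level w))"

definition layered :: "nat \<Rightarrow> 'a \<Rightarrow> real" where
  "layered n w = level_weight w * inverse (real (Suc (Suc n))) ^ level w"

lemma layer_0: "layer 0 = Om"
  unfolding layer_def by simp

lemma layer_Suc: "layer (Suc i) = layer i - {w\<in>layer i. P {w} (layer i) > 0}"
  unfolding layer_def by simp

lemma layer_antimono: "i \<le> j \<Longrightarrow> layer j \<subseteq> layer i"
  by (induction j rule: dec_induct) (auto simp: layer_Suc)

lemma layer_subset: "layer i \<subseteq> Om"
  using layer_antimono[of 0 i] layer_0 by auto

lemma layer_has_positive_atom:
  assumes "layer i \<noteq> {}"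
  shows "\<exists>w\<in>layer i. P {w} (layer i) > 0"
proof (rule ccontr)
  assume "\<not> (\<exists>w\<in>layer i. P {w} (layer i) > 0)"
  hence "(\<Sum>w\<in>layer i. P {w} (layer i)) \<le> 0" by (intro sum_nonpos) auto
  thus False using fcp_sum_one[OF fcp layer_subset assms fin] by simp
qed

lemma layer_card: "layer i = {} \<or> card (layer i) + i \<le> card Om"
proof (induction i)
  case 0 thus ?case using layer_0 by simp
next
  case (Suc i)
  show ?case
  proof (cases "layer (Suc i) = {}")
    case False
    hence ne: "layer i \<noteq> {}" using layer_antimono[of i "Suc i"] by auto
    then obtain w where "w \<in> layer i" "P {w} (layer i) > 0" using layer_has_positive_atom by auto
    hence "layer (Suc i) \<subset> layer i" unfolding layer_Suc by auto
    hence "card (layer (Suc i)) < card (layer i)"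
      using psubset_card_mono finite_subset[OF layer_subset fin] by auto
    thus ?thesis using Suc ne by auto
  qed simp
qed

lemma notin_layer_Suc_level: "w \<notin> layer (Suc (level w))"
  unfolding level_def
  by (rule LeastI[of _ "card Om"]) (use layer_card[of "Suc (card Om)"] in auto)

lemma mem_layer_iff:
  assumes w: "w \<in> Om"
  shows "w \<in> layer i \<longleftrightarrow> i \<le> level w"
proof
  assume "w \<in> layer i"
  thus "i \<le> level w"
    using layer_antimono[of "Suc (level w)" i] notin_layer_Suc_level[of w] by (meson not_less_eq_eq subsetD)
next
  assume i: "i \<le> level w"
  show "w \<in> layer i"
  proof (cases i)
    case 0 thus ?thesis using w layer_0 by simp
  next
    case (Suc j)
    hence "j < level w" using i by auto
    thus ?thesis using not_less_Least[of j "\<lambda>i. w \<notin> layer (Suc i)"] Suc unfolding level_def by auto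
  qed
qed

lemma level_weight_pos: "w \<in> Om \<Longrightarrow> level_weight w > 0"
  using mem_layer_iff[of w "level w"] notin_layer_Suc_level[of w]
  unfolding level_weight_def layer_Suc by auto

lemma prob_deeper_layer_zero:
  assumes w: "w \<in> layer (Suc j)"
  shows "P {w} (layer j) = 0"
proof -
  have wj: "w \<in> layer j" using w layer_antimono[of j "Suc j"] by auto
  have "\<not> P {w} (layer j) > 0" using w unfolding layer_Suc by auto
  moreover have "P {w} (layer j) \<ge> 0"
    by (rule fcp_measure(1)[OF fcp layer_subset]) (use wj layer_subset in auto)
  ultimately show ?thesis by auto
qed

lemma layered_pos: "w \<in> Om \<Longrightarrow> layered n w > 0"
  unfolding layered_def using level_weight_pos by auto

lemma fcp_eq_lowest_layer:
  assumes A: "A \<subseteq> Om" and B: "B \<subseteq> Om" "B \<noteq> {}"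
  defines "j \<equiv> Min (level ` B)"
  defines "g \<equiv> \<lambda>w. if level w = j then level_weight w else 0"
  shows "(\<Sum>w\<in>B. g w) > 0" and "P A B = (\<Sum>w\<in>A \<inter> B. g w) / (\<Sum>w\<in>B. g w)"
proof -
  have finB: "finite B" using B fin finite_subset by auto
  have jle: "w \<in> B \<Longrightarrow> j \<le> level w" for w unfolding j_def using finB by auto
  have "j \<in> level ` B" unfolding j_def by (rule Min_in) (use finB B in auto)
  then obtain w0 where w0: "w0 \<in> B" "level w0 = j" by auto
  have BBj: "B \<subseteq> layer j" using mem_layer_iff jle B by auto
  have Bjne: "layer j \<noteq> {}" using BBj B by auto
  have Pj: "P {w} (layer j) = g w" if "w \<in> B" for w
  proof (cases "level w = j")
    case True thus ?thesis unfolding g_def level_weight_def by simp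
  next
    case False
    hence "Suc j \<le> level w" using jle[OF that] by auto
    hence "w \<in> layer (Suc j)" using mem_layer_iff that B by auto
    thus ?thesis using prob_deeper_layer_zero False unfolding g_def by auto
  qed
  have Pw: "P {w} (layer j) = P {w} B * P B (layer j)" if "w \<in> B" for w
  proof -
    have "P ({w} \<inter> B) (layer j) = P {w} (B \<inter> layer j) * P B (layer j)"
      by (rule fcp_chain[OF fcp]) (use that B layer_subset Bjne BBj in auto)
    moreover have "{w} \<inter> B = {w}" "B \<inter> layer j = B" using that BBj by auto
    ultimately show ?thesis by simp
  qed
  have PBj: "P B (layer j) = (\<Sum>w\<in>B. g w)"
    using fcp_sum[OF fcp layer_subset Bjne finB B(1)] Pj by simp
  have "g w0 > 0" using w0 level_weight_pos B unfolding g_def by auto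
  moreover have "\<forall>w\<in>B. g w \<ge> 0" using level_weight_pos B unfolding g_def by (auto simp: less_imp_le subset_iff)
  ultimately show W_pos: "(\<Sum>w\<in>B. g w) > 0" using finB w0 by (metis sum_pos2)
  have "P A B = P (A \<inter> B) B" by (rule fcp_inter[OF fcp A B])
  also have "\<dots> = (\<Sum>w\<in>A \<inter> B. P {w} B)" by (rule fcp_sum[OF fcp B]) (use finB A in auto)
  also have "\<dots> = (\<Sum>w\<in>A \<inter> B. g w / (\<Sum>w\<in>B. g w))"
    by (rule sum.cong[OF refl]) (use Pw Pj PBj W_pos in \<open>auto simp: field_simps\<close>)
  finally show "P A B = (\<Sum>w\<in>A \<inter> B. g w) / (\<Sum>w\<in>B. g w)" by (simp add: sum_divide_distrib)
qed

lemma cond_ratio_layered_tendsto: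
  assumes A: "A \<subseteq> Om" and B: "B \<subseteq> Om" "B \<noteq> {}"
  shows "(\<lambda>n. cond_ratio (layered n) A B) \<longlonglongrightarrow> P A B"
proof -
  define j where "j = Min (level ` B)"
  define g where "g w = (if level w = j then level_weight w else 0)" for w
  define e where "e n = inverse (real (Suc (Suc n)))" for n
  have e_pos: "e n > 0" for n unfolding e_def by auto
  have e_lim: "e \<longlonglongrightarrow> 0"
    unfolding e_def using LIMSEQ_Suc[OF LIMSEQ_inverse_real_of_nat] by simp
  have finB: "finite B" using B fin finite_subset by auto
  have jle: "w \<in> B \<Longrightarrow> j \<le> level w" for w unfolding j_def using finB by auto
  define h where "h n w = level_weight w * e n ^ (level w - j)" for n w
  have layered_h: "layered n w = e n ^ j * h n w" if "w \<in> B" for n w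
  proof -
    have "level w = j + (level w - j)" using jle[OF that] by auto
    hence "e n ^ level w = e n ^ j * e n ^ (level w - j)" by (metis power_add)
    thus ?thesis unfolding layered_def h_def e_def by simp
  qed
  have ratio: "cond_ratio (layered n) A B = (\<Sum>w\<in>A \<inter> B. h n w) / (\<Sum>w\<in>B. h n w)" for n
  proof -
    have "sum (layered n) (A \<inter> B) = e n ^ j * (\<Sum>w\<in>A \<inter> B. h n w)"
      by (simp add: sum_distrib_left layered_h)
    moreover have "sum (layered n) B = e n ^ j * (\<Sum>w\<in>B. h n w)"
      by (simp add: sum_distrib_left layered_h)
    ultimately show ?thesis unfolding cond_ratio_def using e_pos[of n] by simp
  qed
  have h_lim: "(\<lambda>n. h n w) \<longlonglongrightarrow> g w" if "w \<in> B" for w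
  proof -
    have "(\<lambda>n. level_weight w * e n ^ (level w - j)) \<longlonglongrightarrow> level_weight w * 0 ^ (level w - j)"
      by (intro tendsto_intros e_lim)
    moreover have "level_weight w * 0 ^ (level w - j) = g w" using jle[OF that] unfolding g_def by auto
    ultimately show ?thesis unfolding h_def by simp
  qed
  note lowest = fcp_eq_lowest_layer[OF A B, folded j_def, folded g_def]
  have "(\<lambda>n. (\<Sum>w\<in>A \<inter> B. h n w) / (\<Sum>w\<in>B. h n w)) \<longlonglongrightarrow> (\<Sum>w\<in>A \<inter> B. g w) / (\<Sum>w\<in>B. g w)"
    by (intro tendsto_divide tendsto_sum) (use h_lim lowest(1) in auto)
  thus ?thesis unfolding ratio lowest(2) .
qed

end

lemma fcp_positive_approx:
  fixes P :: "'a set \<Rightarrow> 'a set \<Rightarrow> real"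
  assumes fin: "finite Om" and ne: "Om \<noteq> {}" and fcp: "full_cond_prob Om P"
  shows "\<exists>p. (\<forall>n. \<forall>z\<in>Om. p n z > 0) \<and> (\<forall>n. sum (p n) Om = 1) \<and>
     (\<forall>A B. A \<subseteq> Om \<longrightarrow> B \<subseteq> Om \<longrightarrow> B \<noteq> {} \<longrightarrow> (\<lambda>n. cond_ratio (p n) A B) \<longlonglongrightarrow> P A B)"
proof -
  interpret fcp_layers Om P by (rule fcp_layers.intro[OF fin fcp])
  define p where "p n w = layered n w / sum (layered n) Om" for n w
  have total_pos: "sum (layered n) Om > 0" for n using sum_pos[OF fin ne] layered_pos by auto
  have "\<forall>n. \<forall>z\<in>Om. p n z > 0" unfolding p_def using layered_pos total_pos by auto
  moreover have "sum (p n) Om = 1" for n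
    unfolding p_def using total_pos[of n] by (simp add: sum_divide_distrib[symmetric])
  moreover have "cond_ratio (p n) A B = cond_ratio (layered n) A B" for n A B
    unfolding cond_ratio_def p_def using total_pos[of n] by (simp add: sum_divide_distrib[symmetric])
  ultimately show ?thesis using cond_ratio_layered_tendsto by (intro exI[of _ p]) auto
qed

section \<open>Perturbed local models\<close>

definition cyl_mass :: "('n \<Rightarrow> 'v set) \<Rightarrow> 'n set \<Rightarrow> (('n \<Rightarrow> 'v) \<Rightarrow> real) \<Rightarrow> 'n set \<Rightarrow> ('n \<Rightarrow> 'v) \<Rightarrow> real" where
  "cyl_mass X T h C z = (\<Sum>u\<in>PiE T X. if \<forall>t\<in>C. u t = z t then h u else 0)"

context credal_part
begin

lemma fibre_restrict_bij:
  assumes T: "T \<subseteq> G" and y: "y \<in> PiE G X"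
  shows "bij_betw (\<lambda>y'. restrict y' T) (fibre G X T y) (PiE T X)"
proof (rule bij_betwI')
  fix a b assume a: "a \<in> fibre G X T y" and b: "b \<in> fibre G X T y"
  show "(restrict a T = restrict b T) = (a = b)"
  proof
    assume e: "restrict a T = restrict b T"
    show "a = b"
    proof
      fix t show "a t = b t"
      proof (cases "t \<in> T")
        case True thus ?thesis using e by (metis restrict_apply')
      next
        case False
        show ?thesis
        proof (cases "t \<in> G")
          case True thus ?thesis using a b False unfolding fibre_def by auto
        next
          case False thus ?thesis using a b unfolding fibre_def by (auto simp: PiE_def extensional_def)
        qed
      qed
    qed
  qed simp
next
  fix a assume "a \<in> fibre G X T y"
  thus "restrict a T \<in> PiE T X" using T unfolding fibre_def by (auto simp: PiE_def Pi_def)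
next
  fix u assume u: "u \<in> PiE T X"
  define a where "a = (\<lambda>t. if t \<in> T then u t else y t)"
  have "a \<in> PiE G X" using u y T unfolding a_def by (auto simp: PiE_def Pi_def extensional_def)
  hence "a \<in> fibre G X T y" unfolding fibre_def a_def by auto
  moreover have "u = restrict a T" using u unfolding a_def by (auto simp: PiE_def extensional_def fun_eq_iff)
  ultimately show "\<exists>a\<in>fibre G X T y. u = restrict a T" by blast
qed

lemma sum_fibre_restrict:
  assumes "T \<subseteq> G" "y \<in> PiE G X"
  shows "(\<Sum>y'\<in>fibre G X T y. F (restrict y' T)) = (\<Sum>u\<in>PiE T X. F u)"
  by (rule sum.reindex_bij_betw[OF fibre_restrict_bij[OF assms]])

lemma cyl_mass_eq_sum: "T \<subseteq> G \<Longrightarrow> cyl_mass X T h C z = sum h (cylinder T X C z)"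
  unfolding cyl_mass_def cylinder_def by (rule sum.inter_filter[symmetric]) (rule finite_configs_on)

lemma sum_fibre_agree_indicator:
  assumes T: "T \<subseteq> G" and V: "V \<subseteq> C" "V \<subseteq> T" and y: "y \<in> PiE G X" and u: "u \<in> PiE T X"
  shows "(\<Sum>y1\<in>fibre G X V y. if \<forall>t\<in>C. u t = y1 t then (1::real) else 0) = (if \<forall>t\<in>C - V. u t = y t then 1 else 0)"
proof -
  have agree: "y1 t = y t" if "y1 \<in> fibre G X V y" "t \<notin> V" for y1 t
  proof (cases "t \<in> G")
    case True thus ?thesis using that unfolding fibre_def by auto
  next
    case False thus ?thesis using that y unfolding fibre_def by (auto simp: PiE_def extensional_def)
  qed
  have finF: "finite (fibre G X V y)" using finite_fibre finite_G finite_X by blast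
  have eq: "(\<Sum>y1\<in>fibre G X V y. if \<forall>t\<in>C. u t = y1 t then (1::real) else 0) = real (card {y1\<in>fibre G X V y. \<forall>t\<in>C. u t = y1 t})"
    using sum.inter_filter[OF finF, of "\<lambda>_. (1::real)" "\<lambda>y1. \<forall>t\<in>C. u t = y1 t"] by simp
  show ?thesis
  proof (cases "\<forall>t\<in>C - V. u t = y t")
    case True
    define ys where "ys = (\<lambda>t. if t \<in> V then u t else y t)"
    have ysF: "ys \<in> fibre G X V y"
    proof -
      have "ys \<in> PiE G X" using u y V T unfolding ys_def by (auto simp: PiE_def Pi_def extensional_def)
      thus ?thesis unfolding fibre_def ys_def by auto
    qed
    have "{y1\<in>fibre G X V y. \<forall>t\<in>C. u t = y1 t} = {ys}"
    proof
      show "{ys} \<subseteq> {y1\<in>fibre G X V y. \<forall>t\<in>C. u t = y1 t}" using ysF True unfolding ys_def by auto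
      show "{y1\<in>fibre G X V y. \<forall>t\<in>C. u t = y1 t} \<subseteq> {ys}"
      proof
        fix y1 assume y1: "y1 \<in> {y1\<in>fibre G X V y. \<forall>t\<in>C. u t = y1 t}"
        have "y1 = ys"
        proof
          fix t show "y1 t = ys t"
            using y1 agree[of y1 t] V unfolding ys_def by auto
        qed
        thus "y1 \<in> {ys}" by simp
      qed
    qed
    thus ?thesis using eq True by simp
  next
    case False
    then obtain t where t: "t \<in> C - V" "u t \<noteq> y t" by auto
    have e0: "{y1\<in>fibre G X V y. \<forall>t\<in>C. u t = y1 t} = {}"
      using agree t by force
    have "card {y1\<in>fibre G X V y. \<forall>t\<in>C. u t = y1 t} = 0" unfolding e0 by simp
    thus ?thesis using eq False by simp
  qed
qed

lemma sum_fibre_cyl_mass: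
  assumes T: "T \<subseteq> G" and V: "V \<subseteq> C" "V \<subseteq> T" and y: "y \<in> PiE G X"
  shows "(\<Sum>y1\<in>fibre G X V y. cyl_mass X T h C y1) = cyl_mass X T h (C - V) y"
proof -
  have "(\<Sum>y1\<in>fibre G X V y. cyl_mass X T h C y1) = (\<Sum>y1\<in>fibre G X V y. \<Sum>u\<in>PiE T X. h u * (if \<forall>t\<in>C. u t = y1 t then 1 else 0))"
    unfolding cyl_mass_def by (intro sum.cong refl) auto
  also have "\<dots> = (\<Sum>u\<in>PiE T X. \<Sum>y1\<in>fibre G X V y. h u * (if \<forall>t\<in>C. u t = y1 t then 1 else 0))"
    by (rule sum.swap)
  also have "\<dots> = (\<Sum>u\<in>PiE T X. h u * (if \<forall>t\<in>C - V. u t = y t then 1 else 0))"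
    by (intro sum.cong refl) (simp add: sum_distrib_left[symmetric] sum_fibre_agree_indicator[OF T V y])
  also have "\<dots> = cyl_mass X T h (C - V) y" unfolding cyl_mass_def by (intro sum.cong refl) auto
  finally show ?thesis .
qed

lemma cyl_mass_full:
  assumes T: "T \<subseteq> G" and z: "z \<in> PiE G X"
  shows "cyl_mass X T h T z = h (restrict z T)"
proof -
  have "cylinder T X T z = {restrict z T}"
    using z T unfolding cylinder_def by (auto simp: PiE_def Pi_def extensional_def fun_eq_iff)
  thus ?thesis using cyl_mass_eq_sum[OF T] by simp
qed

lemma cyl_mass_empty: "T \<subseteq> G \<Longrightarrow> cyl_mass X T h {} z = sum h (PiE T X)"
  unfolding cyl_mass_def by simp

lemma cyl_mass_cong:
  assumes "\<forall>t\<in>C. z t = z' t"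
  shows "cyl_mass X T h C z = cyl_mass X T h C z'"
  unfolding cyl_mass_def using assms by simp

lemma node_fibres:
  assumes s: "s \<in> G" and z0: "z0 \<in> PiE G X"
  shows "{z\<in>PiE G X. z s = z0 s} \<inter> cylinder G X (nondesc G par s) z0 = fibre G X (desc G par s) z0"
    and "cylinder G X (nondesc G par s) z0 = fibre G X ({s} \<union> desc G par s) z0"
proof -
  have G1: "G - desc G par s = {s} \<union> nondesc G par s" using node_partition[OF s] desc_nondesc_disjoint notin_desc_self nondesc_iff by auto
  have G2: "G - ({s} \<union> desc G par s) = nondesc G par s" using node_partition[OF s] desc_nondesc_disjoint notin_desc_self nondesc_iff by auto
  show "{z\<in>PiE G X. z s = z0 s} \<inter> cylinder G X (nondesc G par s) z0 = fibre G X (desc G par s) z0"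
    unfolding fibre_def cylinder_def G1 by auto
  show "cylinder G X (nondesc G par s) z0 = fibre G X ({s} \<union> desc G par s) z0"
    unfolding fibre_def cylinder_def G2 by auto
qed

lemma node_cond_ratio:
  fixes p :: "('a \<Rightarrow> 'v) \<Rightarrow> real"
  assumes s: "s \<in> G" and z0: "z0 \<in> PiE G X"
    and num: "\<forall>v\<in>X s. sum p (fibre G X (desc G par s) (z0(s:=v))) = Fac * \<gamma> v" and Fac: "Fac \<noteq> 0"
  shows "cond_ratio p {z\<in>PiE G X. z s = z0 s} (cylinder G X (nondesc G par s) z0) = \<gamma> (z0 s) / (\<Sum>v\<in>X s. \<gamma> v)"
proof -
  have z0s: "z0 s \<in> X s" using z0 s by auto
  have up: "z0(s := z0 s) = z0" by simp
  have "sum p (cylinder G X (nondesc G par s) z0) = (\<Sum>v\<in>X s. sum p (fibre G X (desc G par s) (z0(s:=v))))"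
  proof -
    have "sum p (cylinder G X (nondesc G par s) z0) = (\<Sum>y1\<in>fibre G X {s} z0. sum p (fibre G X (desc G par s) y1))"
      unfolding node_fibres(2)[OF s z0] by (rule sum_fibre_Un[OF finite_G finite_X _ z0]) (use notin_desc_self in auto)
    also have "\<dots> = (\<Sum>v\<in>X s. sum p (fibre G X (desc G par s) (z0(s:=v))))"
      by (rule sum_fibre_singleton[OF s z0])
    finally show ?thesis .
  qed
  also have "\<dots> = Fac * (\<Sum>v\<in>X s. \<gamma> v)" using num by (simp add: sum_distrib_left)
  finally have den: "sum p (cylinder G X (nondesc G par s) z0) = Fac * (\<Sum>v\<in>X s. \<gamma> v)" .
  have "sum p ({z\<in>PiE G X. z s = z0 s} \<inter> cylinder G X (nondesc G par s) z0) = Fac * \<gamma> (z0 s)"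
    using num z0s up unfolding node_fibres(1)[OF s z0] by metis
  thus ?thesis unfolding cond_ratio_def den using Fac by simp
qed


definition chosen :: "'a \<Rightarrow> ('a \<Rightarrow> 'v) \<Rightarrow> 'v \<Rightarrow> real" where
  "chosen t y = (SOME p. p \<in> M t y)"

definition eps :: "nat \<Rightarrow> real" where
  "eps n = inverse (real (Suc (Suc n)))"

definition kern :: "nat \<Rightarrow> 'a \<Rightarrow> ('a \<Rightarrow> 'v) \<Rightarrow> real" where
  "kern n t z = (1 - eps n) * chosen t (restrict z (par t)) (z t) + eps n / real (card (X t))"

lemma eps_bounds: "0 < eps n" "eps n < 1" unfolding eps_def by (auto simp: field_simps)

lemma eps_tendsto_0: "eps \<longlonglongrightarrow> 0"
  unfolding eps_def using LIMSEQ_Suc[OF LIMSEQ_inverse_real_of_nat] by simp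

lemma restrict_par_in_PiE: "t \<in> G \<Longrightarrow> z \<in> PiE G X \<Longrightarrow> restrict z (par t) \<in> PiE (par t) X"
  using par_subset by (auto simp: PiE_def Pi_def)

lemma chosen_in:
  assumes "t \<in> G" "y \<in> PiE (par t) X"
  shows "chosen t y \<in> M t y" "is_pmf_on (X t) (chosen t y)"
proof -
  have "M t y \<noteq> {}" using local_model_props[OF assms] by auto
  thus "chosen t y \<in> M t y" unfolding chosen_def by (simp add: some_in_eq)
  thus "is_pmf_on (X t) (chosen t y)" using local_model_props[OF assms] by auto
qed

lemma kern_pos:
  assumes t: "t \<in> G" and z: "z \<in> PiE G X"
  shows "kern n t z > 0"
proof -
  have pmf: "is_pmf_on (X t) (chosen t (restrict z (par t)))" using chosen_in(2)[OF t restrict_par_in_PiE[OF t z]] .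
  have "z t \<in> X t" using z t by auto
  hence "chosen t (restrict z (par t)) (z t) \<ge> 0" using pmf unfolding is_pmf_on_def by auto
  moreover have "card (X t) > 0" using finite_X X_nonempty t by (simp add: card_gt_0_iff)
  ultimately show ?thesis unfolding kern_def using eps_bounds[of n] by (simp add: add_nonneg_pos)
qed

lemma kern_cong:
  assumes "z t = z' t" "\<forall>u\<in>par t. z u = z' u"
  shows "kern n t z = kern n t z'"
proof -
  have "restrict z (par t) = restrict z' (par t)" using assms by (intro restrict_ext) auto
  thus ?thesis unfolding kern_def using assms by simp
qed

lemma notin_par_self: "t \<in> G \<Longrightarrow> t \<notin> par t"
proof
  assume "t \<in> G" "t \<in> par t"
  hence "t \<in> nondesc G par t" using par_subset_nondesc by auto
  thus False unfolding nondesc_iff by auto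
qed

lemma kern_sum_one:
  assumes t: "t \<in> G" and z: "z \<in> PiE G X"
  shows "(\<Sum>v\<in>X t. kern n t (z(t:=v))) = 1"
proof -
  define y where "y = restrict z (par t)"
  have ry: "restrict (z(t:=v)) (par t) = y" for v
    unfolding y_def using notin_par_self[OF t] by (intro restrict_ext) auto
  have pmf: "is_pmf_on (X t) (chosen t y)" unfolding y_def using chosen_in(2)[OF t restrict_par_in_PiE[OF t z]] .
  have c0: "card (X t) > 0" using finite_X X_nonempty t by (simp add: card_gt_0_iff)
  hence c0': "real (card (X t)) \<noteq> 0" by simp
  have "(\<Sum>v\<in>X t. kern n t (z(t:=v))) = (\<Sum>v\<in>X t. (1 - eps n) * chosen t y v + eps n / real (card (X t)))"
    unfolding kern_def ry by simp
  also have "\<dots> = (1 - eps n) * (\<Sum>v\<in>X t. chosen t y v) + eps n"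
    using c0' by (simp add: sum.distrib sum_distrib_left)
  also have "\<dots> = 1" using pmf unfolding is_pmf_on_def by simp
  finally show ?thesis .
qed

lemma kern_tendsto: "(\<lambda>n. kern n t z) \<longlonglongrightarrow> chosen t (restrict z (par t)) (z t)"
proof -
  have A: "(\<lambda>n. (1 - eps n) * chosen t (restrict z (par t)) (z t)) \<longlonglongrightarrow> (1 - 0) * chosen t (restrict z (par t)) (z t)"
    by (intro tendsto_intros eps_tendsto_0)
  have B: "(\<lambda>n. eps n / real (card (X t))) \<longlonglongrightarrow> 0" by (rule tendsto_divide_zero[OF eps_tendsto_0])
  show ?thesis unfolding kern_def using tendsto_add[OF A B] by simp
qed

lemma sum_fibre_prod_kern:
  assumes W: "W \<subseteq> G" and z: "z \<in> PiE G X"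
  shows "(\<Sum>y\<in>fibre G X W z. \<Prod>w\<in>W. kern n w y) = 1"
proof (rule sum_fibre_prod_kernels[OF finite_G finite_X dag_sink_exists[OF dag W] W _ _ z])
  show "\<forall>w\<in>W. \<forall>y\<in>PiE G X. \<forall>y'\<in>PiE G X. y w = y' w \<and> (\<forall>t\<in>par w. y t = y' t) \<longrightarrow> kern n w y = kern n w y'"
    using kern_cong by blast
  show "\<forall>w\<in>W. \<forall>y\<in>PiE G X. (\<Sum>v\<in>X w. kern n w (y(w:=v))) = 1"
    using kern_sum_one W by blast
qed

lemma fibre_agree:
  assumes "y \<in> fibre G X W z" "z \<in> PiE G X" "t \<notin> W"
  shows "y t = z t"
proof (cases "t \<in> G")
  case True thus ?thesis using assms unfolding fibre_def by auto
next
  case False thus ?thesis using assms unfolding fibre_def by (auto simp: PiE_def extensional_def)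
qed

lemma prod_kern_fibre_const:
  assumes "\<forall>u\<in>U. u \<notin> W \<and> par u \<inter> W = {}" "y \<in> fibre G X W z" "z \<in> PiE G X"
  shows "(\<Prod>u\<in>U. kern n u y) = (\<Prod>u\<in>U. kern n u z)"
proof (rule prod.cong[OF refl])
  fix u assume u: "u \<in> U"
  show "kern n u y = kern n u z"
    by (rule kern_cong) (use assms u fibre_agree in blast)+
qed

lemma fun_upd_fibre: "z \<in> PiE G X \<Longrightarrow> s \<in> G \<Longrightarrow> v \<in> X s \<Longrightarrow> y \<in> fibre G X W (z(s:=v)) \<Longrightarrow> s \<notin> W \<Longrightarrow> y \<in> fibre G X (insert s W) z"
  unfolding fibre_def by auto

definition node_witness :: "'a \<Rightarrow> ('a \<Rightarrow> 'v) \<Rightarrow> 'v \<Rightarrow> ('a \<Rightarrow> 'v)" where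
  "node_witness s xN v = (default_ext G X (nondesc G par s) xN)(s := v)"

lemma node_witness:
  assumes s: "s \<in> G" and xN: "xN \<in> PiE (nondesc G par s) X" and v: "v \<in> X s"
  shows "node_witness s xN v \<in> PiE G X" "node_witness s xN v s = v"
    "{z\<in>PiE G X. restrict z (nondesc G par s) = xN} = cylinder G X (nondesc G par s) (node_witness s xN v)"
    "{z\<in>PiE G X. z s = v} = {z\<in>PiE G X. z s = node_witness s xN v s}"
    "restrict (node_witness s xN v) (par s) = restrict xN (par s)"
proof -
  have e: "default_ext G X (nondesc G par s) xN \<in> PiE G X" "\<forall>t\<in>nondesc G par s \<inter> G. default_ext G X (nondesc G par s) xN t = xN t"
    using default_ext_in[OF X_nonempty, of "nondesc G par s" xN] xN by auto
  show "node_witness s xN v \<in> PiE G X" unfolding node_witness_def by (rule fun_upd_in_PiE[OF e(1) s v])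
  show "node_witness s xN v s = v" unfolding node_witness_def by simp
  have ag: "\<forall>t\<in>nondesc G par s. node_witness s xN v t = xN t"
  proof
    fix t assume t: "t \<in> nondesc G par s"
    hence "t \<noteq> s" "t \<in> G" unfolding nondesc_iff by auto
    thus "node_witness s xN v t = xN t" using e(2) t unfolding node_witness_def by auto
  qed
  show "{z\<in>PiE G X. restrict z (nondesc G par s) = xN} = cylinder G X (nondesc G par s) (node_witness s xN v)"
    using restrict_eq_cylinder[OF xN, of G] ag unfolding cylinder_def by auto
  show "{z\<in>PiE G X. z s = v} = {z\<in>PiE G X. z s = node_witness s xN v s}" unfolding node_witness_def by simp
  show "restrict (node_witness s xN v) (par s) = restrict xN (par s)"
    using ag par_subset_nondesc[OF s] by (intro restrict_ext) auto
qed

lemma cond_ratio_prod_kern: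
  assumes s: "s \<in> G" and z0: "z0 \<in> PiE G X"
  shows "cond_ratio (\<lambda>z. \<Prod>t\<in>G. kern n t z) {z\<in>PiE G X. z s = z0 s} (cylinder G X (nondesc G par s) z0)
       = kern n s z0"
proof -
  define Fac where "Fac = (\<Prod>t\<in>nondesc G par s. kern n t z0)"
  have num: "\<forall>v'\<in>X s. sum (\<lambda>z. \<Prod>t\<in>G. kern n t z) (fibre G X (desc G par s) (z0(s:=v'))) = Fac * kern n s (z0(s:=v'))"
  proof
    fix v' assume v': "v' \<in> X s"
    define z1 where "z1 = z0(s:=v')"
    have z1P: "z1 \<in> PiE G X" unfolding z1_def by (rule fun_upd_in_PiE[OF z0 s v'])
    have split: "(\<Prod>t\<in>G. kern n t y) = (\<Prod>t\<in>nondesc G par s. kern n t y) * kern n s y * (\<Prod>t\<in>desc G par s. kern n t y)" for y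
    proof -
      have "G = nondesc G par s \<union> ({s} \<union> desc G par s)" using node_partition[OF s] by auto
      moreover have "nondesc G par s \<inter> ({s} \<union> desc G par s) = {}" using desc_nondesc_disjoint nondesc_iff by auto
      moreover have "finite (nondesc G par s)" "finite ({s} \<union> desc G par s)"
        using finite_subset[OF nondesc_subset finite_G] finite_subset[OF desc_subset finite_G] by auto
      ultimately have "(\<Prod>t\<in>G. kern n t y) = (\<Prod>t\<in>nondesc G par s. kern n t y) * (\<Prod>t\<in>{s} \<union> desc G par s. kern n t y)"
        by (metis prod.union_disjoint)
      moreover have "(\<Prod>t\<in>{s} \<union> desc G par s. kern n t y) = kern n s y * (\<Prod>t\<in>desc G par s. kern n t y)"
        using prod.insert[OF finite_subset[OF desc_subset finite_G] notin_desc_self] by simp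
      ultimately show ?thesis by simp
    qed
    have "sum (\<lambda>z. \<Prod>t\<in>G. kern n t z) (fibre G X (desc G par s) z1) = (\<Sum>y\<in>fibre G X (desc G par s) z1. Fac * kern n s z1 * (\<Prod>t\<in>desc G par s. kern n t y))"
    proof (rule sum.cong[OF refl])
      fix y assume y: "y \<in> fibre G X (desc G par s) z1"
      have y0: "y \<in> fibre G X (insert s (desc G par s)) z0" using fun_upd_fibre[OF z0 s v'] y notin_desc_self unfolding z1_def by auto
      have "(\<Prod>t\<in>nondesc G par s. kern n t y) = Fac"
        unfolding Fac_def
      proof (rule prod_kern_fibre_const[OF _ y0 z0])
        show "\<forall>u\<in>nondesc G par s. u \<notin> insert s (desc G par s) \<and> par u \<inter> insert s (desc G par s) = {}"
          using par_nondesc_subset_nondesc[OF s] nondesc_iff desc_nondesc_disjoint by blast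
      qed
      moreover have "kern n s y = kern n s z1"
        by (rule kern_cong) (use fibre_agree[OF y z1P] notin_desc_self par_subset_nondesc[OF s] desc_nondesc_disjoint in blast)+
      ultimately show "(\<Prod>t\<in>G. kern n t y) = Fac * kern n s z1 * (\<Prod>t\<in>desc G par s. kern n t y)" using split by simp
    qed
    also have "\<dots> = Fac * kern n s z1" using sum_fibre_prod_kern[OF desc_subset z1P] by (simp add: sum_distrib_left[symmetric])
    finally show "sum (\<lambda>z. \<Prod>t\<in>G. kern n t z) (fibre G X (desc G par s) (z0(s:=v'))) = Fac * kern n s (z0(s:=v'))" unfolding z1_def .
  qed
  have Facpos: "Fac > 0" unfolding Fac_def by (rule prod_pos) (use kern_pos z0 nondesc_subset in blast)
  have "cond_ratio (\<lambda>z. \<Prod>t\<in>G. kern n t z) {z\<in>PiE G X. z s = z0 s} (cylinder G X (nondesc G par s) z0)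
      = kern n s (z0(s := z0 s)) / (\<Sum>v'\<in>X s. kern n s (z0(s:=v')))"
    by (rule node_cond_ratio[OF s z0 num]) (use Facpos in auto)
  thus ?thesis using kern_sum_one[OF s z0] by simp
qed

theorem irr_ext_nonempty: "irr_ext G par X M \<noteq> {}"
proof -
  define p where "p n z = (\<Prod>t\<in>G. kern n t z)" for n z
  have ppos: "\<forall>n. \<forall>z\<in>PiE G X. p n z > 0" unfolding p_def using kern_pos by (auto intro: prod_pos)
  obtain \<sigma> P where sP: "strict_mono \<sigma>" "full_cond_prob (PiE G X) P"
    "\<forall>A B. A \<subseteq> PiE G X \<longrightarrow> B \<subseteq> PiE G X \<longrightarrow> B \<noteq> {} \<longrightarrow> (\<lambda>n. cond_ratio (p (\<sigma> n)) A B) \<longlonglongrightarrow> P A B"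
    using fcp_cond_ratio_limit[OF finite_configs ppos] by blast
  have loc: "(\<lambda>v. if v \<in> X s then P {z\<in>PiE G X. z s = v} {z\<in>PiE G X. restrict z (nondesc G par s) = xN} else 0)
      \<in> M s (restrict xN (par s))" if s: "s \<in> G" and xN: "xN \<in> PiE (nondesc G par s) X" for s xN
  proof -
    have xpP: "restrict xN (par s) \<in> PiE (par s) X" using xN par_subset_nondesc[OF s] by (auto simp: PiE_def Pi_def)
    have "(\<lambda>v. if v \<in> X s then P {z\<in>PiE G X. z s = v} {z\<in>PiE G X. restrict z (nondesc G par s) = xN} else 0)
        = chosen s (restrict xN (par s))"
    proof
      fix v
      show "(if v \<in> X s then P {z\<in>PiE G X. z s = v} {z\<in>PiE G X. restrict z (nondesc G par s) = xN} else 0) = chosen s (restrict xN (par s)) v"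
      proof (cases "v \<in> X s")
        case False thus ?thesis using chosen_in(2)[OF s xpP] unfolding is_pmf_on_def by auto
      next
        case v: True
        define z0 where "z0 = node_witness s xN v"
        note zz = node_witness[OF s xN v, folded z0_def]
        have l1: "(\<lambda>n. cond_ratio (p (\<sigma> n)) {z\<in>PiE G X. z s = z0 s} (cylinder G X (nondesc G par s) z0))
            \<longlonglongrightarrow> P {z\<in>PiE G X. z s = z0 s} (cylinder G X (nondesc G par s) z0)"
        proof -
          have "cylinder G X (nondesc G par s) z0 \<noteq> {}"
            by (rule cylinder_nonempty[OF X_nonempty]) (use zz(1) nondesc_subset in \<open>auto simp: PiE_def Pi_def\<close>)
          moreover have "{z\<in>PiE G X. z s = z0 s} \<subseteq> PiE G X" by auto
          ultimately show ?thesis using sP(3) cylinder_subset[of G X "nondesc G par s" z0] by blast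
        qed
        have l2: "(\<lambda>n. cond_ratio (p (\<sigma> n)) {z\<in>PiE G X. z s = z0 s} (cylinder G X (nondesc G par s) z0))
            \<longlonglongrightarrow> chosen s (restrict z0 (par s)) (z0 s)"
          unfolding p_def[abs_def] cond_ratio_prod_kern[OF s zz(1)] using LIMSEQ_subseq_LIMSEQ[OF kern_tendsto sP(1)] by (simp add: comp_def)
        have F: "P {z\<in>PiE G X. z s = z0 s} (cylinder G X (nondesc G par s) z0) = chosen s (restrict z0 (par s)) (z0 s)"
          using LIMSEQ_unique[OF l1 l2] .
        have "P {z\<in>PiE G X. z s = v} {z\<in>PiE G X. restrict z (nondesc G par s) = xN} = chosen s (restrict xN (par s)) v"
          using F unfolding zz(2) zz(5) zz(3)[symmetric] .
        thus ?thesis using v by simp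
      qed
    qed
    thus ?thesis using chosen_in(1)[OF s xpP] by simp
  qed
  have "P \<in> irr_ext G par X M" unfolding irr_ext_def using sP(2) loc by blast
  thus ?thesis by auto
qed

end

section \<open>Composing a marginal and a conditional model\<close>

locale composition = credal_part +
  fixes xP Q R q r
  assumes xP: "xP \<in> PiE PK X"
    and Qirr: "Q \<in> irr_ext N (sub_pa par N) X (\<lambda>s z. M s (restrict z (par s)))"
    and Rirr: "R \<in> irr_ext K (sub_pa par K) X (sub_M par M K xP)"
    and qpos: "\<forall>n. \<forall>w\<in>PiE N X. q n w > 0" and qsum: "\<forall>n. sum (q n) (PiE N X) = 1"
    and qlim: "\<forall>A B. A \<subseteq> PiE N X \<longrightarrow> B \<subseteq> PiE N X \<longrightarrow> B \<noteq> {} \<longrightarrow> (\<lambda>n. cond_ratio (q n) A B) \<longlonglongrightarrow> Q A B"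
    and rpos: "\<forall>n. \<forall>w\<in>PiE K X. r n w > 0" and rsum: "\<forall>n. sum (r n) (PiE K X) = 1"
    and rlim: "\<forall>A B. A \<subseteq> PiE K X \<longrightarrow> B \<subseteq> PiE K X \<longrightarrow> B \<noteq> {} \<longrightarrow> (\<lambda>n. cond_ratio (r n) A B) \<longlonglongrightarrow> R A B"
begin

text \<open>The joint approximant draws the nodes of N from q, the nodes of K that no deviation from
  xP reaches (the shielded ones) from the r-marginal on them, and all other nodes of K and D from
  the perturbed local kernels.\<close>

definition deviating where "deviating z = {t \<in> PK. z t \<noteq> xP t}"
definition shielded where "shielded z = {k \<in> K. \<forall>t\<in>deviating z. \<not> reaches t k}"
definition rho where
  "rho n z = cyl_mass X K (r n) (shielded z) z * (\<Prod>k\<in>K - shielded z. kern n k z)"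
definition joint where
  "joint n z = q n (restrict z N) * rho n z * (\<Prod>d\<in>D. kern n d z)"

lemma shielded_subset: "shielded z \<subseteq> K" unfolding shielded_def by auto

lemma shielded_par: "k \<in> shielded z \<Longrightarrow> t \<in> par k \<Longrightarrow> t \<in> K \<Longrightarrow> t \<in> shielded z"
  unfolding shielded_def using reaches_trans reaches_edge K_subset by blast

lemma shielded_par_outside: "k \<in> shielded z \<Longrightarrow> t \<in> par k \<Longrightarrow> t \<notin> K \<Longrightarrow> z t = xP t"
proof (rule ccontr)
  assume a: "k \<in> shielded z" "t \<in> par k" "t \<notin> K" "z t \<noteq> xP t"
  have "t \<in> PK" using a unfolding PK_iff shielded_def by auto
  hence "t \<in> deviating z" using a unfolding deviating_def by auto
  moreover have "reaches t k" using reaches_edge a K_subset unfolding shielded_def by auto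
  ultimately show False using a unfolding shielded_def by auto
qed

lemma deviating_cong: "\<forall>t\<in>PK. z t = z' t \<Longrightarrow> deviating z = deviating z'" unfolding deviating_def by auto
lemma shielded_cong: "\<forall>t\<in>PK. z t = z' t \<Longrightarrow> shielded z = shielded z'"
proof -
  assume "\<forall>t\<in>PK. z t = z' t"
  hence "deviating z = deviating z'" by (rule deviating_cong)
  thus ?thesis unfolding shielded_def by simp
qed

lemma K_PK_disjoint: "K \<inter> PK = {}" unfolding parK_def by auto

lemma cyl_mass_pos:
  assumes z: "z \<in> PiE G X" and C: "C \<subseteq> K"
  shows "cyl_mass X K (r n) C z > 0"
proof -
  have "restrict z K \<in> cylinder K X C z" using z K_subset C unfolding cylinder_def by (auto simp: PiE_def Pi_def)
  moreover have "finite (cylinder K X C z)" using finite_cylinder[of K X] finite_G K_subset finite_X finite_subset by blast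
  moreover have "\<forall>u\<in>cylinder K X C z. r n u > 0" using rpos cylinder_subset by blast
  ultimately show ?thesis unfolding cyl_mass_eq_sum[OF K_subset] by (metis empty_iff sum_pos)
qed

lemma rho_pos: "z \<in> PiE G X \<Longrightarrow> rho n z > 0"
  unfolding rho_def using cyl_mass_pos shielded_subset kern_pos K_subset by (auto intro!: mult_pos_pos prod_pos)

lemma joint_pos: "z \<in> PiE G X \<Longrightarrow> joint n z > 0"
proof -
  assume z: "z \<in> PiE G X"
  have "restrict z N \<in> PiE N X" using z N_subset by (auto simp: PiE_def Pi_def)
  hence "q n (restrict z N) > 0" using qpos by auto
  moreover have "(\<Prod>d\<in>D. kern n d z) > 0" by (rule prod_pos) (use kern_pos z D_subset in blast)
  ultimately show ?thesis unfolding joint_def using rho_pos[OF z] by auto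
qed

lemma rho_cong:
  assumes "\<forall>t\<in>K \<union> PK. z t = z' t"
  shows "rho n z = rho n z'"
proof -
  have A: "shielded z = shielded z'" using shielded_cong assms by auto
  have "cyl_mass X K (r n) (shielded z) z = cyl_mass X K (r n) (shielded z) z'" by (rule cyl_mass_cong) (use assms shielded_subset in blast)
  moreover have "(\<Prod>k\<in>K - shielded z. kern n k z) = (\<Prod>k\<in>K - shielded z. kern n k z')"
  proof (rule prod.cong[OF refl])
    fix k assume "k \<in> K - shielded z"
    thus "kern n k z = kern n k z'" by (intro kern_cong) (use assms par_subset_K_PK in blast)+
  qed
  ultimately show ?thesis unfolding rho_def A by simp
qed

lemma sum_fibre_rho:
  assumes W: "W \<subseteq> K" and dc: "\<forall>u\<in>K. \<forall>t\<in>W. t \<in> par u \<longrightarrow> u \<in> W" and y: "y \<in> PiE G X"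
  shows "(\<Sum>y'\<in>fibre G X W y. rho n y') = cyl_mass X K (r n) (shielded y - W) y * (\<Prod>k\<in>K - shielded y - W. kern n k y)"
proof -
  define A where "A = shielded y"
  have AK: "A \<subseteq> K" unfolding A_def by (rule shielded_subset)
  have WG: "W \<subseteq> G" using W K_subset by auto
  have Aeq: "shielded y' = A" if "y' \<in> fibre G X W y" for y'
    unfolding A_def by (rule shielded_cong) (use fibre_agree[OF that y] W K_PK_disjoint in blast)
  have "(\<Sum>y'\<in>fibre G X W y. rho n y') = (\<Sum>y'\<in>fibre G X ((W \<inter> A) \<union> (W - A)) y. rho n y')"
    by (metis Int_Diff_Un)
  also have "\<dots> = (\<Sum>y1\<in>fibre G X (W \<inter> A) y. \<Sum>y'\<in>fibre G X (W - A) y1. rho n y')"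
    by (rule sum_fibre_Un[OF finite_G finite_X _ y]) auto
  also have "\<dots> = (\<Sum>y1\<in>fibre G X (W \<inter> A) y. cyl_mass X K (r n) A y1 * (\<Prod>k\<in>K - A - W. kern n k y))"
  proof (rule sum.cong[OF refl])
    fix y1 assume y1: "y1 \<in> fibre G X (W \<inter> A) y"
    have y1P: "y1 \<in> PiE G X" using y1 fibre_subset by blast
    have "(\<Sum>y'\<in>fibre G X (W - A) y1. rho n y') = (\<Sum>y'\<in>fibre G X (W - A) y1. cyl_mass X K (r n) A y1 * (\<Prod>k\<in>K - A - W. kern n k y) * (\<Prod>k\<in>W - A. kern n k y'))"
    proof (rule sum.cong[OF refl])
      fix y' assume y': "y' \<in> fibre G X (W - A) y1"
      have y'W: "y' \<in> fibre G X W y" using fibre_trans[OF y1 y'] fibre_mono by blast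
      have "cyl_mass X K (r n) (shielded y') y' = cyl_mass X K (r n) A y1"
        unfolding Aeq[OF y'W] by (rule cyl_mass_cong) (use fibre_agree[OF y' y1P] in blast)
      moreover have "(\<Prod>k\<in>K - shielded y'. kern n k y') = (\<Prod>k\<in>K - A - W. kern n k y') * (\<Prod>k\<in>W - A. kern n k y')"
      proof -
        have e: "K - A = (K - A - W) \<union> (W - A)" using W by auto
        have fK: "finite K" using finite_subset[OF K_subset finite_G] .
        have f1: "finite (K - A - W)" "finite (W - A)" using fK W by (auto intro: finite_subset)
        have "(\<Prod>k\<in>K - A. kern n k y') = (\<Prod>k\<in>(K - A - W) \<union> (W - A). kern n k y')" using e by simp
        also have "\<dots> = (\<Prod>k\<in>K - A - W. kern n k y') * (\<Prod>k\<in>W - A. kern n k y')"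
          by (rule prod.union_disjoint[OF f1]) auto
        finally show ?thesis unfolding Aeq[OF y'W] .
      qed
      moreover have "(\<Prod>k\<in>K - A - W. kern n k y') = (\<Prod>k\<in>K - A - W. kern n k y)"
        by (rule prod_kern_fibre_const[OF _ y'W y]) (use dc in blast)
      ultimately show "rho n y' = cyl_mass X K (r n) A y1 * (\<Prod>k\<in>K - A - W. kern n k y) * (\<Prod>k\<in>W - A. kern n k y')"
        unfolding rho_def by simp
    qed
    also have "\<dots> = cyl_mass X K (r n) A y1 * (\<Prod>k\<in>K - A - W. kern n k y)"
    proof -
      have g: "(\<Sum>y'\<in>fibre G X (W - A) y1. \<Prod>k\<in>W - A. kern n k y') = 1" using sum_fibre_prod_kern[of "W - A" y1 n] WG y1P by auto
      show ?thesis by (simp add: sum_distrib_left[symmetric] g)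
    qed
    finally show "(\<Sum>y'\<in>fibre G X (W - A) y1. rho n y') = cyl_mass X K (r n) A y1 * (\<Prod>k\<in>K - A - W. kern n k y)" .
  qed
  also have "\<dots> = (\<Sum>y1\<in>fibre G X (W \<inter> A) y. cyl_mass X K (r n) A y1) * (\<Prod>k\<in>K - A - W. kern n k y)"
    by (simp add: sum_distrib_right)
  also have "(\<Sum>y1\<in>fibre G X (W \<inter> A) y. cyl_mass X K (r n) A y1) = cyl_mass X K (r n) (A - (W \<inter> A)) y"
    by (rule sum_fibre_cyl_mass[OF K_subset _ _ y]) (use AK in auto)
  also have "A - (W \<inter> A) = A - W" by auto
  finally show ?thesis unfolding A_def .
qed


lemma sum_configs_split:
  assumes zs: "zs \<in> PiE G X"
  shows "(\<Sum>z\<in>PiE G X. F z) = (\<Sum>y1\<in>fibre G X N zs. \<Sum>y2\<in>fibre G X K y1. \<Sum>y3\<in>fibre G X D y2. F y3)"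
proof -
  have "PiE G X = fibre G X (N \<union> (K \<union> D)) zs" using fibre_all[of G X zs] G_eq_K_D_N by (metis Un_commute Un_left_commute)
  hence "(\<Sum>z\<in>PiE G X. F z) = (\<Sum>y1\<in>fibre G X N zs. \<Sum>y\<in>fibre G X (K \<union> D) y1. F y)"
  proof -
    have "N \<inter> (K \<union> D) = {}" using K_N_disjoint D_N_disjoint by auto
    thus ?thesis using sum_fibre_Un[OF finite_G finite_X _ zs, of N "K \<union> D" F] \<open>PiE G X = _\<close> by simp
  qed
  also have "\<dots> = (\<Sum>y1\<in>fibre G X N zs. \<Sum>y2\<in>fibre G X K y1. \<Sum>y3\<in>fibre G X D y2. F y3)"
  proof (rule sum.cong[OF refl])
    fix y1 assume "y1 \<in> fibre G X N zs"
    hence y1: "y1 \<in> PiE G X" using fibre_subset by blast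
    show "(\<Sum>y\<in>fibre G X (K \<union> D) y1. F y) = (\<Sum>y2\<in>fibre G X K y1. \<Sum>y3\<in>fibre G X D y2. F y3)"
      by (rule sum_fibre_Un[OF finite_G finite_X _ y1]) (use K_D_disjoint in auto)
  qed
  finally show ?thesis .
qed

lemma sum_fibre_D_joint:
  assumes y2: "y2 \<in> PiE G X" and H: "\<forall>y3\<in>fibre G X D y2. H y3 = H y2"
  shows "(\<Sum>y3\<in>fibre G X D y2. joint n y3 * H y3) = q n (restrict y2 N) * rho n y2 * H y2"
proof -
  have "(\<Sum>y3\<in>fibre G X D y2. joint n y3 * H y3) = (\<Sum>y3\<in>fibre G X D y2. (q n (restrict y2 N) * rho n y2 * H y2) * (\<Prod>d\<in>D. kern n d y3))"
  proof (rule sum.cong[OF refl])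
    fix y3 assume y3: "y3 \<in> fibre G X D y2"
    have ag: "\<forall>t. t \<notin> D \<longrightarrow> y3 t = y2 t" using fibre_agree[OF y3 y2] by blast
    have "restrict y3 N = restrict y2 N" using ag D_N_disjoint by (intro restrict_ext) auto
    moreover have "rho n y3 = rho n y2" by (rule rho_cong) (use ag K_D_disjoint PK_subset_N D_N_disjoint in blast)
    ultimately show "joint n y3 * H y3 = (q n (restrict y2 N) * rho n y2 * H y2) * (\<Prod>d\<in>D. kern n d y3)"
      unfolding joint_def using H y3 by simp
  qed
  also have "\<dots> = q n (restrict y2 N) * rho n y2 * H y2"
    using sum_fibre_prod_kern[OF D_subset y2, of n] by (simp add: sum_distrib_left[symmetric])
  finally show ?thesis .
qed

lemma fibre_K_agree:
  assumes "y2 \<in> fibre G X K y1" "y1 \<in> PiE G X"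
  shows "restrict y2 N = restrict y1 N" "\<forall>t\<in>PK. y2 t = y1 t"
proof -
  have ag: "\<forall>t. t \<notin> K \<longrightarrow> y2 t = y1 t" using fibre_agree[OF assms] by blast
  show "restrict y2 N = restrict y1 N" using ag K_N_disjoint by (intro restrict_ext) auto
  show "\<forall>t\<in>PK. y2 t = y1 t" using ag K_PK_disjoint by auto
qed

lemma sum_joint: "sum (joint n) (PiE G X) = 1"
proof -
  obtain zs where zs: "zs \<in> PiE G X" using configs_on_nonempty[of G] by auto
  have "sum (joint n) (PiE G X) = (\<Sum>y1\<in>fibre G X N zs. \<Sum>y2\<in>fibre G X K y1. \<Sum>y3\<in>fibre G X D y2. joint n y3 * 1)"
    using sum_configs_split[OF zs, of "joint n"] by simp
  also have "\<dots> = (\<Sum>y1\<in>fibre G X N zs. q n (restrict y1 N))"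
  proof (rule sum.cong[OF refl])
    fix y1 assume "y1 \<in> fibre G X N zs"
    hence y1: "y1 \<in> PiE G X" using fibre_subset by blast
    have "(\<Sum>y2\<in>fibre G X K y1. \<Sum>y3\<in>fibre G X D y2. joint n y3 * 1) = (\<Sum>y2\<in>fibre G X K y1. q n (restrict y1 N) * rho n y2)"
    proof (rule sum.cong[OF refl])
      fix y2 assume y2f: "y2 \<in> fibre G X K y1"
      hence y2: "y2 \<in> PiE G X" using fibre_subset by blast
      show "(\<Sum>y3\<in>fibre G X D y2. joint n y3 * 1) = q n (restrict y1 N) * rho n y2"
        using sum_fibre_D_joint[OF y2, of "\<lambda>_. 1"] fibre_K_agree[OF y2f y1] by simp
    qed
    also have "\<dots> = q n (restrict y1 N) * (\<Sum>y2\<in>fibre G X K y1. rho n y2)" by (simp add: sum_distrib_left)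
    also have "(\<Sum>y2\<in>fibre G X K y1. rho n y2) = cyl_mass X K (r n) (shielded y1 - K) y1 * (\<Prod>k\<in>K - shielded y1 - K. kern n k y1)"
      by (rule sum_fibre_rho[OF _ _ y1]) auto
    also have "\<dots> = 1"
    proof -
      have e1: "shielded y1 - K = {}" using shielded_subset by auto
      have e2: "K - shielded y1 - K = {}" by auto
      show ?thesis unfolding e1 e2 using cyl_mass_empty[OF K_subset] rsum by simp
    qed
    finally show "(\<Sum>y2\<in>fibre G X K y1. \<Sum>y3\<in>fibre G X D y2. joint n y3 * 1) = q n (restrict y1 N)" by (simp add: restrict_def)
  qed
  also have "\<dots> = sum (q n) (PiE N X)" by (rule sum_fibre_restrict[OF N_subset zs])
  also have "\<dots> = 1" using qsum by simp
  finally show ?thesis .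
qed

lemma joint_expectation:
  assumes Find: "\<forall>w\<in>PiE N X. F w \<noteq> 0 \<longrightarrow> restrict w PK = xP"
  shows "(\<Sum>z\<in>PiE G X. F (restrict z N) * f (restrict z K) * joint n z)
       = (\<Sum>w\<in>PiE N X. F w * q n w) * (\<Sum>u\<in>PiE K X. f u * r n u)"
proof -
  obtain zs where zs: "zs \<in> PiE G X" using configs_on_nonempty[of G] by auto
  define S where "S = (\<Sum>u\<in>PiE K X. f u * r n u)"
  define H where "H z = F (restrict z N) * f (restrict z K)" for z
  have "(\<Sum>z\<in>PiE G X. F (restrict z N) * f (restrict z K) * joint n z) = (\<Sum>y1\<in>fibre G X N zs. \<Sum>y2\<in>fibre G X K y1. \<Sum>y3\<in>fibre G X D y2. joint n y3 * H y3)"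
    using sum_configs_split[OF zs, of "\<lambda>z. joint n z * H z"] unfolding H_def by (simp add: algebra_simps)
  also have "\<dots> = (\<Sum>y1\<in>fibre G X N zs. F (restrict y1 N) * q n (restrict y1 N) * S)"
  proof (rule sum.cong[OF refl])
    fix y1 assume "y1 \<in> fibre G X N zs"
    hence y1: "y1 \<in> PiE G X" using fibre_subset by blast
    have "(\<Sum>y2\<in>fibre G X K y1. \<Sum>y3\<in>fibre G X D y2. joint n y3 * H y3) = (\<Sum>y2\<in>fibre G X K y1. q n (restrict y1 N) * rho n y2 * H y2)"
    proof (rule sum.cong[OF refl])
      fix y2 assume y2f: "y2 \<in> fibre G X K y1"
      hence y2: "y2 \<in> PiE G X" using fibre_subset by blast
      have "\<forall>y3\<in>fibre G X D y2. H y3 = H y2"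
      proof
        fix y3 assume y3: "y3 \<in> fibre G X D y2"
        have ag: "\<forall>t. t \<notin> D \<longrightarrow> y3 t = y2 t" using fibre_agree[OF y3 y2] by blast
        have "restrict y3 N = restrict y2 N" using ag D_N_disjoint by (intro restrict_ext) auto
        moreover have "restrict y3 K = restrict y2 K" using ag K_D_disjoint by (intro restrict_ext) auto
        ultimately show "H y3 = H y2" unfolding H_def by simp
      qed
      thus "(\<Sum>y3\<in>fibre G X D y2. joint n y3 * H y3) = q n (restrict y1 N) * rho n y2 * H y2"
        using sum_fibre_D_joint[OF y2] fibre_K_agree[OF y2f y1] by simp
    qed
    also have "\<dots> = F (restrict y1 N) * q n (restrict y1 N) * S"
    proof (cases "F (restrict y1 N) = 0")
      case True
      have "\<forall>y2\<in>fibre G X K y1. H y2 = 0" unfolding H_def using fibre_K_agree[OF _ y1] True by auto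
      thus ?thesis using True by simp
    next
      case False
      have rN: "restrict y1 N \<in> PiE N X" using restrict_in_PiE[OF y1 N_subset] .
      hence rPK: "restrict (restrict y1 N) PK = xP" using Find False by blast
      have y1PK: "\<forall>t\<in>PK. y1 t = xP t"
      proof
        fix t assume t: "t \<in> PK"
        hence "t \<in> N" using PK_subset_N by auto
        thus "y1 t = xP t" using fun_cong[OF rPK, of t] t by simp
      qed
      have "(\<Sum>y2\<in>fibre G X K y1. q n (restrict y1 N) * rho n y2 * H y2)
          = (\<Sum>y2\<in>fibre G X K y1. F (restrict y1 N) * q n (restrict y1 N) * (f (restrict y2 K) * r n (restrict y2 K)))"
      proof (rule sum.cong[OF refl])
        fix y2 assume y2f: "y2 \<in> fibre G X K y1"
        hence y2: "y2 \<in> PiE G X" using fibre_subset by blast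
        have "deviating y2 = {}" unfolding deviating_def using fibre_K_agree(2)[OF y2f y1] y1PK by auto
        hence A: "shielded y2 = K" unfolding shielded_def by auto
        have "rho n y2 = r n (restrict y2 K)" unfolding rho_def A using cyl_mass_full[OF K_subset y2] by simp
        thus "q n (restrict y1 N) * rho n y2 * H y2 = F (restrict y1 N) * q n (restrict y1 N) * (f (restrict y2 K) * r n (restrict y2 K))"
          unfolding H_def using fibre_K_agree(1)[OF y2f y1] by simp
      qed
      also have "\<dots> = F (restrict y1 N) * q n (restrict y1 N) * (\<Sum>y2\<in>fibre G X K y1. f (restrict y2 K) * r n (restrict y2 K))"
        by (simp add: sum_distrib_left)
      also have "(\<Sum>y2\<in>fibre G X K y1. f (restrict y2 K) * r n (restrict y2 K)) = S"
        unfolding S_def by (rule sum_fibre_restrict[OF K_subset y1])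
      finally show ?thesis .
    qed
    finally show "(\<Sum>y2\<in>fibre G X K y1. \<Sum>y3\<in>fibre G X D y2. joint n y3 * H y3) = F (restrict y1 N) * q n (restrict y1 N) * S" .
  qed
  also have "\<dots> = (\<Sum>w\<in>PiE N X. F w * q n w * S)"
    by (rule sum_fibre_restrict[OF N_subset zs])
  also have "\<dots> = (\<Sum>w\<in>PiE N X. F w * q n w) * S" by (simp add: sum_distrib_right)
  finally show ?thesis unfolding S_def .
qed


lemma par_disjoint_desc_closure:
  assumes s: "s \<in> G" and u: "u \<in> G" "u \<notin> insert s (desc G par s)"
  shows "par u \<inter> insert s (desc G par s) = {}"
proof (rule ccontr)
  assume "par u \<inter> insert s (desc G par s) \<noteq> {}"
  then obtain t where t: "t \<in> par u" "t = s \<or> t \<in> desc G par s" by auto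
  have "reaches s t" using t reaches_refl unfolding desc_iff by auto
  hence "u \<in> desc G par s" using child_in_desc[OF u(1) t(1)] by auto
  thus False using u by auto
qed

lemma desc_closure_agree:
  assumes "y \<in> fibre G X (insert s (desc G par s)) z0" "z0 \<in> PiE G X" "t \<notin> insert s (desc G par s)"
  shows "y t = z0 t"
  using fibre_agree[OF assms] .

lemma sum_fibre_desc_D_joint:
  assumes s: "s \<in> G" "s \<notin> D" and z0: "z0 \<in> PiE G X" and y2: "y2 \<in> fibre G X (insert s (desc G par s)) z0"
  shows "(\<Sum>y\<in>fibre G X (desc G par s \<inter> D) y2. joint n y) = q n (restrict y2 N) * rho n y2 * (\<Prod>d\<in>D - desc G par s. kern n d z0)"
proof -
  have y2P: "y2 \<in> PiE G X" using y2 fibre_subset by blast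
  have "(\<Sum>y\<in>fibre G X (desc G par s \<inter> D) y2. joint n y)
      = (\<Sum>y\<in>fibre G X (desc G par s \<inter> D) y2. (q n (restrict y2 N) * rho n y2 * (\<Prod>d\<in>D - desc G par s. kern n d z0)) * (\<Prod>d\<in>desc G par s \<inter> D. kern n d y))"
  proof (rule sum.cong[OF refl])
    fix y assume y: "y \<in> fibre G X (desc G par s \<inter> D) y2"
    have ag: "\<forall>t. t \<notin> D \<longrightarrow> y t = y2 t" using fibre_agree[OF y y2P] by blast
    have yW: "y \<in> fibre G X (insert s (desc G par s)) z0" using fibre_trans[OF y2 y] fibre_mono by blast
    have "restrict y N = restrict y2 N" using ag D_N_disjoint by (intro restrict_ext) auto
    moreover have "rho n y = rho n y2" by (rule rho_cong) (use ag K_D_disjoint PK_subset_N D_N_disjoint in blast)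
    moreover have "(\<Prod>d\<in>D. kern n d y) = (\<Prod>d\<in>D - desc G par s. kern n d y) * (\<Prod>d\<in>desc G par s \<inter> D. kern n d y)"
    proof -
      have fD: "finite D" using finite_subset[OF D_subset finite_G] .
      have "D = (D - desc G par s) \<union> (desc G par s \<inter> D)" by auto
      hence "(\<Prod>d\<in>D. kern n d y) = (\<Prod>d\<in>(D - desc G par s) \<union> (desc G par s \<inter> D). kern n d y)" by simp
      also have "\<dots> = (\<Prod>d\<in>D - desc G par s. kern n d y) * (\<Prod>d\<in>desc G par s \<inter> D. kern n d y)"
        by (rule prod.union_disjoint) (use fD in auto)
      finally show ?thesis .
    qed
    moreover have "(\<Prod>d\<in>D - desc G par s. kern n d y) = (\<Prod>d\<in>D - desc G par s. kern n d z0)"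
    proof (rule prod_kern_fibre_const[OF _ yW z0])
      show "\<forall>u\<in>D - desc G par s. u \<notin> insert s (desc G par s) \<and> par u \<inter> insert s (desc G par s) = {}"
        using par_disjoint_desc_closure[OF s(1)] s(2) D_subset by blast
    qed
    ultimately show "joint n y = (q n (restrict y2 N) * rho n y2 * (\<Prod>d\<in>D - desc G par s. kern n d z0)) * (\<Prod>d\<in>desc G par s \<inter> D. kern n d y)"
      unfolding joint_def by simp
  qed
  also have "\<dots> = q n (restrict y2 N) * rho n y2 * (\<Prod>d\<in>D - desc G par s. kern n d z0)"
  proof -
    have "(\<Sum>y\<in>fibre G X (desc G par s \<inter> D) y2. \<Prod>d\<in>desc G par s \<inter> D. kern n d y) = 1"
      by (rule sum_fibre_prod_kern[OF _ y2P]) (use D_subset in auto)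
    thus ?thesis by (simp add: sum_distrib_left[symmetric])
  qed
  finally show ?thesis .
qed

lemma fun_upd_desc_closure: "z0 \<in> PiE G X \<Longrightarrow> s \<in> G \<Longrightarrow> v \<in> X s \<Longrightarrow> y \<in> fibre G X W (z0(s:=v)) \<Longrightarrow> W \<subseteq> desc G par s \<Longrightarrow> y \<in> fibre G X (insert s (desc G par s)) z0"
  using fun_upd_fibre[of z0 s v y W] notin_desc_self fibre_mono by blast

lemma prod_kern_pos: "z0 \<in> PiE G X \<Longrightarrow> (\<Prod>d\<in>U. kern n d z0) > 0" if "U \<subseteq> G" for U
  using that by (intro prod_pos) (use kern_pos in blast)

lemma joint_ratio_D:
  assumes d: "d \<in> D" and z0: "z0 \<in> PiE G X"
  shows "cond_ratio (joint n) {z\<in>PiE G X. z d = z0 d} (cylinder G X (nondesc G par d) z0) = kern n d z0"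
proof -
  have dG: "d \<in> G" using d D_subset by auto
  define W where "W = insert d (desc G par d)"
  define Fac where "Fac = q n (restrict z0 N) * rho n z0 * (\<Prod>t\<in>D - W. kern n t z0)"
  have WD: "W \<subseteq> D" unfolding W_def using d desc_subset_D[OF d] by auto
  have num: "\<forall>v'\<in>X d. sum (joint n) (fibre G X (desc G par d) (z0(d:=v'))) = Fac * kern n d (z0(d:=v'))"
  proof
    fix v' assume v': "v' \<in> X d"
    define z1 where "z1 = z0(d:=v')"
    have z1P: "z1 \<in> PiE G X" unfolding z1_def by (rule fun_upd_in_PiE[OF z0 dG v'])
    have "sum (joint n) (fibre G X (desc G par d) z1) = (\<Sum>y\<in>fibre G X (desc G par d) z1. Fac * kern n d z1 * (\<Prod>t\<in>desc G par d. kern n t y))"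
    proof (rule sum.cong[OF refl])
      fix y assume y: "y \<in> fibre G X (desc G par d) z1"
      have yW: "y \<in> fibre G X W z0" unfolding W_def using fun_upd_desc_closure[OF z0 dG v'] y unfolding z1_def by blast
      have ag: "\<forall>t. t \<notin> W \<longrightarrow> y t = z0 t" using fibre_agree[OF yW z0] by blast
      have "restrict y N = restrict z0 N" using ag WD D_N_disjoint by (intro restrict_ext) auto
      moreover have "rho n y = rho n z0" by (rule rho_cong) (use ag WD K_D_disjoint PK_subset_N D_N_disjoint in blast)
      moreover have "(\<Prod>t\<in>D. kern n t y) = (\<Prod>t\<in>D - W. kern n t y) * kern n d y * (\<Prod>t\<in>desc G par d. kern n t y)"
      proof -
        have fD: "finite D" using finite_subset[OF D_subset finite_G] .
        have e: "D = (D - W) \<union> W" using WD by auto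
        have "(\<Prod>t\<in>D. kern n t y) = (\<Prod>t\<in>D - W. kern n t y) * (\<Prod>t\<in>W. kern n t y)"
          by (subst e, rule prod.union_disjoint) (use fD WD in \<open>auto intro: finite_subset\<close>)
        moreover have "(\<Prod>t\<in>W. kern n t y) = kern n d y * (\<Prod>t\<in>desc G par d. kern n t y)"
          unfolding W_def by (rule prod.insert) (use finite_subset[OF desc_subset finite_G] notin_desc_self in auto)
        ultimately show ?thesis by simp
      qed
      moreover have "(\<Prod>t\<in>D - W. kern n t y) = (\<Prod>t\<in>D - W. kern n t z0)"
        by (rule prod_kern_fibre_const[OF _ yW z0]) (use par_disjoint_desc_closure[OF dG] D_subset in \<open>auto simp: W_def\<close>)
      moreover have "kern n d y = kern n d z1"
        by (rule kern_cong) (use fibre_agree[OF y z1P] notin_desc_self par_subset_nondesc[OF dG] desc_nondesc_disjoint in blast)+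
      ultimately show "joint n y = Fac * kern n d z1 * (\<Prod>t\<in>desc G par d. kern n t y)"
        unfolding joint_def Fac_def by simp
    qed
    also have "\<dots> = Fac * kern n d z1" using sum_fibre_prod_kern[OF desc_subset z1P] by (simp add: sum_distrib_left[symmetric])
    finally show "sum (joint n) (fibre G X (desc G par d) (z0(d:=v'))) = Fac * kern n d (z0(d:=v'))" unfolding z1_def .
  qed
  have c1: "(\<Prod>t\<in>D - W. kern n t z0) > 0" by (rule prod_kern_pos) (use D_subset z0 in auto)
  have c2: "q n (restrict z0 N) > 0" using qpos restrict_in_PiE[OF z0 N_subset] by auto
  have Fpos: "Fac > 0" unfolding Fac_def using c1 c2 rho_pos[OF z0] by auto
  have "cond_ratio (joint n) {z\<in>PiE G X. z d = z0 d} (cylinder G X (nondesc G par d) z0) = kern n d (z0(d := z0 d)) / (\<Sum>v'\<in>X d. kern n d (z0(d:=v')))"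
    by (rule node_cond_ratio[OF dG z0 num]) (use Fpos in auto)
  thus ?thesis using kern_sum_one[OF dG z0] by simp
qed


lemma desc_child_closed: "u \<in> G \<Longrightarrow> t \<in> desc G par k \<Longrightarrow> t \<in> par u \<Longrightarrow> u \<in> desc G par k"
  using child_in_desc[of u t k] unfolding desc_iff by blast

lemma desc_K_split: "k \<in> K \<Longrightarrow> desc G par k = (desc G par k \<inter> K) \<union> (desc G par k \<inter> D)"
  using desc_subset_K_D by auto

lemma sum_fibre_desc_K_joint:
  assumes k: "k \<in> K" and z0: "z0 \<in> PiE G X" and v': "v' \<in> X k"
  shows "sum (joint n) (fibre G X (desc G par k) (z0(k:=v'))) = q n (restrict z0 N) * (\<Prod>d\<in>D - desc G par k. kern n d z0)
          * (cyl_mass X K (r n) (shielded z0 - desc G par k) (z0(k:=v')) * (\<Prod>j\<in>K - shielded z0 - desc G par k. kern n j (z0(k:=v'))))"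
proof -
  have kG: "k \<in> G" using k K_subset by auto
  have kD: "k \<notin> D" using k K_D_disjoint by auto
  define z1 where "z1 = z0(k:=v')"
  have z1P: "z1 \<in> PiE G X" unfolding z1_def by (rule fun_upd_in_PiE[OF z0 kG v'])
  define CD where "CD = (\<Prod>d\<in>D - desc G par k. kern n d z0)"
  have "sum (joint n) (fibre G X (desc G par k) z1) = (\<Sum>y2\<in>fibre G X (desc G par k \<inter> K) z1. \<Sum>y\<in>fibre G X (desc G par k \<inter> D) y2. joint n y)"
    using sum_fibre_Un[OF finite_G finite_X _ z1P, of "desc G par k \<inter> K" "desc G par k \<inter> D" "joint n"] desc_K_split[OF k] K_D_disjoint by auto
  also have "\<dots> = (\<Sum>y2\<in>fibre G X (desc G par k \<inter> K) z1. q n (restrict z0 N) * CD * rho n y2)"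
  proof (rule sum.cong[OF refl])
    fix y2 assume y2: "y2 \<in> fibre G X (desc G par k \<inter> K) z1"
    have y2W: "y2 \<in> fibre G X (insert k (desc G par k)) z0" using fun_upd_desc_closure[OF z0 kG v'] y2 unfolding z1_def by blast
    have "\<forall>t\<in>N. y2 t = z0 t"
    proof
      fix t assume t: "t \<in> N"
      hence "t \<notin> insert k (desc G par k)" using k K_N_disjoint D_N_disjoint desc_subset_K_D[OF k] by auto
      thus "y2 t = z0 t" using desc_closure_agree[OF y2W z0] by auto
    qed
    hence "restrict y2 N = restrict z0 N" by (intro restrict_ext) auto
    thus "(\<Sum>y\<in>fibre G X (desc G par k \<inter> D) y2. joint n y) = q n (restrict z0 N) * CD * rho n y2"
      using sum_fibre_desc_D_joint[OF kG kD z0 y2W] unfolding CD_def by simp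
  qed
  also have "\<dots> = q n (restrict z0 N) * CD * (\<Sum>y2\<in>fibre G X (desc G par k \<inter> K) z1. rho n y2)"
    by (simp add: sum_distrib_left)
  also have "(\<Sum>y2\<in>fibre G X (desc G par k \<inter> K) z1. rho n y2)
      = cyl_mass X K (r n) (shielded z1 - desc G par k \<inter> K) z1 * (\<Prod>j\<in>K - shielded z1 - desc G par k \<inter> K. kern n j z1)"
  proof (rule sum_fibre_rho[OF _ _ z1P])
    show "\<forall>u\<in>K. \<forall>t\<in>desc G par k \<inter> K. t \<in> par u \<longrightarrow> u \<in> desc G par k \<inter> K"
    proof (intro ballI impI)
      fix u t assume "u \<in> K" "t \<in> desc G par k \<inter> K" "t \<in> par u"
      thus "u \<in> desc G par k \<inter> K" using desc_child_closed[of u t k] K_subset by auto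
    qed
  qed auto
  also have "shielded z1 = shielded z0" by (rule shielded_cong) (use k K_PK_disjoint in \<open>auto simp: z1_def\<close>)
  also have "shielded z0 - desc G par k \<inter> K = shielded z0 - desc G par k" using shielded_subset by auto
  also have "K - shielded z0 - desc G par k \<inter> K = K - shielded z0 - desc G par k" by auto
  finally show ?thesis unfolding z1_def CD_def .
qed

lemma prod_kern_K_pos: "z \<in> PiE G X \<Longrightarrow> A \<subseteq> K \<Longrightarrow> (\<Prod>j\<in>A. kern n j z) > 0"
  by (rule prod_pos) (use kern_pos K_subset in blast)

lemma joint_ratio_K_unshielded:
  assumes k: "k \<in> K" and z0: "z0 \<in> PiE G X" and kA: "k \<notin> shielded z0"
  shows "cond_ratio (joint n) {z\<in>PiE G X. z k = z0 k} (cylinder G X (nondesc G par k) z0) = kern n k z0"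
proof -
  have kG: "k \<in> G" using k K_subset by auto
  define A where "A = shielded z0 - desc G par k"
  define U where "U = K - shielded z0 - desc G par k - {k}"
  define Fac where "Fac = q n (restrict z0 N) * (\<Prod>d\<in>D - desc G par k. kern n d z0) * (cyl_mass X K (r n) A z0 * (\<Prod>j\<in>U. kern n j z0))"
  have num: "\<forall>v'\<in>X k. sum (joint n) (fibre G X (desc G par k) (z0(k:=v'))) = Fac * kern n k (z0(k:=v'))"
  proof
    fix v' assume v': "v' \<in> X k"
    have e1: "cyl_mass X K (r n) A (z0(k:=v')) = cyl_mass X K (r n) A z0" by (rule cyl_mass_cong) (use kA in \<open>auto simp: A_def\<close>)
    have kin: "k \<in> K - shielded z0 - desc G par k" using k kA notin_desc_self by auto
    have fK: "finite (K - shielded z0 - desc G par k)" using finite_subset[OF K_subset finite_G] by auto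
    have e2: "(\<Prod>j\<in>K - shielded z0 - desc G par k. kern n j (z0(k:=v'))) = kern n k (z0(k:=v')) * (\<Prod>j\<in>U. kern n j (z0(k:=v')))"
      unfolding U_def using prod.remove[OF fK kin] by simp
    have e3: "(\<Prod>j\<in>U. kern n j (z0(k:=v'))) = (\<Prod>j\<in>U. kern n j z0)"
    proof (rule prod.cong[OF refl])
      fix j assume j: "j \<in> U"
      have "k \<notin> par j"
      proof
        assume "k \<in> par j"
        hence "j \<in> desc G par k" using child_in_desc[of j k k] j K_subset reaches_refl unfolding U_def by auto
        thus False using j unfolding U_def by auto
      qed
      thus "kern n j (z0(k:=v')) = kern n j z0" by (intro kern_cong) (use j U_def in auto)
    qed
    show "sum (joint n) (fibre G X (desc G par k) (z0(k:=v'))) = Fac * kern n k (z0(k:=v'))"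
      unfolding sum_fibre_desc_K_joint[OF k z0 v'] Fac_def A_def[symmetric] e1 e2 e3 by simp
  qed
  have Fpos: "Fac > 0"
  proof -
    have "q n (restrict z0 N) > 0" using qpos restrict_in_PiE[OF z0 N_subset] by auto
    moreover have "(\<Prod>d\<in>D - desc G par k. kern n d z0) > 0" by (rule prod_kern_pos) (use D_subset z0 in auto)
    moreover have "cyl_mass X K (r n) A z0 > 0" by (rule cyl_mass_pos[OF z0]) (use shielded_subset in \<open>auto simp: A_def\<close>)
    moreover have "(\<Prod>j\<in>U. kern n j z0) > 0" by (rule prod_kern_K_pos[OF z0]) (auto simp: U_def)
    ultimately show ?thesis unfolding Fac_def by auto
  qed
  have "cond_ratio (joint n) {z\<in>PiE G X. z k = z0 k} (cylinder G X (nondesc G par k) z0) = kern n k (z0(k := z0 k)) / (\<Sum>v'\<in>X k. kern n k (z0(k:=v')))"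
    by (rule node_cond_ratio[OF kG z0 num]) (use Fpos in auto)
  thus ?thesis using kern_sum_one[OF kG z0] by simp
qed

lemma joint_ratio_K_shielded:
  assumes k: "k \<in> K" and z0: "z0 \<in> PiE G X" and kA: "k \<in> shielded z0"
  shows "cond_ratio (joint n) {z\<in>PiE G X. z k = z0 k} (cylinder G X (nondesc G par k) z0)
       = cond_ratio (r n) {u\<in>PiE K X. u k = z0 k} (cylinder K X (shielded z0 - desc G par k - {k}) z0)"
proof -
  have kG: "k \<in> G" using k K_subset by auto
  define A where "A = shielded z0 - desc G par k"
  define U where "U = K - shielded z0 - desc G par k"
  define Fac where "Fac = q n (restrict z0 N) * (\<Prod>d\<in>D - desc G par k. kern n d z0) * (\<Prod>j\<in>U. kern n j z0)"
  have num: "\<forall>v'\<in>X k. sum (joint n) (fibre G X (desc G par k) (z0(k:=v'))) = Fac * cyl_mass X K (r n) A (z0(k:=v'))"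
  proof
    fix v' assume v': "v' \<in> X k"
    have e3: "(\<Prod>j\<in>U. kern n j (z0(k:=v'))) = (\<Prod>j\<in>U. kern n j z0)"
    proof (rule prod.cong[OF refl])
      fix j assume j: "j \<in> U"
      have "k \<notin> par j"
      proof
        assume "k \<in> par j"
        hence "j \<in> desc G par k" using child_in_desc[of j k k] j K_subset reaches_refl unfolding U_def by auto
        thus False using j unfolding U_def by auto
      qed
      moreover have "j \<noteq> k" using j kA unfolding U_def by auto
      ultimately show "kern n j (z0(k:=v')) = kern n j z0" by (intro kern_cong) auto
    qed
    show "sum (joint n) (fibre G X (desc G par k) (z0(k:=v'))) = Fac * cyl_mass X K (r n) A (z0(k:=v'))"
      unfolding sum_fibre_desc_K_joint[OF k z0 v'] Fac_def A_def[symmetric] U_def[symmetric] e3 by simp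
  qed
  have Fpos: "Fac > 0"
  proof -
    have "q n (restrict z0 N) > 0" using qpos restrict_in_PiE[OF z0 N_subset] by auto
    moreover have "(\<Prod>d\<in>D - desc G par k. kern n d z0) > 0" by (rule prod_kern_pos) (use D_subset z0 in auto)
    moreover have "(\<Prod>j\<in>U. kern n j z0) > 0" by (rule prod_kern_K_pos[OF z0]) (auto simp: U_def)
    ultimately show ?thesis unfolding Fac_def by auto
  qed
  have kA': "k \<in> A" using kA notin_desc_self unfolding A_def by auto
  have AK: "A \<subseteq> K" using shielded_subset unfolding A_def by auto
  have "cond_ratio (joint n) {z\<in>PiE G X. z k = z0 k} (cylinder G X (nondesc G par k) z0)
      = cyl_mass X K (r n) A (z0(k := z0 k)) / (\<Sum>v'\<in>X k. cyl_mass X K (r n) A (z0(k:=v')))"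
    by (rule node_cond_ratio[OF kG z0 num]) (use Fpos in auto)
  also have "(\<Sum>v'\<in>X k. cyl_mass X K (r n) A (z0(k:=v'))) = cyl_mass X K (r n) (A - {k}) z0"
  proof -
    have "(\<Sum>v'\<in>X k. cyl_mass X K (r n) A (z0(k:=v'))) = (\<Sum>y1\<in>fibre G X {k} z0. cyl_mass X K (r n) A y1)"
      by (rule sum_fibre_singleton[OF kG z0, symmetric])
    also have "\<dots> = cyl_mass X K (r n) (A - {k}) z0" by (rule sum_fibre_cyl_mass[OF K_subset _ _ z0]) (use kA' k in auto)
    finally show ?thesis .
  qed
  also have "cyl_mass X K (r n) A (z0(k := z0 k)) = sum (r n) ({u\<in>PiE K X. u k = z0 k} \<inter> cylinder K X (A - {k}) z0)"
  proof -
    have "{u\<in>PiE K X. u k = z0 k} \<inter> cylinder K X (A - {k}) z0 = cylinder K X A z0" unfolding cylinder_def using kA' by auto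
    thus ?thesis using cyl_mass_eq_sum[OF K_subset] by simp
  qed
  also have "cyl_mass X K (r n) (A - {k}) z0 = sum (r n) (cylinder K X (A - {k}) z0)" by (rule cyl_mass_eq_sum[OF K_subset])
  finally show ?thesis unfolding cond_ratio_def A_def by simp
qed

lemma shielded_desc_closure:
  assumes s: "s \<in> G" "s \<notin> K" and z0: "z0 \<in> PiE G X" and y: "y \<in> fibre G X (insert s (desc G par s)) z0"
  shows "shielded y - desc G par s = shielded z0 - desc G par s"
proof -
  have "k \<in> shielded y \<longleftrightarrow> k \<in> shielded z0" if k: "k \<in> K" "k \<notin> desc G par s" for k
  proof -
    have noW: "\<not> reaches t k" if "t \<in> insert s (desc G par s)" for t
    proof
      assume p: "reaches t k"
      have "reaches s t" using that reaches_refl desc_iff by auto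
      hence "reaches s k" using reaches_trans p by blast
      moreover have "s \<noteq> k" using s k by auto
      ultimately have "k \<in> desc G par s" using k K_subset unfolding desc_iff by auto
      thus False using k by auto
    qed
    have ag: "y t = z0 t" if "reaches t k" for t
    proof -
      have "t \<notin> insert s (desc G par s)" using noW that by blast
      thus ?thesis using desc_closure_agree[OF y z0] by blast
    qed
    have "(\<forall>t\<in>deviating y. \<not> reaches t k) \<longleftrightarrow> (\<forall>t\<in>deviating z0. \<not> reaches t k)"
      unfolding deviating_def using ag by auto
    thus ?thesis unfolding shielded_def using k by auto
  qed
  thus ?thesis using shielded_subset by blast
qed

lemma sum_fibre_desc_KD_joint:
  assumes s: "s \<in> N" and z0: "z0 \<in> PiE G X" and y1W: "y1 \<in> fibre G X (insert s (desc G par s)) z0"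
  shows "(\<Sum>y\<in>fibre G X (desc G par s \<inter> K \<union> desc G par s \<inter> D) y1. joint n y)
       = q n (restrict y1 N) * (\<Prod>d\<in>D - desc G par s. kern n d z0)
         * (cyl_mass X K (r n) (shielded z0 - desc G par s) z0
            * (\<Prod>j\<in>K - (shielded z0 - desc G par s) - desc G par s. kern n j z0))"
proof -
  have sG: "s \<in> G" using s N_subset by auto
  have sK: "s \<notin> K" "s \<notin> D" using s K_N_disjoint D_N_disjoint by auto
  have y1P: "y1 \<in> PiE G X" using y1W fibre_subset by blast
  define Ks where "Ks = desc G par s \<inter> K"
  define A where "A = shielded z0 - desc G par s"
  define U where "U = K - A - desc G par s"
  define CD where "CD = (\<Prod>d\<in>D - desc G par s. kern n d z0)"
  have "(\<Sum>y\<in>fibre G X (Ks \<union> desc G par s \<inter> D) y1. joint n y)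
      = (\<Sum>y2\<in>fibre G X Ks y1. \<Sum>y\<in>fibre G X (desc G par s \<inter> D) y2. joint n y)"
    by (rule sum_fibre_Un[OF finite_G finite_X _ y1P]) (use K_D_disjoint in \<open>auto simp: Ks_def\<close>)
  also have "\<dots> = (\<Sum>y2\<in>fibre G X Ks y1. q n (restrict y1 N) * CD * rho n y2)"
  proof (rule sum.cong[OF refl])
    fix y2 assume y2: "y2 \<in> fibre G X Ks y1"
    have y2W: "y2 \<in> fibre G X (insert s (desc G par s)) z0"
      using fibre_trans[OF y1W y2] fibre_mono[of y2 G X _ z0 "insert s (desc G par s)"] unfolding Ks_def by blast
    have "restrict y2 N = restrict y1 N"
      by (rule restrict_ext) (use fibre_agree[OF y2 y1P] K_N_disjoint in \<open>auto simp: Ks_def\<close>)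
    thus "(\<Sum>y\<in>fibre G X (desc G par s \<inter> D) y2. joint n y) = q n (restrict y1 N) * CD * rho n y2"
      using sum_fibre_desc_D_joint[OF sG sK(2) z0 y2W] unfolding CD_def by simp
  qed
  also have "\<dots> = q n (restrict y1 N) * CD * (\<Sum>y2\<in>fibre G X Ks y1. rho n y2)" by (simp add: sum_distrib_left)
  also have "(\<Sum>y2\<in>fibre G X Ks y1. rho n y2) = cyl_mass X K (r n) (shielded y1 - Ks) y1 * (\<Prod>j\<in>K - shielded y1 - Ks. kern n j y1)"
  proof (rule sum_fibre_rho[OF _ _ y1P])
    show "\<forall>u\<in>K. \<forall>t\<in>Ks. t \<in> par u \<longrightarrow> u \<in> Ks"
      using desc_child_closed K_subset unfolding Ks_def by blast
  qed (auto simp: Ks_def)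
  also have "\<dots> = cyl_mass X K (r n) A z0 * (\<Prod>j\<in>U. kern n j z0)"
  proof -
    have a1: "shielded y1 - Ks = A" unfolding A_def Ks_def using shielded_desc_closure[OF sG sK(1) z0 y1W] shielded_subset by blast
    have a2: "K - shielded y1 - Ks = U" unfolding U_def A_def Ks_def using shielded_desc_closure[OF sG sK(1) z0 y1W] shielded_subset by blast
    have "\<forall>t\<in>A. y1 t = z0 t"
    proof
      fix t assume "t \<in> A"
      hence "t \<notin> insert s (desc G par s)" using shielded_subset sK unfolding A_def by auto
      thus "y1 t = z0 t" using desc_closure_agree[OF y1W z0] by blast
    qed
    hence "cyl_mass X K (r n) A y1 = cyl_mass X K (r n) A z0" by (rule cyl_mass_cong)
    moreover have "(\<Prod>j\<in>U. kern n j y1) = (\<Prod>j\<in>U. kern n j z0)"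
      by (rule prod_kern_fibre_const[OF _ y1W z0]) (use par_disjoint_desc_closure[OF sG] K_subset sK in \<open>auto simp: U_def\<close>)
    ultimately show ?thesis unfolding a1 a2 by simp
  qed
  finally show ?thesis unfolding Ks_def CD_def A_def U_def .
qed

lemma sum_fibre_desc_N_joint:
  assumes s: "s \<in> N" and z0: "z0 \<in> PiE G X" and v': "v' \<in> X s"
  shows "sum (joint n) (fibre G X (desc G par s) (z0(s:=v')))
       = (\<Prod>d\<in>D - desc G par s. kern n d z0)
         * (cyl_mass X K (r n) (shielded z0 - desc G par s) z0
            * (\<Prod>j\<in>K - (shielded z0 - desc G par s) - desc G par s. kern n j z0))
         * cyl_mass X N (q n) (N - desc G par s \<inter> N) (z0(s:=v'))"
    (is "_ = ?C * ?cyl")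
proof -
  have sG: "s \<in> G" using s N_subset by auto
  define Ns where "Ns = desc G par s \<inter> N"
  define z1 where "z1 = z0(s:=v')"
  have z1P: "z1 \<in> PiE G X" unfolding z1_def by (rule fun_upd_in_PiE[OF z0 sG v'])
  have "desc G par s = Ns \<union> (desc G par s \<inter> K \<union> desc G par s \<inter> D)"
    unfolding Ns_def using G_eq_K_D_N desc_subset by auto
  hence "sum (joint n) (fibre G X (desc G par s) z1)
      = (\<Sum>y1\<in>fibre G X Ns z1. \<Sum>y\<in>fibre G X (desc G par s \<inter> K \<union> desc G par s \<inter> D) y1. joint n y)"
    using sum_fibre_Un[OF finite_G finite_X _ z1P, of Ns "desc G par s \<inter> K \<union> desc G par s \<inter> D"]
      K_N_disjoint D_N_disjoint unfolding Ns_def by auto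
  also have "\<dots> = (\<Sum>y1\<in>fibre G X Ns z1. q n (restrict y1 N) * ?C)"
  proof (rule sum.cong[OF refl])
    fix y1 assume "y1 \<in> fibre G X Ns z1"
    hence "y1 \<in> fibre G X (insert s (desc G par s)) z0"
      using fun_upd_desc_closure[OF z0 sG v'] unfolding z1_def Ns_def by blast
    thus "(\<Sum>y\<in>fibre G X (desc G par s \<inter> K \<union> desc G par s \<inter> D) y1. joint n y) = q n (restrict y1 N) * ?C"
      using sum_fibre_desc_KD_joint[OF s z0] by (simp add: algebra_simps)
  qed
  also have "\<dots> = ?C * (\<Sum>y1\<in>fibre G X Ns z1. q n (restrict y1 N))"
    by (simp add: sum_distrib_right mult.commute)
  also have "(\<Sum>y1\<in>fibre G X Ns z1. q n (restrict y1 N)) = (\<Sum>y1\<in>fibre G X Ns z1. cyl_mass X N (q n) N y1)"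
    by (rule sum.cong[OF refl]) (simp add: cyl_mass_full[OF N_subset] fibre_subset[THEN subsetD])
  also have "(\<Sum>y1\<in>fibre G X Ns z1. cyl_mass X N (q n) N y1) = cyl_mass X N (q n) (N - Ns) z1"
    by (rule sum_fibre_cyl_mass[OF N_subset _ _ z1P]) (auto simp: Ns_def)
  finally show ?thesis unfolding z1_def Ns_def .
qed

lemma joint_ratio_N:
  assumes s: "s \<in> N" and z0: "z0 \<in> PiE G X"
  shows "cond_ratio (joint n) {z\<in>PiE G X. z s = z0 s} (cylinder G X (nondesc G par s) z0)
       = cond_ratio (q n) {w\<in>PiE N X. w s = z0 s} (cylinder N X (N \<inter> nondesc G par s) z0)"
proof -
  have sG: "s \<in> G" using s N_subset by auto
  define Ns where "Ns = desc G par s \<inter> N"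
  define A where "A = shielded z0 - desc G par s"
  define C where "C = (\<Prod>d\<in>D - desc G par s. kern n d z0)
         * (cyl_mass X K (r n) A z0 * (\<Prod>j\<in>K - A - desc G par s. kern n j z0))"
  have num: "\<forall>v'\<in>X s. sum (joint n) (fibre G X (desc G par s) (z0(s:=v'))) = C * cyl_mass X N (q n) (N - Ns) (z0(s:=v'))"
    using sum_fibre_desc_N_joint[OF s z0] unfolding C_def A_def Ns_def by blast
  have "C > 0"
  proof -
    have "(\<Prod>d\<in>D - desc G par s. kern n d z0) > 0" by (rule prod_kern_pos) (use D_subset z0 in auto)
    moreover have "cyl_mass X K (r n) A z0 > 0" by (rule cyl_mass_pos[OF z0]) (use shielded_subset in \<open>auto simp: A_def\<close>)
    moreover have "(\<Prod>j\<in>K - A - desc G par s. kern n j z0) > 0" by (rule prod_kern_K_pos[OF z0]) auto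
    ultimately show ?thesis unfolding C_def by auto
  qed
  have sNs: "s \<in> N - Ns" using s notin_desc_self unfolding Ns_def by auto
  have "cond_ratio (joint n) {z\<in>PiE G X. z s = z0 s} (cylinder G X (nondesc G par s) z0)
      = cyl_mass X N (q n) (N - Ns) (z0(s := z0 s)) / (\<Sum>v'\<in>X s. cyl_mass X N (q n) (N - Ns) (z0(s:=v')))"
    by (rule node_cond_ratio[OF sG z0 num]) (use \<open>C > 0\<close> in auto)
  also have "(\<Sum>v'\<in>X s. cyl_mass X N (q n) (N - Ns) (z0(s:=v'))) = cyl_mass X N (q n) (N - Ns - {s}) z0"
  proof -
    have "(\<Sum>v'\<in>X s. cyl_mass X N (q n) (N - Ns) (z0(s:=v'))) = (\<Sum>y1\<in>fibre G X {s} z0. cyl_mass X N (q n) (N - Ns) y1)"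
      by (rule sum_fibre_singleton[OF sG z0, symmetric])
    also have "\<dots> = cyl_mass X N (q n) (N - Ns - {s}) z0" by (rule sum_fibre_cyl_mass[OF N_subset _ _ z0]) (use sNs s in auto)
    finally show ?thesis .
  qed
  also have "N - Ns - {s} = N \<inter> nondesc G par s" unfolding Ns_def nondesc_def using N_subset by auto
  also have "cyl_mass X N (q n) (N - Ns) (z0(s := z0 s)) = sum (q n) ({w\<in>PiE N X. w s = z0 s} \<inter> cylinder N X (N \<inter> nondesc G par s) z0)"
  proof -
    have "{w\<in>PiE N X. w s = z0 s} \<inter> cylinder N X (N \<inter> nondesc G par s) z0 = cylinder N X (N - Ns) z0"
      unfolding cylinder_def Ns_def nondesc_def using s N_subset notin_desc_self[of s] by auto
    thus ?thesis using cyl_mass_eq_sum[OF N_subset] by simp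
  qed
  also have "cyl_mass X N (q n) (N \<inter> nondesc G par s) z0 = sum (q n) (cylinder N X (N \<inter> nondesc G par s) z0)" by (rule cyl_mass_eq_sum[OF N_subset])
  finally show ?thesis unfolding cond_ratio_def by simp
qed


lemma node_witness_agree:
  assumes s: "s \<in> G" and xN: "xN \<in> PiE (nondesc G par s) X" and t: "t \<in> nondesc G par s"
  shows "node_witness s xN v t = xN t"
proof -
  have ex: "\<forall>t\<in>nondesc G par s \<inter> G. default_ext G X (nondesc G par s) xN t = xN t"
    by (rule default_ext_in(2)[OF X_nonempty]) (use xN in auto)
  have "t \<noteq> s" "t \<in> G" using t unfolding nondesc_iff by auto
  thus ?thesis using ex t unfolding node_witness_def by auto
qed

lemma shielded_local_model:
  assumes k: "k \<in> K" and xN: "xN \<in> PiE (nondesc G par k) X" and kA: "k \<in> shielded xN"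
  shows "(\<lambda>v. if v \<in> X k then R {u\<in>PiE K X. u k = v} (cylinder K X (shielded xN - desc G par k - {k}) xN) else 0) \<in> M k (restrict xN (par k))"
proof -
  have kG: "k \<in> G" using k K_subset by auto
  define Nd where "Nd = nondesc K (sub_pa par K) k"
  have Nd: "Nd = nondesc G par k \<inter> K" unfolding Nd_def by (rule nondesc_sub_pa[OF closedK k])
  define C where "C = shielded xN - desc G par k - {k}"
  have CNd: "C \<subseteq> Nd"
  proof
    fix t assume t: "t \<in> C"
    hence tK: "t \<in> K" and tG: "t \<in> G" and td: "t \<notin> desc G par k" and tk: "t \<noteq> k"
      using shielded_subset K_subset unfolding C_def by auto
    have "\<not> reaches k t"
    proof
      assume "reaches k t"
      hence "t \<in> desc G par k" using tG tk unfolding desc_iff by auto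
      thus False using td by auto
    qed
    hence "t \<in> nondesc G par k" using tG tk unfolding nondesc_iff by auto
    thus "t \<in> Nd" using Nd tK by auto
  qed
  have fcpR: "full_cond_prob (PiE K X) R" using irr_ext_fcp[OF Rirr] .
  have xpP: "restrict xN (par k) \<in> PiE (par k) X" using xN par_subset_nondesc[OF kG] by (auto simp: PiE_def Pi_def)
  show ?thesis unfolding C_def[symmetric]
  proof (rule local_model_coarsen[OF finite_subset[OF K_subset finite_G] _ _ fcpR, of Nd C xN k "\<lambda>xN'. sub_M par M K xP k (restrict xN' (sub_pa par K k))"])
    show "\<forall>t\<in>K. finite (X t)" using finite_X K_subset by auto
    show "\<forall>t\<in>K. X t \<noteq> {}" using X_nonempty K_subset by auto
    show "Nd \<subseteq> K" using Nd by auto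
    show "C \<subseteq> Nd" by (rule CNd)
    show "\<forall>t\<in>C. xN t \<in> X t" using CNd Nd xN by auto
    show "\<forall>xN'\<in>PiE Nd X. (\<lambda>v. if v \<in> X k then R {z \<in> PiE K X. z k = v} {z \<in> PiE K X. restrict z Nd = xN'} else 0)
        \<in> sub_M par M K xP k (restrict xN' (sub_pa par K k))"
      unfolding Nd_def using irr_ext_local[OF Rirr k] by blast
    show "\<forall>xN'\<in>PiE Nd X. (\<forall>t\<in>C. xN' t = xN t) \<longrightarrow> sub_M par M K xP k (restrict xN' (sub_pa par K k)) = M k (restrict xN (par k))"
    proof (intro ballI impI)
      fix xN' assume ag: "\<forall>t\<in>C. xN' t = xN t"
      have "restrict (\<lambda>t. if t \<in> K then restrict xN' (sub_pa par K k) t else xP t) (par k) = restrict xN (par k)"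
      proof (rule restrict_ext)
        fix t assume t: "t \<in> par k"
        show "(if t \<in> K then restrict xN' (sub_pa par K k) t else xP t) = xN t"
        proof (cases "t \<in> K")
          case True
          have "t \<in> shielded xN" using shielded_par[OF kA t True] .
          moreover have "t \<in> nondesc G par k" using par_subset_nondesc[OF kG] t by auto
          ultimately have "t \<notin> desc G par k" "t \<noteq> k" using desc_nondesc_disjoint nondesc_iff by auto
          hence "t \<in> C" unfolding C_def using \<open>t \<in> shielded xN\<close> by auto
          thus ?thesis using True t ag unfolding sub_pa_def by auto
        next
          case False
          thus ?thesis using shielded_par_outside[OF kA t False] by simp
        qed
      qed
      thus "sub_M par M K xP k (restrict xN' (sub_pa par K k)) = M k (restrict xN (par k))"
        unfolding sub_M_def by simp
    qed
    show "convex_fun_set (M k (restrict xN (par k)))" using local_model_props[OF kG xpP] by auto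
  qed
qed

end
lemma cond_ratio_singleton_tendsto:
  assumes "\<forall>n. sum (h n) Om = 1"
    and "\<forall>A B. A \<subseteq> Om \<longrightarrow> B \<subseteq> Om \<longrightarrow> B \<noteq> {} \<longrightarrow> (\<lambda>n. cond_ratio (h n) A B) \<longlonglongrightarrow> L A B"
    and "w \<in> Om"
  shows "(\<lambda>n. h n w) \<longlonglongrightarrow> L {w} Om"
proof -
  have "cond_ratio (h n) {w} Om = h n w" for n unfolding cond_ratio_def using assms(1,3) by auto
  moreover have "(\<lambda>n. cond_ratio (h n) {w} Om) \<longlonglongrightarrow> L {w} Om"
    using assms(2)[rule_format, of "{w}" Om] assms(3) by auto
  ultimately show ?thesis by simp
qed

locale composition_limit = composition +
  fixes \<sigma> :: "nat \<Rightarrow> nat" and P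
  assumes subseq: "strict_mono \<sigma>" and P_fcp: "full_cond_prob (PiE G X) P"
    and P_lim: "\<forall>A B. A \<subseteq> PiE G X \<longrightarrow> B \<subseteq> PiE G X \<longrightarrow> B \<noteq> {} \<longrightarrow>
                  (\<lambda>n. cond_ratio (joint (\<sigma> n)) A B) \<longlonglongrightarrow> P A B"
begin

definition local_cond where
  "local_cond s xN = (\<lambda>v. if v \<in> X s then
     P {z\<in>PiE G X. z s = v} {z\<in>PiE G X. restrict z (nondesc G par s) = xN} else 0)"

lemma local_cond_limit:
  assumes s: "s \<in> G" and xN: "xN \<in> PiE (nondesc G par s) X" and v: "v \<in> X s"
  shows "(\<lambda>n. cond_ratio (joint (\<sigma> n)) {z\<in>PiE G X. z s = node_witness s xN v s}
            (cylinder G X (nondesc G par s) (node_witness s xN v))) \<longlonglongrightarrow> local_cond s xN v"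
proof -
  note zz = node_witness[OF s xN v]
  have "cylinder G X (nondesc G par s) (node_witness s xN v) \<noteq> {}"
    by (rule cylinder_nonempty[OF X_nonempty]) (use zz(1) nondesc_subset in \<open>auto simp: PiE_def Pi_def\<close>)
  hence "(\<lambda>n. cond_ratio (joint (\<sigma> n)) {z\<in>PiE G X. z s = node_witness s xN v s} (cylinder G X (nondesc G par s) (node_witness s xN v)))
      \<longlonglongrightarrow> P {z\<in>PiE G X. z s = node_witness s xN v s} (cylinder G X (nondesc G par s) (node_witness s xN v))"
    by (intro P_lim[rule_format] cylinder_subset) auto
  thus ?thesis unfolding local_cond_def zz(3) zz(4) using v by simp
qed

lemma subseq_tendsto:
  "(\<lambda>n. a n) \<longlonglongrightarrow> l \<Longrightarrow> (\<lambda>n. a (\<sigma> n)) \<longlonglongrightarrow> l"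
  using LIMSEQ_subseq_LIMSEQ[OF _ subseq] by (simp add: o_def)

text \<open>Where the conditional ratios of the approximants equal the perturbed kernels, the limit is the
  chosen local model, because the perturbation vanishes.\<close>

lemma local_cond_chosen:
  assumes s: "s \<in> G" and xN: "xN \<in> PiE (nondesc G par s) X"
    and kern_ratio: "\<forall>v\<in>X s. \<forall>n. cond_ratio (joint n) {z\<in>PiE G X. z s = node_witness s xN v s}
        (cylinder G X (nondesc G par s) (node_witness s xN v)) = kern n s (node_witness s xN v)"
  shows "local_cond s xN \<in> M s (restrict xN (par s))"
proof -
  have xpP: "restrict xN (par s) \<in> PiE (par s) X" using xN par_subset_nondesc[OF s] by (auto simp: PiE_def Pi_def)
  have "local_cond s xN = chosen s (restrict xN (par s))"
  proof
    fix v show "local_cond s xN v = chosen s (restrict xN (par s)) v"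
    proof (cases "v \<in> X s")
      case False thus ?thesis using chosen_in(2)[OF s xpP] unfolding is_pmf_on_def local_cond_def by auto
    next
      case v: True
      note zz = node_witness[OF s xN v]
      have "(\<lambda>n. kern (\<sigma> n) s (node_witness s xN v)) \<longlonglongrightarrow> chosen s (restrict (node_witness s xN v) (par s)) (node_witness s xN v s)"
        by (rule subseq_tendsto[OF kern_tendsto])
      moreover have "(\<lambda>n. kern (\<sigma> n) s (node_witness s xN v)) \<longlonglongrightarrow> local_cond s xN v"
        using local_cond_limit[OF s xN v] kern_ratio v by simp
      ultimately show ?thesis using LIMSEQ_unique zz(2) zz(5) by metis
    qed
  qed
  thus ?thesis using chosen_in(1)[OF s xpP] by simp
qed

lemma local_cond_D:
  assumes d: "s \<in> D" and xN: "xN \<in> PiE (nondesc G par s) X"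
  shows "local_cond s xN \<in> M s (restrict xN (par s))"
  using d D_subset by (intro local_cond_chosen xN) (auto simp: joint_ratio_D node_witness(1)[OF _ xN])

lemma shielded_node_witness:
  assumes k: "s \<in> K" and xN: "xN \<in> PiE (nondesc G par s) X"
  shows "shielded (node_witness s xN v) = shielded xN"
proof (rule shielded_cong, rule ballI)
  fix t assume "t \<in> PK"
  hence "t \<in> nondesc G par s" using PK_subset_N N_subset_nondesc_K[OF k] by auto
  thus "node_witness s xN v t = xN t" using k K_subset xN by (intro node_witness_agree) auto
qed

lemma local_cond_K_shielded:
  assumes k: "s \<in> K" and xN: "xN \<in> PiE (nondesc G par s) X" and sh: "s \<in> shielded xN"
  shows "local_cond s xN \<in> M s (restrict xN (par s))"
proof -
  have s: "s \<in> G" using k K_subset by auto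
  define C where "C = shielded xN - desc G par s - {s}"
  have CN: "C \<subseteq> nondesc G par s"
  proof
    fix t assume t: "t \<in> C"
    hence "t \<in> G" "t \<noteq> s" "t \<notin> desc G par s" using shielded_subset K_subset unfolding C_def by auto
    thus "t \<in> nondesc G par s" using desc_iff nondesc_iff by auto
  qed
  have "local_cond s xN = (\<lambda>v. if v \<in> X s then R {u\<in>PiE K X. u s = v} (cylinder K X C xN) else 0)"
  proof
    fix v show "local_cond s xN v = (if v \<in> X s then R {u\<in>PiE K X. u s = v} (cylinder K X C xN) else 0)"
    proof (cases "v \<in> X s")
      case v: True
      note zz = node_witness[OF s xN v]
      have "\<forall>t\<in>C. node_witness s xN v t = xN t" using CN node_witness_agree[OF s xN] by blast
      hence cyleq: "cylinder K X C (node_witness s xN v) = cylinder K X C xN" unfolding cylinder_def by auto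
      have r1: "(\<lambda>n. cond_ratio (joint (\<sigma> n)) {z\<in>PiE G X. z s = node_witness s xN v s} (cylinder G X (nondesc G par s) (node_witness s xN v)))
          = (\<lambda>n. cond_ratio (r (\<sigma> n)) {u\<in>PiE K X. u s = v} (cylinder K X C xN))"
        using joint_ratio_K_shielded[OF k zz(1)] shielded_node_witness[OF k xN] sh zz(2) cyleq
        unfolding C_def by auto
      have "cylinder K X C xN \<noteq> {}"
        by (rule cylinder_nonempty) (use X_nonempty K_subset xN CN shielded_subset[of xN] in \<open>auto simp: C_def\<close>)
      hence "(\<lambda>n. cond_ratio (r (\<sigma> n)) {u\<in>PiE K X. u s = v} (cylinder K X C xN)) \<longlonglongrightarrow> R {u\<in>PiE K X. u s = v} (cylinder K X C xN)"
        by (intro subseq_tendsto rlim[rule_format] cylinder_subset) auto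
      thus ?thesis using LIMSEQ_unique local_cond_limit[OF s xN v, unfolded r1] v by auto
    qed (simp add: local_cond_def)
  qed
  thus ?thesis using shielded_local_model[OF k xN sh] unfolding C_def by simp
qed

lemma local_cond_K:
  assumes k: "s \<in> K" and xN: "xN \<in> PiE (nondesc G par s) X"
  shows "local_cond s xN \<in> M s (restrict xN (par s))"
proof (cases "s \<in> shielded xN")
  case False
  have "s \<in> G" using k K_subset by auto
  thus ?thesis
    using joint_ratio_K_unshielded[OF k] node_witness(1)[OF _ xN] shielded_node_witness[OF k xN] False
    by (intro local_cond_chosen xN) auto
qed (rule local_cond_K_shielded[OF k xN])

lemma local_cond_N:
  assumes sN: "s \<in> N" and xN: "xN \<in> PiE (nondesc G par s) X"
  shows "local_cond s xN \<in> M s (restrict xN (par s))"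
proof -
  have s: "s \<in> G" using sN N_subset by auto
  define Nn where "Nn = N \<inter> nondesc G par s"
  have Nn': "nondesc N (sub_pa par N) s = Nn" unfolding Nn_def using nondesc_sub_pa[OF closed_set_N sN] by auto
  define xn where "xn = restrict xN Nn"
  have xn: "xn \<in> PiE (nondesc N (sub_pa par N) s) X" unfolding Nn' xn_def Nn_def using xN by (auto simp: PiE_def Pi_def)
  have QM: "(\<lambda>v. if v \<in> X s then Q {z\<in>PiE N X. z s = v} {z\<in>PiE N X. restrict z Nn = xn} else 0)
      \<in> M s (restrict (restrict xn (sub_pa par N s)) (par s))"
    using irr_ext_local[OF Qirr sN xn] unfolding Nn' by simp
  have parsNn: "par s \<subseteq> Nn" unfolding Nn_def using par_subset_N[OF sN] par_subset_nondesc[OF s] by auto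
  have e1: "restrict (restrict xn (sub_pa par N s)) (par s) = restrict xN (par s)"
    unfolding xn_def sub_pa_def using parsNn by (auto simp: restrict_def fun_eq_iff Nn_def)
  have "local_cond s xN = (\<lambda>v. if v \<in> X s then Q {z\<in>PiE N X. z s = v} {z\<in>PiE N X. restrict z Nn = xn} else 0)"
  proof
    fix v show "local_cond s xN v = (if v \<in> X s then Q {z\<in>PiE N X. z s = v} {z\<in>PiE N X. restrict z Nn = xn} else 0)"
    proof (cases "v \<in> X s")
      case v: True
      note zz = node_witness[OF s xN v]
      have xnP: "xn \<in> PiE Nn X" using xn Nn' by simp
      have "\<forall>t\<in>Nn. node_witness s xN v t = xn t"
        unfolding xn_def Nn_def using node_witness_agree[OF s xN] by auto
      hence cyleq: "{z\<in>PiE N X. restrict z Nn = xn} = cylinder N X Nn (node_witness s xN v)"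
        using restrict_eq_cylinder[OF xnP, of N] unfolding cylinder_def by auto
      have r1: "(\<lambda>n. cond_ratio (joint (\<sigma> n)) {z\<in>PiE G X. z s = node_witness s xN v s} (cylinder G X (nondesc G par s) (node_witness s xN v)))
          = (\<lambda>n. cond_ratio (q (\<sigma> n)) {w\<in>PiE N X. w s = v} {z\<in>PiE N X. restrict z Nn = xn})"
        using joint_ratio_N[OF sN zz(1)] zz(2) cyleq unfolding Nn_def by auto
      have ne: "{z\<in>PiE N X. restrict z Nn = xn} \<noteq> {}" unfolding cyleq
        by (rule cylinder_nonempty) (use X_nonempty N_subset zz(1) in \<open>auto simp: Nn_def PiE_def Pi_def\<close>)
      have "(\<lambda>n. cond_ratio (q (\<sigma> n)) {w\<in>PiE N X. w s = v} {z\<in>PiE N X. restrict z Nn = xn})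
          \<longlonglongrightarrow> Q {w\<in>PiE N X. w s = v} {z\<in>PiE N X. restrict z Nn = xn}"
        by (intro subseq_tendsto qlim[rule_format] ne) auto
      thus ?thesis using LIMSEQ_unique local_cond_limit[OF s xN v, unfolded r1] v by auto
    qed (simp add: local_cond_def)
  qed
  thus ?thesis using QM e1 by simp
qed

lemma limit_in_irr_ext: "P \<in> irr_ext G par X M"
proof -
  have "local_cond s xN \<in> M s (restrict xN (par s))"
    if "s \<in> G" "xN \<in> PiE (nondesc G par s) X" for s xN
    using that G_eq_K_D_N local_cond_D local_cond_K local_cond_N by blast
  thus ?thesis unfolding irr_ext_def local_cond_def using P_fcp by blast
qed

lemma limit_expectation:
  assumes F_vanishes: "\<forall>w\<in>PiE N X. F w \<noteq> 0 \<longrightarrow> restrict w PK = xP"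
  shows "(\<Sum>z\<in>PiE G X. F (restrict z N) * f (restrict z K) * P {z} (PiE G X))
       = (\<Sum>w\<in>PiE N X. F w * Q {w} (PiE N X)) * (\<Sum>u\<in>PiE K X. f u * R {u} (PiE K X))"
proof -
  have qs: "(\<lambda>n. q (\<sigma> n) w) \<longlonglongrightarrow> Q {w} (PiE N X)" if "w \<in> PiE N X" for w
    using subseq_tendsto[OF cond_ratio_singleton_tendsto[OF qsum qlim that]] .
  have rs: "(\<lambda>n. r (\<sigma> n) u) \<longlonglongrightarrow> R {u} (PiE K X)" if "u \<in> PiE K X" for u
    using subseq_tendsto[OF cond_ratio_singleton_tendsto[OF rsum rlim that]] .
  have ps: "(\<lambda>n. joint (\<sigma> n) z) \<longlonglongrightarrow> P {z} (PiE G X)" if "z \<in> PiE G X" for z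
    by (rule cond_ratio_singleton_tendsto[OF _ P_lim that]) (simp add: sum_joint)
  have e: "(\<lambda>n. \<Sum>z\<in>PiE G X. F (restrict z N) * f (restrict z K) * joint (\<sigma> n) z)
      = (\<lambda>n. (\<Sum>w\<in>PiE N X. F w * q (\<sigma> n) w) * (\<Sum>u\<in>PiE K X. f u * r (\<sigma> n) u))"
    using joint_expectation[OF F_vanishes] by simp
  have l1: "(\<lambda>n. \<Sum>z\<in>PiE G X. F (restrict z N) * f (restrict z K) * joint (\<sigma> n) z)
      \<longlonglongrightarrow> (\<Sum>z\<in>PiE G X. F (restrict z N) * f (restrict z K) * P {z} (PiE G X))"
    by (intro tendsto_sum tendsto_mult tendsto_const ps)
  have l2: "(\<lambda>n. (\<Sum>w\<in>PiE N X. F w * q (\<sigma> n) w) * (\<Sum>u\<in>PiE K X. f u * r (\<sigma> n) u))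
      \<longlonglongrightarrow> (\<Sum>w\<in>PiE N X. F w * Q {w} (PiE N X)) * (\<Sum>u\<in>PiE K X. f u * R {u} (PiE K X))"
    by (intro tendsto_mult tendsto_sum tendsto_const qs rs)
  show ?thesis using LIMSEQ_unique[OF l1[unfolded e] l2] .
qed

end

context composition
begin

theorem composition_attains_product:
  "\<exists>P\<in>irr_ext G par X M. \<forall>F f. (\<forall>w\<in>PiE N X. F w \<noteq> 0 \<longrightarrow> restrict w PK = xP) \<longrightarrow>
     (\<Sum>z\<in>PiE G X. F (restrict z N) * f (restrict z K) * P {z} (PiE G X))
     = (\<Sum>w\<in>PiE N X. F w * Q {w} (PiE N X)) * (\<Sum>u\<in>PiE K X. f u * R {u} (PiE K X))"
proof -
  have "\<forall>n. \<forall>z\<in>PiE G X. joint n z > 0" using joint_pos by auto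
  then obtain \<sigma> P where "strict_mono \<sigma>" "full_cond_prob (PiE G X) P"
    "\<forall>A B. A \<subseteq> PiE G X \<longrightarrow> B \<subseteq> PiE G X \<longrightarrow> B \<noteq> {} \<longrightarrow> (\<lambda>n. cond_ratio (joint (\<sigma> n)) A B) \<longlonglongrightarrow> P A B"
    using fcp_cond_ratio_limit[OF finite_configs] by metis
  then interpret L: composition_limit G par K X M xP Q R q r \<sigma> P
    by (rule composition_limit.intro[OF composition_axioms composition_limit_axioms.intro])
  show ?thesis
    by (rule bexI[OF _ L.limit_in_irr_ext]) (intro allI impI L.limit_expectation)
qed

end


section \<open>The factorisation\<close>

lemma Inf_le_mult:
  fixes U V :: "real set"
  assumes V: "V \<noteq> {}" and u: "u \<in> U" "u \<ge> 0" and le: "\<forall>v\<in>V. L \<le> u * v"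
  shows "L \<le> Inf V * u"
proof (cases "u = 0")
  case True
  then show ?thesis using le V by fastforce
next
  case False
  hence u_pos: "u > 0" using u by simp
  have "L / u \<le> Inf V"
  proof (rule cInf_greatest[OF V])
    fix v assume "v \<in> V"
    hence "L \<le> v * u" using le by (metis mult.commute)
    thus "L / u \<le> v" using u_pos by (simp add: pos_divide_le_eq)
  qed
  thus ?thesis using u_pos by (simp add: field_simps)
qed

lemma Inf_eq_mult_Inf:
  fixes U W :: "real set"
  assumes U: "U \<noteq> {}" "bdd_below U" and W: "W \<noteq> {}" and a: "a \<ge> 0"
    and ge: "\<forall>w\<in>W. \<exists>u\<in>U. a * u \<le> w" and le: "\<forall>u\<in>U. Inf W \<le> a * u"
  shows "Inf W = a * Inf U"
proof (rule antisym)
  show "a * Inf U \<le> Inf W"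
  proof (rule cInf_greatest[OF W])
    fix w assume "w \<in> W"
    then obtain u where u: "u \<in> U" "a * u \<le> w" using ge by auto
    have "a * Inf U \<le> a * u" using cInf_lower[OF u(1) U(2)] a by (simp add: mult_left_mono)
    thus "a * Inf U \<le> w" using u by auto
  qed
  show "Inf W \<le> a * Inf U"
  proof (cases "a = 0")
    case True
    thus ?thesis using le U(1) by fastforce
  next
    case False
    hence a_pos: "a > 0" using a by simp
    have "Inf W / a \<le> Inf U"
      using le a_pos by (intro cInf_greatest[OF U(1)]) (simp add: field_simps mult.commute)
    thus ?thesis using a_pos by (simp add: field_simps)
  qed
qed

lemma Inf_eq_mult_Sup:
  fixes U W :: "real set"
  assumes U: "U \<noteq> {}" "bdd_above U" and W: "W \<noteq> {}" and a: "a \<le> 0"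
    and ge: "\<forall>w\<in>W. \<exists>u\<in>U. a * u \<le> w" and le: "\<forall>u\<in>U. Inf W \<le> a * u"
  shows "Inf W = a * Sup U"
proof -
  have "Inf W = (- a) * Inf (uminus ` U)"
    by (rule Inf_eq_mult_Inf) (use U W a ge le in \<open>auto simp: algebra_simps\<close>)
  moreover have "Inf (uminus ` U) = - Sup U" by (simp add: Inf_real_def image_image)
  ultimately show ?thesis by simp
qed

text \<open>Applied below with W, U and V the expectation sets of the models of the whole network, of the
  sub-network on N and of the sub-network on K.\<close>

lemma Inf_product_cases:
  fixes U V W :: "real set"
  assumes ne: "U \<noteq> {}" "V \<noteq> {}" "W \<noteq> {}"
    and bd: "bdd_below U" "bdd_above U"
    and Unn: "\<forall>u\<in>U. u \<ge> 0"
    and ge: "\<forall>w\<in>W. \<exists>u\<in>U. Inf V * u \<le> w"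
    and le: "\<forall>u\<in>U. \<forall>v\<in>V. Inf W \<le> u * v"
  shows "(Inf V \<ge> 0 \<longrightarrow> Inf W = Inf V * Inf U) \<and> (Inf V \<le> 0 \<longrightarrow> Inf W = Inf V * Sup U)"
proof -
  have "\<forall>u\<in>U. Inf W \<le> Inf V * u" using Inf_le_mult[OF ne(2)] Unn le by blast
  thus ?thesis using Inf_eq_mult_Inf[OF ne(1) bd(1) ne(3)] Inf_eq_mult_Sup[OF ne(1) bd(2) ne(3)] ge
    by blast
qed

lemma expectation_nonneg:
  assumes "full_cond_prob Om P" "Om \<noteq> {}" "\<forall>z\<in>Om. f z \<ge> 0"
  shows "(\<Sum>z\<in>Om. f z * P {z} Om) \<ge> 0"
  using assms fcp_singleton_bounds(1)[OF assms(1,2)] by (intro sum_nonneg) auto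

lemma lowE_irr_cong:
  "\<forall>z\<in>PiE S X. f z = g z \<Longrightarrow> lowE_irr S pa X M f = lowE_irr S pa X M g"
  unfolding lowE_irr_def by (metis (no_types, lifting) sum.cong)

lemma neg_lowE_irr_neg:
  "- lowE_irr S pa X M (\<lambda>z. - f z)
     = Sup {(\<Sum>z\<in>PiE S X. f z * P {z} (PiE S X)) | P. P \<in> irr_ext S pa X M}"
proof -
  have "{(\<Sum>z\<in>PiE S X. - f z * P {z} (PiE S X)) | P. P \<in> irr_ext S pa X M}
      = uminus ` {(\<Sum>z\<in>PiE S X. f z * P {z} (PiE S X)) | P. P \<in> irr_ext S pa X M}"
    by (auto simp: sum_negf image_iff)
  thus ?thesis unfolding lowE_irr_def Inf_real_def by (simp add: image_image)
qed

context credal_part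
begin

lemma product_expectation_attained:
  assumes xP: "xP \<in> PiE PK X"
    and Q: "Q \<in> irr_ext N (sub_pa par N) X (\<lambda>s z. M s (restrict z (par s)))"
    and R: "R \<in> irr_ext K (sub_pa par K) X (sub_M par M K xP)"
    and F_vanishes: "\<forall>w\<in>PiE N X. F w \<noteq> 0 \<longrightarrow> restrict w PK = xP"
  shows "\<exists>P\<in>irr_ext G par X M.
           (\<Sum>z\<in>PiE G X. F (restrict z N) * f (restrict z K) * P {z} (PiE G X))
         = (\<Sum>w\<in>PiE N X. F w * Q {w} (PiE N X)) * (\<Sum>u\<in>PiE K X. f u * R {u} (PiE K X))"
proof -
  obtain q where "\<forall>n. \<forall>z\<in>PiE N X. q n z > 0" "\<forall>n. sum (q n) (PiE N X) = 1"
    "\<forall>A B. A \<subseteq> PiE N X \<longrightarrow> B \<subseteq> PiE N X \<longrightarrow> B \<noteq> {} \<longrightarrow> (\<lambda>n. cond_ratio (q n) A B) \<longlonglongrightarrow> Q A B"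
    using fcp_positive_approx[OF finite_configs_on configs_on_nonempty irr_ext_fcp[OF Q]] N_subset by blast
  moreover obtain r where "\<forall>n. \<forall>z\<in>PiE K X. r n z > 0" "\<forall>n. sum (r n) (PiE K X) = 1"
    "\<forall>A B. A \<subseteq> PiE K X \<longrightarrow> B \<subseteq> PiE K X \<longrightarrow> B \<noteq> {} \<longrightarrow> (\<lambda>n. cond_ratio (r n) A B) \<longlonglongrightarrow> R A B"
    using fcp_positive_approx[OF finite_configs_on configs_on_nonempty irr_ext_fcp[OF R]] K_subset by blast
  ultimately interpret C: composition G par K X M xP Q R q r
    using xP Q R by (intro composition.intro credal_part_axioms composition_axioms.intro) auto
  show ?thesis using C.composition_attains_product F_vanishes by blast
qed

lemma lowE_irr_factorises:
  fixes F f
  assumes xP: "xP \<in> PiE PK X"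
    and F_nonneg: "\<forall>w\<in>PiE N X. F w \<ge> 0"
    and F_vanishes: "\<forall>w\<in>PiE N X. F w \<noteq> 0 \<longrightarrow> restrict w PK = xP"
  defines "a \<equiv> lowE_sub K par X M xP f"
  shows "(a \<ge> 0 \<longrightarrow> lowE_irr G par X M (\<lambda>z. F (restrict z N) * f (restrict z K)) = a * lowE_sub0 N par X M F)
       \<and> (a \<le> 0 \<longrightarrow> lowE_irr G par X M (\<lambda>z. F (restrict z N) * f (restrict z K)) = a * upE_sub0 N par X M F)"
proof -
  define irrN where "irrN = irr_ext N (sub_pa par N) X (\<lambda>s z. M s (restrict z (par s)))"
  define irrK where "irrK = irr_ext K (sub_pa par K) X (sub_M par M K xP)"
  define U where "U = {(\<Sum>w\<in>PiE N X. F w * Q {w} (PiE N X)) | Q. Q \<in> irrN}"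
  define V where "V = {(\<Sum>u\<in>PiE K X. f u * R {u} (PiE K X)) | R. R \<in> irrK}"
  define W where "W = {(\<Sum>z\<in>PiE G X. F (restrict z N) * f (restrict z K) * P {z} (PiE G X)) | P. P \<in> irr_ext G par X M}"
  have a: "a = Inf V" unfolding a_def V_def irrK_def lowE_sub_def lowE_irr_def ..
  have fcp: "\<forall>Q\<in>irrN. full_cond_prob (PiE N X) Q" "\<forall>R\<in>irrK. full_cond_prob (PiE K X) R"
    "\<forall>P\<in>irr_ext G par X M. full_cond_prob (PiE G X) P"
    unfolding irrN_def irrK_def using irr_ext_fcp by blast+
  have marg: "marg_N P \<in> irrN" if "P \<in> irr_ext G par X M" for P
    unfolding irrN_def by (rule marg_N_irr_ext[OF that])
  obtain P0 where P0: "P0 \<in> irr_ext G par X M" using irr_ext_nonempty by auto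
  define w0 where "w0 = default_ext N X PK xP"
  have "w0 \<in> PiE N X" unfolding w0_def
    by (rule default_ext_in(1)) (use X_nonempty N_subset xP PK_subset_N in auto)
  moreover have "restrict w0 PK = xP" unfolding w0_def
    by (rule restrict_default_ext) (use X_nonempty N_subset xP PK_subset_N in auto)
  ultimately have w0: "w0 \<in> PiE N X" "restrict w0 PK = xP" by simp_all
  have ne: "U \<noteq> {}" "V \<noteq> {}" "W \<noteq> {}"
    using marg[OF P0] cond_K_irr_ext[OF P0 w0(1)] P0
    unfolding U_def V_def W_def irrK_def w0(2) by auto
  note N_configs = configs_on_nonempty[OF N_subset] finite_configs_on[OF N_subset]
  have U_bdd: "bdd_below U" "bdd_above U" unfolding U_def
    using bdd_below_expectations[OF fcp(1) N_configs] bdd_above_expectations[OF fcp(1) N_configs] .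
  have W_bdd: "bdd_below W" unfolding W_def
    using bdd_below_expectations[OF fcp(3) configs_on_nonempty finite_configs] by simp
  have "\<forall>u\<in>U. u \<ge> 0"
    unfolding U_def using expectation_nonneg[OF _ N_configs(1)] fcp(1) F_nonneg by blast
  moreover have "\<forall>w\<in>W. \<exists>u\<in>U. Inf V * u \<le> w"
  proof
    fix w assume "w \<in> W"
    then obtain P where P: "P \<in> irr_ext G par X M"
      and w: "w = (\<Sum>z\<in>PiE G X. F (restrict z N) * f (restrict z K) * P {z} (PiE G X))"
      unfolding W_def by blast
    have "Inf V * (\<Sum>w\<in>PiE N X. F w * marg_N P {w} (PiE N X)) \<le> w"
      using expectation_lower_bound[OF P xP F_nonneg F_vanishes] unfolding w a[symmetric] a_def .
    moreover have "(\<Sum>w\<in>PiE N X. F w * marg_N P {w} (PiE N X)) \<in> U" unfolding U_def using marg[OF P] by blast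
    ultimately show "\<exists>u\<in>U. Inf V * u \<le> w" by blast
  qed
  moreover have "\<forall>u\<in>U. \<forall>v\<in>V. Inf W \<le> u * v"
  proof (intro ballI)
    fix u v assume "u \<in> U" "v \<in> V"
    then obtain P where P: "P \<in> irr_ext G par X M"
      and uv: "(\<Sum>z\<in>PiE G X. F (restrict z N) * f (restrict z K) * P {z} (PiE G X)) = u * v"
      using product_expectation_attained[OF xP _ _ F_vanishes] unfolding U_def V_def irrN_def irrK_def by blast
    have "u * v \<in> W" unfolding W_def uv[symmetric] using P by blast
    thus "Inf W \<le> u * v" by (rule cInf_lower[OF _ W_bdd])
  qed
  ultimately have cases: "(Inf V \<ge> 0 \<longrightarrow> Inf W = Inf V * Inf U) \<and> (Inf V \<le> 0 \<longrightarrow> Inf W = Inf V * Sup U)"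
    by (rule Inf_product_cases[OF ne U_bdd])
  have lowE_U: "lowE_sub0 N par X M F = Inf U"
    unfolding U_def irrN_def lowE_sub0_def lowE_irr_def ..
  have upE_U: "upE_sub0 N par X M F = Sup U"
    unfolding U_def irrN_def upE_sub0_def lowE_sub0_def neg_lowE_irr_neg ..
  have lowE_W: "lowE_irr G par X M (\<lambda>z. F (restrict z N) * f (restrict z K)) = Inf W"
    unfolding W_def lowE_irr_def ..
  show ?thesis unfolding a lowE_U upE_U lowE_W by (rule cases)
qed

end

theorem corollary1:
  fixes G :: "'n set" and par :: "'n \<Rightarrow> 'n set" and X :: "'n \<Rightarrow> 'v set"
    and M :: "'n \<Rightarrow> ('n \<Rightarrow> 'v) \<Rightarrow> ('v \<Rightarrow> real) set"
    and K :: "'n set" and f :: "('n \<Rightarrow> 'v) \<Rightarrow> real" and xP :: "'n \<Rightarrow> 'v"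
    and g :: "('n \<Rightarrow> 'v) \<Rightarrow> real"
  assumes net: "credal_network G par X M"
    and K_closed: "closed_set G par K"
    and xP: "xP \<in> PiE (parK G par K) X"
    and g_nonneg: "\<forall>y\<in>PiE (nondescK' G par K) X. g y \<ge> 0"
  defines "a \<equiv> lowE_sub K par X M xP f"
    and "\<phi> \<equiv> (\<lambda>z. g (restrict z (nondescK' G par K)) *
                  (if restrict z (parK G par K) = xP then 1 else 0))"
  shows "(a \<ge> 0 \<longrightarrow> lowE_irr G par X M (\<lambda>z. \<phi> z * f (restrict z K))
                      = a * lowE_sub0 (nondescK G par K) par X M \<phi>)
       \<and> (a \<le> 0 \<longrightarrow> lowE_irr G par X M (\<lambda>z. \<phi> z * f (restrict z K))
                      = a * upE_sub0 (nondescK G par K) par X M \<phi>)"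
proof -
  interpret credal_part G par K X M
    by unfold_locales (use net K_closed in \<open>auto simp: credal_network_def\<close>)
  have N'_N: "nondescK' G par K \<subseteq> N" unfolding nondescK'_def by auto
  have "\<phi> z = \<phi> (restrict z N)" for z
    using N'_N PK_subset_N unfolding \<phi>_def by (simp add: Int_absorb1 Int_absorb2)
  hence "lowE_irr G par X M (\<lambda>z. \<phi> z * f (restrict z K))
       = lowE_irr G par X M (\<lambda>z. \<phi> (restrict z N) * f (restrict z K))"
    by (intro lowE_irr_cong) simp
  moreover have "\<forall>w\<in>PiE N X. \<phi> w \<ge> 0"
  proof
    fix w assume "w \<in> PiE N X"
    hence "restrict w (nondescK' G par K) \<in> PiE (nondescK' G par K) X" by (rule restrict_in_PiE[OF _ N'_N])
    thus "\<phi> w \<ge> 0" using g_nonneg unfolding \<phi>_def by simp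
  qed
  moreover have "\<forall>w\<in>PiE N X. \<phi> w \<noteq> 0 \<longrightarrow> restrict w PK = xP" unfolding \<phi>_def by auto
  ultimately show ?thesis using lowE_irr_factorises[OF xP] unfolding a_def by simp
qed

end
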